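(* (1) Let $a,b\ge 0$ be integers with $a+b$ even, and put $m=\frac{a+b}{2}$. Then for every partition $\nu$, $$\bar{g}_{(m)\,(m)}^{\nu} \geq \bar{g}_{(a)\,(b)}^{\nu}.$$ (2) More strongly, let $i,j,k,l$ be nonnegative integers with $i<j\le k<l$ and $j+k=i+l$. Then for every partition $\nu$, $$\bar{g}_{(j)\,(k)}^{\nu} \geq \bar{g}_{(i)\,(l)}^{\nu}.$$
   Context: For a partition $\alpha$ of $d$, let $V_\alpha$ be the irreducible complex representation of the symmetric group $S_d$ indexed by $\alpha$. For partitions $\alpha,\beta,\gamma$ of $d$, the Kronecker coefficient $g_{\alpha\beta}^{\gamma}$ is the multiplicity of $V_\gamma$ in $V_\alpha\otimes V_\beta$ (with diagonal $S_d$-action). For a partition $\lambda=(\lambda_1\ge\lambda_2\ge\cdots)$ of any size and an integer $d\ge|\lambda|+\lambda_1$, the padded partition is $\lambda[d]=(d-|\lambda|,\lambda_1,\lambda_2,\dots)$, a partition of $d$. For arbitrary partitions $\lambda,\mu,\nu$ (not necessarily of the same size), the sequence $g_{\lambda[d]\,\mu[d]}^{\nu[d]}$ is constant for all sufficiently large $d$ (Murnaghan); its stable value is the reduced Kronecker coefficient $\bar g_{\lambda\mu}^{\nu}$. Here $(m)$ denotes the partition with the single part $m$, and $(0)$ is the empty partition. *)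

theory Defs
  imports Complex_Main "HOL-Library.FuncSet" "HOL-Library.Function_Algebras"
    "HOL-Combinatorics.Permutations"
begin

section \<open>Partitions\<close>

definition is_partition :: "nat list \<Rightarrow> bool"
  where "is_partition lam \<longleftrightarrow> sorted_wrt (\<ge>) lam \<and> 0 \<notin> set lam"

definition row_partition :: "nat \<Rightarrow> nat list"
  where "row_partition m = (if m = 0 then [] else [m])"

text \<open>The padded partition. It is meaningful for \<open>d\<close> at least the size of \<open>lam\<close> plus its
  largest part, which is all that matters for the stable value below.\<close>

definition padded :: "nat list \<Rightarrow> nat \<Rightarrow> nat list"
  where "padded lam d = row_partition (d - sum_list lam) @ lam"


section \<open>Complex representations on spaces of functions\<close>

definition cscale :: "complex \<Rightarrow> ('x \<Rightarrow> complex) \<Rightarrow> 'x \<Rightarrow> complex"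
  where "cscale c f = (\<lambda>x. c * f x)"

interpretation cfun: vector_space "cscale :: complex \<Rightarrow> ('x \<Rightarrow> complex) \<Rightarrow> 'x \<Rightarrow> complex"
  by unfold_locales (auto simp: cscale_def fun_eq_iff algebra_simps)

text \<open>A representation of \<open>G\<close> is given by a linear action \<open>\<rho>\<close> on the functions on some type and
  a \<open>\<rho>\<close>-stable subspace \<open>W\<close>.\<close>

definition subrep :: "'g set \<Rightarrow> ('g \<Rightarrow> ('x \<Rightarrow> complex) \<Rightarrow> 'x \<Rightarrow> complex) \<Rightarrow> ('x \<Rightarrow> complex) set \<Rightarrow> bool"
  where "subrep G \<rho> W \<longleftrightarrow> cfun.subspace W \<and> (\<forall>g\<in>G. \<forall>w\<in>W. \<rho> g w \<in> W)"

definition irreducible_rep ::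
    "'g set \<Rightarrow> ('g \<Rightarrow> ('x \<Rightarrow> complex) \<Rightarrow> 'x \<Rightarrow> complex) \<Rightarrow> ('x \<Rightarrow> complex) set \<Rightarrow> bool"
  where "irreducible_rep G \<rho> W \<longleftrightarrow> subrep G \<rho> W \<and> W \<noteq> {0} \<and>
    (\<forall>U. subrep G \<rho> U \<and> U \<subseteq> W \<longrightarrow> U = {0} \<or> U = W)"

text \<open>A linear map between subspaces always extends to the ambient spaces, so it is no
  restriction that the isomorphism \<open>T\<close> is a linear map of the ambient spaces.\<close>

definition rep_iso :: "'g set
    \<Rightarrow> ('g \<Rightarrow> ('x \<Rightarrow> complex) \<Rightarrow> 'x \<Rightarrow> complex) \<Rightarrow> ('x \<Rightarrow> complex) set
    \<Rightarrow> ('g \<Rightarrow> ('y \<Rightarrow> complex) \<Rightarrow> 'y \<Rightarrow> complex) \<Rightarrow> ('y \<Rightarrow> complex) set \<Rightarrow> bool"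
  where "rep_iso G \<rho> V \<sigma> W \<longleftrightarrow>
    (\<exists>T. Vector_Spaces.linear cscale cscale T \<and> bij_betw T V W \<and>
         (\<forall>g\<in>G. \<forall>v\<in>V. T (\<rho> g v) = \<sigma> g (T v)))"

text \<open>\<open>W\<close> is the internal direct sum of the irreducible subrepresentations \<open>U 0, \<dots>, U (N - 1)\<close>.\<close>

definition irreducible_decomposition :: "'g set \<Rightarrow> ('g \<Rightarrow> ('x \<Rightarrow> complex) \<Rightarrow> 'x \<Rightarrow> complex)
    \<Rightarrow> ('x \<Rightarrow> complex) set \<Rightarrow> nat \<Rightarrow> (nat \<Rightarrow> ('x \<Rightarrow> complex) set) \<Rightarrow> bool"
  where "irreducible_decomposition G \<rho> W N U \<longleftrightarrow>
    (\<forall>i<N. irreducible_rep G \<rho> (U i)) \<and>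
    bij_betw (\<lambda>u. \<Sum>i<N. u i) (\<Pi>\<^sub>E i\<in>{..<N}. U i) W"

text \<open>The multiplicity of the irreducible representation \<open>V\<close> in \<open>W\<close>: the number of summands
  isomorphic to \<open>V\<close> in a decomposition of \<open>W\<close> into irreducibles.  For finite \<open>G\<close> and
  finite-dimensional \<open>W\<close> a decomposition exists and this number does not depend on it.\<close>

definition multiplicity :: "'g set
    \<Rightarrow> ('g \<Rightarrow> ('x \<Rightarrow> complex) \<Rightarrow> 'x \<Rightarrow> complex) \<Rightarrow> ('x \<Rightarrow> complex) set
    \<Rightarrow> ('g \<Rightarrow> ('y \<Rightarrow> complex) \<Rightarrow> 'y \<Rightarrow> complex) \<Rightarrow> ('y \<Rightarrow> complex) set \<Rightarrow> nat"
  where "multiplicity G \<rho> V \<sigma> W =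
    (THE n. \<exists>N U. irreducible_decomposition G \<sigma> W N U \<and>
                  n = card {i. i < N \<and> rep_iso G \<rho> V \<sigma> (U i)})"


section \<open>The irreducible representations of the symmetric group\<close>

definition symgroup :: "nat \<Rightarrow> (nat \<Rightarrow> nat) set"
  where "symgroup d = {p. p permutes {..<d}}"

definition group_algebra :: "nat \<Rightarrow> ((nat \<Rightarrow> nat) \<Rightarrow> complex) set"
  where "group_algebra d = {f. \<forall>p. p \<notin> symgroup d \<longrightarrow> f p = 0}"

definition convolution :: "nat \<Rightarrow> ((nat \<Rightarrow> nat) \<Rightarrow> complex) \<Rightarrow> ((nat \<Rightarrow> nat) \<Rightarrow> complex)
    \<Rightarrow> (nat \<Rightarrow> nat) \<Rightarrow> complex"
  where "convolution d f h = (\<lambda>g. \<Sum>p\<in>symgroup d. f p * h (inv p \<circ> g))"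

text \<open>The boxes of the Young diagram of \<open>\<alpha>\<close> are numbered \<open>0, 1, \<dots>, d - 1\<close> row by row; the
  following are the row and the column (counted from 0) of the box with number \<open>x\<close>.\<close>

definition row_of :: "nat list \<Rightarrow> nat \<Rightarrow> nat"
  where "row_of \<alpha> x = (LEAST r. x < sum_list (take (Suc r) \<alpha>))"

definition col_of :: "nat list \<Rightarrow> nat \<Rightarrow> nat"
  where "col_of \<alpha> x = x - sum_list (take (row_of \<alpha> x) \<alpha>)"

definition row_sum :: "nat \<Rightarrow> nat list \<Rightarrow> (nat \<Rightarrow> nat) \<Rightarrow> complex"
  where "row_sum d \<alpha> p =
    (if p \<in> symgroup d \<and> (\<forall>x<d. row_of \<alpha> (p x) = row_of \<alpha> x) then 1 else 0)"

definition col_sum :: "nat \<Rightarrow> nat list \<Rightarrow> (nat \<Rightarrow> nat) \<Rightarrow> complex"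
  where "col_sum d \<alpha> p =
    (if p \<in> symgroup d \<and> (\<forall>x<d. col_of \<alpha> (p x) = col_of \<alpha> x) then of_int (sign p) else 0)"

definition young_symmetrizer :: "nat \<Rightarrow> nat list \<Rightarrow> (nat \<Rightarrow> nat) \<Rightarrow> complex"
  where "young_symmetrizer d \<alpha> = convolution d (row_sum d \<alpha>) (col_sum d \<alpha>)"

text \<open>The irreducible representation indexed by the partition \<open>\<alpha>\<close> of \<open>d\<close>, as the left ideal of the
  group algebra generated by the Young symmetrizer, with the action by left multiplication.  In
  this convention the one-row partition indexes the trivial representation.\<close>

definition specht :: "nat \<Rightarrow> nat list \<Rightarrow> ((nat \<Rightarrow> nat) \<Rightarrow> complex) set"
  where "specht d \<alpha> = (\<lambda>f. convolution d f (young_symmetrizer d \<alpha>)) ` group_algebra d"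

definition left_action :: "(nat \<Rightarrow> nat) \<Rightarrow> ((nat \<Rightarrow> nat) \<Rightarrow> complex) \<Rightarrow> (nat \<Rightarrow> nat) \<Rightarrow> complex"
  where "left_action g f = (\<lambda>x. f (inv g \<circ> x))"


section \<open>Kronecker coefficients\<close>

definition tensor_vec :: "('x \<Rightarrow> complex) \<Rightarrow> ('y \<Rightarrow> complex) \<Rightarrow> 'x \<times> 'y \<Rightarrow> complex"
  where "tensor_vec f h = (\<lambda>(x, y). f x * h y)"

text \<open>For spaces of functions, the tensor product embeds into the functions on the product.\<close>

definition tensor_space ::
    "('x \<Rightarrow> complex) set \<Rightarrow> ('y \<Rightarrow> complex) set \<Rightarrow> ('x \<times> 'y \<Rightarrow> complex) set"
  where "tensor_space V W = cfun.span {tensor_vec v w | v w. v \<in> V \<and> w \<in> W}"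

definition diagonal_action :: "(nat \<Rightarrow> nat) \<Rightarrow> ((nat \<Rightarrow> nat) \<times> (nat \<Rightarrow> nat) \<Rightarrow> complex)
    \<Rightarrow> (nat \<Rightarrow> nat) \<times> (nat \<Rightarrow> nat) \<Rightarrow> complex"
  where "diagonal_action g F = (\<lambda>(x, y). F (inv g \<circ> x, inv g \<circ> y))"

lemma diagonal_action_tensor_vec:
  "diagonal_action g (tensor_vec f h) = tensor_vec (left_action g f) (left_action g h)"
  by (simp add: diagonal_action_def tensor_vec_def left_action_def)

definition kronecker :: "nat \<Rightarrow> nat list \<Rightarrow> nat list \<Rightarrow> nat list \<Rightarrow> nat"
  where "kronecker d \<alpha> \<beta> \<gamma> = multiplicity (symgroup d) left_action (specht d \<gamma>)
    diagonal_action (tensor_space (specht d \<alpha>) (specht d \<beta>))"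

definition reduced_kronecker :: "nat list \<Rightarrow> nat list \<Rightarrow> nat list \<Rightarrow> nat"
  where "reduced_kronecker lam mu nu =
    (THE g. \<forall>\<^sub>F d in sequentially. kronecker d (padded lam d) (padded mu d) (padded nu d) = g)"

end

theory Submission
  imports Defs "HOL-Analysis.Analysis"
begin

text \<open>
  The multiplicity of the Specht module of \<open>\<gamma>\<close> in a representation is the rank of the Young
  symmetrizer of \<open>\<gamma>\<close> on it. The Specht module of shape \<open>(d - i, i)\<close> consists of the functions on
  \<open>i\<close>-subsets whose sums over all one-element extensions of any set vanish, so the tensor product of
  two of them is the space of the elements of weight \<open>(i, l)\<close> in the \<open>d\<close>-th tensor power of
  \<open>\<complex>\<^sup>2 \<otimes> \<complex>\<^sup>2\<close> that are killed by two commuting derivations. Symmetrizing over rows turns tensors into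
  polynomials in a matrix of variables, and the Young symmetrizer produces products of minors. The
  unipotent group of the two derivations allows one to restrict these polynomials, without loss, to
  matrices with first row \<open>(1, 0, 0, z)\<close>. There a box of the first row in a column of length one
  contributes only \<open>1\<close> or \<open>z\<close>, so that the restricted space \<open>R(i, l)\<close> does not depend on \<open>d\<close>; this
  gives the stable value, with no recourse to Murnaghan's theorem. Conversely every restricted
  polynomial lifts to the kernel of the derivations once \<open>d\<close> is large. Finally the \<open>sl\<^sub>2\<close> exchanging
  the two middle letters preserves the slice, acts on the sum of the \<open>R(i, l)\<close> with \<open>i + l\<close> fixed,
  and has weight \<open>i - l\<close> on \<open>R(i, l)\<close>. Hence the dimensions are symmetric and unimodal.
\<close>

section \<open>Linear algebra of function spaces\<close>

text \<open>The obstacle is that the \<open>sl2\<close> does not act on the highest weight tensors: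
  the commutator of \<open>e1\<close> and \<open>raise\<close> is not a combination of
  \<open>e1\<close> and \<open>e2\<close>, so the common kernel of these two derivations need not be
  preserved. Restriction to the slice removes both conditions: once the first row is long enough,
  the tensors killed by the two derivations have, after antisymmetrizing columns, the same
  restrictions as all tensors of their weight, and the latter family is visibly stable under mixing
  the middle letters. Row 0 of the slice vanishes at exactly these letters, so the one-parameter
  groups of \<open>raise\<close> and \<open>lower\<close> fix it. The action on the restricted
  spaces is never constructed. It suffices that \<open>raise\<close> and \<open>lower\<close>
  preserve the kernel of the restriction map \<open>theta\<close>; the textbook argument that
  raising is injective on negative weights is then carried out on tensors modulo that kernel. The
  power of \<open>z\<close> records how many boxes of the tail carry the letter
  \<open>(True, True)\<close>; it is limited by the weight and not by the number of boxes, so the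
  restricted space no longer sees \<open>d\<close>.\<close>

interpretation cfun_pair: vector_space_pair
  "cscale :: complex \<Rightarrow> ('x \<Rightarrow> complex) \<Rightarrow> 'x \<Rightarrow> complex"
  "cscale :: complex \<Rightarrow> ('y \<Rightarrow> complex) \<Rightarrow> 'y \<Rightarrow> complex"
  by unfold_locales

abbreviation clinear :: "(('x \<Rightarrow> complex) \<Rightarrow> 'y \<Rightarrow> complex) \<Rightarrow> bool"
  where "clinear \<equiv> Vector_Spaces.linear cscale cscale"

lemma clinearI:
  assumes "\<And>f g. T (f + g) = T f + T g" "\<And>c f. T (cscale c f) = cscale c (T f)"
  shows "clinear T"
  unfolding Vector_Spaces.linear_iff by (intro conjI allI cfun.vector_space_axioms assms)

lemma clinear_compose: "clinear S \<Longrightarrow> clinear T \<Longrightarrow> clinear (\<lambda>v. S (T v))"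
  using Vector_Spaces.linear_compose[of cscale cscale T cscale S] by (simp add: comp_def)

lemma clinear_sum: "(\<And>a. a \<in> A \<Longrightarrow> clinear (S a)) \<Longrightarrow> clinear (\<lambda>v. \<Sum>a\<in>A. S a v)"
  by (rule cfun_pair.linear_compose_sum[rule_format]) auto

lemma clinear_cscale: "clinear T \<Longrightarrow> clinear (\<lambda>v. cscale k (T v))"
  by (rule cfun_pair.linear_compose_scale_right)

lemma sum_fun_apply: "(\<Sum>i\<in>A. f i) x = (\<Sum>i\<in>A. f i x :: complex)"
  by (induction A rule: infinite_finite_induct) auto

lemma cscale_apply: "cscale c f x = c * f x"
  by (simp add: cscale_def)

text \<open>The ambient function spaces are infinite-dimensional, and \<open>cfun.dim\<close> takes
  the default value 0 on infinite-dimensional sets. Comparisons of dimensions therefore carry this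
  predicate as a hypothesis.\<close>

definition finite_dim :: "('x \<Rightarrow> complex) set \<Rightarrow> bool"
  where "finite_dim V \<longleftrightarrow> (\<exists>B. finite B \<and> V \<subseteq> cfun.span B)"

lemma finite_dim_subset: "V \<subseteq> W \<Longrightarrow> finite_dim W \<Longrightarrow> finite_dim V"
  unfolding finite_dim_def by blast

lemma finite_dim_image: "clinear T \<Longrightarrow> finite_dim V \<Longrightarrow> finite_dim (T ` V)"
  unfolding finite_dim_def using cfun_pair.linear_span_image
  by (metis finite_imageI image_mono)

lemma finite_dim_finite_support:
  fixes X :: "'x set"
  assumes "finite X"
  shows "finite_dim {f. \<forall>x. x \<notin> X \<longrightarrow> f x = 0}"
proof -
  let ?e = "\<lambda>x y. if y = (x :: 'x) then 1 else 0 :: complex"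
  have "f \<in> cfun.span (?e ` X)" if f: "\<forall>x. x \<notin> X \<longrightarrow> f x = 0" for f
  proof -
    have "f = (\<Sum>x\<in>X. cscale (f x) (?e x))"
    proof
      fix y
      have "(\<Sum>x\<in>X. cscale (f x) (?e x)) y = (\<Sum>x\<in>X. if y = x then f x else 0)"
        by (simp add: sum_fun_apply cscale_apply if_distrib cong: if_cong)
      also have "\<dots> = f y" using assms f by (simp add: sum.delta')
      finally show "f y = (\<Sum>x\<in>X. cscale (f x) (?e x)) y" by simp
    qed
    also have "\<dots> \<in> cfun.span (?e ` X)"
      by (intro cfun.span_sum cfun.span_scale cfun.span_base) auto
    finally show ?thesis .
  qed
  then show ?thesis
    unfolding finite_dim_def using assms by (intro exI[of _ "?e ` X"]) auto
qed

lemma finite_basis: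
  assumes "finite_dim V"
  obtains B where "B \<subseteq> V" "cfun.independent B" "V \<subseteq> cfun.span B" "finite B" "card B = cfun.dim V"
proof -
  obtain B where B: "B \<subseteq> V" "cfun.independent B" "V \<subseteq> cfun.span B" "card B = cfun.dim V"
    by (rule cfun.basis_exists)
  obtain A where A: "finite A" "V \<subseteq> cfun.span A" using assms unfolding finite_dim_def by blast
  have "finite B"
    using cfun.independent_span_bound[OF A(1) B(2)] B(1) A(2) by blast
  with B that show ?thesis by blast
qed

lemma dim_mono_finite_dim:
  assumes "V \<subseteq> W" "finite_dim W"
  shows "cfun.dim V \<le> cfun.dim W"
proof -
  obtain B where B: "V \<subseteq> cfun.span B" "finite B" "card B = cfun.dim W"
    using finite_basis[OF assms(2)] assms(1) by (metis subset_trans)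
  show ?thesis using cfun.dim_le_card[OF B(1,2)] B(3) by simp
qed

lemma dim_strict_mono_finite_dim:
  assumes "V \<subset> W" "cfun.subspace V" "finite_dim W"
  shows "cfun.dim V < cfun.dim W"
proof -
  have "finite_dim V" using assms finite_dim_subset by blast
  then obtain B where B: "B \<subseteq> V" "cfun.independent B" "V \<subseteq> cfun.span B" "finite B" "card B = cfun.dim V"
    by (rule finite_basis)
  obtain x where x: "x \<in> W" "x \<notin> V" using assms(1) by blast
  have "cfun.span B \<subseteq> V" using B(1) assms(2) by (simp add: cfun.span_minimal)
  then have xB: "x \<notin> cfun.span B" using x by blast
  then have ind: "cfun.independent (insert x B)" using B(2) by (rule cfun.independent_insertI)
  have "x \<notin> B" using xB cfun.span_base by blast
  then have "card (insert x B) = Suc (cfun.dim V)" using B by simp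
  moreover have "card (insert x B) = cfun.dim (insert x B)"
    using cfun.dim_eq_card_independent[OF ind] by simp
  moreover have "cfun.dim (insert x B) \<le> cfun.dim W"
    using B(1) x assms by (intro dim_mono_finite_dim) auto
  ultimately show ?thesis by simp
qed

lemma dim_inj_image:
  assumes T: "clinear T" and V: "cfun.subspace V" and inj: "inj_on T V"
  shows "cfun.dim (T ` V) = cfun.dim V"
proof -
  obtain B where B: "B \<subseteq> V" "cfun.independent B" "V \<subseteq> cfun.span B" "card B = cfun.dim V"
    by (rule cfun.basis_exists)
  have span: "cfun.span B = V"
    using B V by (simp add: cfun.span_minimal subset_antisym)
  have "cfun.independent (T ` B)"
    using cfun_pair.linear_independent_injective_image[OF T B(2)] inj span by simp
  moreover have "cfun.span (T ` B) = cfun.span (T ` V)"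
    using span cfun_pair.linear_span_image[OF T] V by (metis cfun.span_eq_iff)
  ultimately have "cfun.dim (T ` V) = card (T ` B)"
    by (intro cfun.dim_eq_card)
  also have "\<dots> = card B"
    using inj B(1) by (metis card_image inj_on_subset)
  finally show ?thesis using B by simp
qed

lemma clinear_inj_on_iff:
  assumes "clinear T" "cfun.subspace V"
  shows "inj_on T V \<longleftrightarrow> (\<forall>v\<in>V. T v = 0 \<longrightarrow> v = 0)"
  by (rule cfun_pair.linear_inj_on_iff_eq_0[OF assms])

lemma clinear_left_inverse_on:
  assumes "clinear T" "cfun.subspace V" "inj_on T V"
  obtains S where "clinear S" "range S \<subseteq> V" "\<And>v. v \<in> V \<Longrightarrow> S (T v) = v"
  using cfun_pair.linear_exists_left_inverse_on[OF assms] by auto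

text \<open>A left inverse of the inclusion of \<open>V\<close>. It is averaged in
  \<open>maschke\<close> and applied to delta functions in \<open>tensor_spaceI\<close>.\<close>

lemma clinear_projection:
  assumes "cfun.subspace V"
  obtains P where "clinear P" "range P \<subseteq> V" "\<And>v. v \<in> V \<Longrightarrow> P v = v"
proof -
  have "clinear (\<lambda>v. v :: 'a \<Rightarrow> complex)" by (rule cfun.linear_ident)
  then show ?thesis
    using that assms clinear_left_inverse_on[of "\<lambda>v. v" V] by (metis inj_on_id2)
qed

section \<open>Representations of the symmetric group\<close>

lemma id_in_symgroup [simp]: "id \<in> symgroup d"
  by (simp add: symgroup_def permutes_id)

lemma comp_in_symgroup [simp]: "p \<in> symgroup d \<Longrightarrow> q \<in> symgroup d \<Longrightarrow> p \<circ> q \<in> symgroup d"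
  by (simp add: symgroup_def permutes_compose)

lemma inv_in_symgroup [simp]: "p \<in> symgroup d \<Longrightarrow> inv p \<in> symgroup d"
  by (simp add: symgroup_def permutes_inv)

lemma finite_symgroup [simp]: "finite (symgroup d)"
  by (simp add: symgroup_def finite_permutations)

lemma card_symgroup_pos: "card (symgroup d) > 0"
  using card_gt_0_iff id_in_symgroup by (metis empty_iff finite_symgroup)

lemma symgroup_inv_o [simp]:
  assumes "p \<in> symgroup d"
  shows "inv p \<circ> p = id" "p \<circ> inv p = id" "inv p (p x) = x" "p (inv p x) = x" "inv (inv p) = p"
  using assms permutes_inv_o[of p "{..<d}"] permutes_inverses[of p "{..<d}"] permutes_inv_inv[of p]
  by (auto simp: symgroup_def)

lemma symgroup_inv_comp:
  assumes "p \<in> symgroup d" "q \<in> symgroup d"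
  shows "inv (p \<circ> q) = inv q \<circ> inv p"
  using assms by (simp add: symgroup_def o_inv_distrib permutes_bij)

lemma symgroup_cancel:
  "g \<in> symgroup d \<Longrightarrow> inv g \<circ> (g \<circ> p) = p" "g \<in> symgroup d \<Longrightarrow> g \<circ> (inv g \<circ> p) = p"
  by (simp_all add: o_assoc)

lemma sum_symgroup_left:
  assumes "g \<in> symgroup d"
  shows "(\<Sum>p\<in>symgroup d. f (g \<circ> p)) = (\<Sum>p\<in>symgroup d. f p)"
  by (rule sum.reindex_bij_witness[where i = "\<lambda>p. inv g \<circ> p" and j = "\<lambda>p. g \<circ> p"])
     (use assms in \<open>auto simp: o_assoc\<close>)

lemma sum_symgroup_inv: "(\<Sum>p\<in>symgroup d. f (inv p)) = (\<Sum>p\<in>symgroup d. f p)"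
  by (rule sum.reindex_bij_witness[where i = inv and j = inv]) auto

section \<open>The group algebra acting on a representation\<close>

definition act :: "nat \<Rightarrow> ((nat \<Rightarrow> nat) \<Rightarrow> ('x \<Rightarrow> complex) \<Rightarrow> 'x \<Rightarrow> complex)
    \<Rightarrow> ((nat \<Rightarrow> nat) \<Rightarrow> complex) \<Rightarrow> ('x \<Rightarrow> complex) \<Rightarrow> 'x \<Rightarrow> complex"
  where "act d \<rho> c v = (\<Sum>g\<in>symgroup d. cscale (c g) (\<rho> g v))"

lemma act_apply: "act d \<rho> c v x = (\<Sum>g\<in>symgroup d. c g * \<rho> g v x)"
  by (simp add: act_def sum_fun_apply cscale_apply)

lemma convolution_eq_act: "convolution d f h = act d left_action f h"
  by (rule ext) (simp add: convolution_def act_apply left_action_def)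

lemma act_add_left: "act d \<rho> (f + h) v = act d \<rho> f v + act d \<rho> h v"
  by (simp add: act_def cfun.scale_left_distrib sum.distrib)

lemma act_cscale_left: "act d \<rho> (cscale k f) v = cscale k (act d \<rho> f v)"
  by (simp add: act_def cfun.scale_sum_right cscale_apply)

text \<open>The intertwining condition is asked at the vector \<open>v\<close> alone, so
  \<open>T\<close> may be equivariant just on a subrepresentation, as the isomorphisms in
  \<open>rep_iso\<close> are.\<close>

lemma act_equivariant:
  assumes "clinear T" "\<And>g. g \<in> symgroup d \<Longrightarrow> T (\<rho> g v) = \<sigma> g (T v)"
  shows "T (act d \<rho> c v) = act d \<sigma> c (T v)"
  unfolding act_def using assms
  by (simp add: cfun_pair.linear_sum cfun_pair.linear_scale)

lemma act_mem_subrep: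
  assumes "subrep (symgroup d) \<rho> W" "w \<in> W"
  shows "act d \<rho> c w \<in> W"
  using assms unfolding act_def subrep_def
  by (auto intro!: cfun.subspace_sum cfun.subspace_scale)

lemma subrep_subspace: "subrep G \<rho> W \<Longrightarrow> cfun.subspace W"
  by (simp add: subrep_def)

lemma subrep_kernel:
  assumes "subrep G \<rho> V" "clinear T" "\<And>g v. g \<in> G \<Longrightarrow> v \<in> V \<Longrightarrow> T (\<rho> g v) = \<sigma> g (T v)"
    "\<And>g. g \<in> G \<Longrightarrow> \<sigma> g 0 = 0"
  shows "subrep G \<rho> {v \<in> V. T v = 0}"
  unfolding subrep_def
proof (intro conjI ballI)
  have "cfun.subspace ({v. T v = 0} \<inter> V)"
    by (intro cfun.subspace_inter cfun_pair.linear_subspace_kernel[OF assms(2)] subrep_subspace[OF assms(1)])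
  moreover have "{v. T v = 0} \<inter> V = {v \<in> V. T v = 0}" by blast
  ultimately show "cfun.subspace {v \<in> V. T v = 0}" by simp
  fix g v assume "g \<in> G" "v \<in> {v \<in> V. T v = 0}"
  with assms show "\<rho> g v \<in> {v \<in> V. T v = 0}"
    by (simp add: subrep_def)
qed

lemma subrep_image:
  assumes "subrep G \<rho> V" "clinear T" "\<And>g v. g \<in> G \<Longrightarrow> v \<in> V \<Longrightarrow> T (\<rho> g v) = \<sigma> g (T v)"
  shows "subrep G \<sigma> (T ` V)"
  unfolding subrep_def
proof (intro conjI ballI)
  show "cfun.subspace (T ` V)"
    by (intro cfun_pair.linear_subspace_image[OF assms(2)] subrep_subspace[OF assms(1)])
  fix g w assume "g \<in> G" "w \<in> T ` V"
  with assms(1,3) show "\<sigma> g w \<in> T ` V"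
    unfolding subrep_def by (metis (no_types, lifting) imageE imageI)
qed

section \<open>Complete reducibility\<close>

lemma direct_sum_bij_betw_Suc:
  fixes U :: "nat \<Rightarrow> ('x \<Rightarrow> complex) set"
  assumes bij: "bij_betw (\<lambda>u. \<Sum>i<N. u i) (\<Pi>\<^sub>E i\<in>{..<N}. U i) W'"
    and sub: "cfun.subspace V" "cfun.subspace W'" "cfun.subspace W" and incl: "V \<subseteq> W" "W' \<subseteq> W"
    and int: "V \<inter> W' = {0}" and sum: "\<And>w. w \<in> W \<Longrightarrow> \<exists>u\<in>V. \<exists>u'\<in>W'. w = u + u'"
  shows "bij_betw (\<lambda>u. \<Sum>i<Suc N. u i) (\<Pi>\<^sub>E i\<in>{..<Suc N}. (U(N := V)) i) W"
proof -
  let ?U = "U(N := V)" and ?s = "\<lambda>u. \<Sum>i<N. u i :: 'x \<Rightarrow> complex"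
  have res: "restrict u {..<N} \<in> (\<Pi>\<^sub>E i\<in>{..<N}. U i)" "?s (restrict u {..<N}) = ?s u" "u N \<in> V"
    if "u \<in> (\<Pi>\<^sub>E i\<in>{..<Suc N}. ?U i)" for u
  proof -
    have mem: "u i \<in> ?U i" if "i < Suc N" for i
      using that PiE_mem[OF \<open>u \<in> _\<close>, of i] by simp
    show "restrict u {..<N} \<in> (\<Pi>\<^sub>E i\<in>{..<N}. U i)"
    proof (intro restrict_PiE_iff[THEN iffD2] ballI)
      fix i assume "i \<in> {..<N}" then show "u i \<in> U i" using mem[of i] by auto
    qed
    show "?s (restrict u {..<N}) = ?s u" by (intro sum.cong) auto
    show "u N \<in> V" using mem[of N] by simp
  qed
  have s_mem: "?s u \<in> W'" if "u \<in> (\<Pi>\<^sub>E i\<in>{..<Suc N}. ?U i)" for u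
    using res[OF that] bij by (metis bij_betwE)
  show ?thesis
  proof (rule bij_betw_imageI)
    show "inj_on (\<lambda>u. \<Sum>i<Suc N. u i) (\<Pi>\<^sub>E i\<in>{..<Suc N}. ?U i)"
    proof (rule inj_onI)
      fix u v assume u: "u \<in> (\<Pi>\<^sub>E i\<in>{..<Suc N}. ?U i)" and v: "v \<in> (\<Pi>\<^sub>E i\<in>{..<Suc N}. ?U i)"
        and eq: "(\<Sum>i<Suc N. u i) = (\<Sum>i<Suc N. v i)"
      have eq': "u N - v N = ?s v - ?s u" using eq by (simp add: algebra_simps)
      have "u N - v N \<in> V" using res(3)[OF u] res(3)[OF v] sub(1) by (simp add: cfun.subspace_diff)
      moreover have "u N - v N \<in> W'"
        unfolding eq' using s_mem[OF u] s_mem[OF v] sub(2) by (simp add: cfun.subspace_diff)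
      ultimately have "u N - v N = 0" using int by blast
      then have N: "u N = v N" and "?s u = ?s v" using eq' by auto
      then have "restrict u {..<N} = restrict v {..<N}"
        using res[OF u] res[OF v] bij unfolding bij_betw_def by (metis inj_onD)
      then have "u i = v i" if "i < N" for i using that by (metis lessThan_iff restrict_apply')
      with N have "u i = v i" if "i \<in> {..<Suc N}" for i using that by (cases "i = N") auto
      then show "u = v" using u v by (intro PiE_ext[of u _ _ v]) auto
    qed
    show "(\<lambda>u. \<Sum>i<Suc N. u i) ` (\<Pi>\<^sub>E i\<in>{..<Suc N}. ?U i) = W"
    proof (intro equalityI subsetI)
      fix w assume "w \<in> (\<lambda>u. \<Sum>i<Suc N. u i) ` (\<Pi>\<^sub>E i\<in>{..<Suc N}. ?U i)"
      then obtain u where u: "u \<in> (\<Pi>\<^sub>E i\<in>{..<Suc N}. ?U i)" and w: "w = ?s u + u N" by auto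
      show "w \<in> W"
        unfolding w using s_mem[OF u] res(3)[OF u] incl sub(3) by (intro cfun.subspace_add) auto
    next
      fix w assume "w \<in> W"
      then obtain a b where ab: "a \<in> V" "b \<in> W'" "w = a + b" using sum by blast
      then obtain u where u: "u \<in> (\<Pi>\<^sub>E i\<in>{..<N}. U i)" "?s u = b"
        using bij unfolding bij_betw_def by (metis imageE)
      have "u(N := a) \<in> (\<Pi>\<^sub>E i\<in>{..<Suc N}. ?U i)"
        using u(1) ab(1) unfolding lessThan_Suc by (intro PiE_fun_upd) (auto simp: PiE_iff extensional_def)
      moreover have "(\<Sum>i<Suc N. (u(N := a)) i) = w"
      proof -
        have "(\<Sum>i<N. (u(N := a)) i) = ?s u" by (intro sum.cong) auto
        then show ?thesis using u(2) ab(3) by (simp add: add.commute)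
      qed
      ultimately show "w \<in> (\<lambda>u. \<Sum>i<Suc N. u i) ` (\<Pi>\<^sub>E i\<in>{..<Suc N}. ?U i)"
        by (metis (no_types, lifting) imageI)
    qed
  qed
qed

locale symgroup_action =
  fixes d :: nat and \<rho> :: "(nat \<Rightarrow> nat) \<Rightarrow> ('x \<Rightarrow> complex) \<Rightarrow> 'x \<Rightarrow> complex"
  assumes linear: "g \<in> symgroup d \<Longrightarrow> clinear (\<rho> g)"
    and one: "\<rho> id v = v"
    and mult: "g \<in> symgroup d \<Longrightarrow> h \<in> symgroup d \<Longrightarrow> \<rho> (g \<circ> h) v = \<rho> g (\<rho> h v)"
begin

lemma zero: "g \<in> symgroup d \<Longrightarrow> \<rho> g 0 = 0"
  using linear cfun_pair.linear_0 by blast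

lemma clinear_act: "clinear (act d \<rho> c)"
proof -
  have "clinear (\<lambda>v. \<Sum>g\<in>symgroup d. cscale (c g) (\<rho> g v))"
    by (intro clinear_sum clinear_cscale linear)
  then show ?thesis by (simp add: act_def[abs_def])
qed

lemma act_left_action:
  assumes g: "g \<in> symgroup d"
  shows "act d \<rho> (left_action g f) v = \<rho> g (act d \<rho> f v)"
proof -
  have "act d \<rho> (left_action g f) v = (\<Sum>p\<in>symgroup d. cscale (f (inv g \<circ> p)) (\<rho> p v))"
    by (simp add: act_def left_action_def)
  also have "\<dots> = (\<Sum>p\<in>symgroup d. cscale (f (inv g \<circ> (g \<circ> p))) (\<rho> (g \<circ> p) v))"
    by (rule sum_symgroup_left[OF g, symmetric])
  also have "\<dots> = (\<Sum>p\<in>symgroup d. cscale (f p) (\<rho> g (\<rho> p v)))"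
    using g by (intro sum.cong refl) (simp add: mult symgroup_cancel)
  also have "\<dots> = \<rho> g (act d \<rho> f v)"
    by (simp add: act_def cfun_pair.linear_sum[OF linear[OF g]] cfun_pair.linear_scale[OF linear[OF g]])
  finally show ?thesis .
qed

lemma act_convolution: "act d \<rho> (convolution d f h) v = act d \<rho> f (act d \<rho> h v)"
proof -
  have "clinear (\<lambda>h. act d \<rho> h v)"
    by (rule clinearI) (simp_all add: act_add_left act_cscale_left)
  from act_equivariant[OF this, where \<rho> = left_action and \<sigma> = \<rho>] show ?thesis
    by (simp add: convolution_eq_act act_left_action)
qed

text \<open>The complement is the kernel in \<open>W\<close> of \<open>Q\<close>, the average of the
  conjugates of a linear projection onto \<open>U\<close>. Averaging makes the projection
  equivariant and keeps it the identity on \<open>U\<close>.\<close>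

lemma maschke:
  assumes W: "subrep (symgroup d) \<rho> W" and U: "subrep (symgroup d) \<rho> U" and UW: "U \<subseteq> W"
  obtains U' where "subrep (symgroup d) \<rho> U'" "U' \<subseteq> W" "U \<inter> U' = {0}"
    "\<And>w. w \<in> W \<Longrightarrow> \<exists>u\<in>U. \<exists>u'\<in>U'. w = u + u'"
proof -
  let ?G = "symgroup d" and ?k = "1 / of_nat (card (symgroup d)) :: complex"
  obtain P where P: "clinear P" "range P \<subseteq> U" "\<And>v. v \<in> U \<Longrightarrow> P v = v"
    using clinear_projection subrep_subspace[OF U] by blast
  define Q where "Q v = cscale ?k (\<Sum>g\<in>?G. \<rho> g (P (\<rho> (inv g) v)))" for v
  have Qlin: "clinear Q"
    unfolding Q_def
  proof (intro clinear_cscale clinear_sum)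
    fix g assume g: "g \<in> ?G"
    have "clinear (\<lambda>v. P (\<rho> (inv g) v))" by (rule clinear_compose[OF P(1) linear[OF inv_in_symgroup[OF g]]])
    then show "clinear (\<lambda>v. \<rho> g (P (\<rho> (inv g) v)))" by (rule clinear_compose[OF linear[OF g]])
  qed
  have QU: "Q v \<in> U" for v
    unfolding Q_def using U P(2) unfolding subrep_def
    by (intro cfun.subspace_scale cfun.subspace_sum) auto
  have Qid: "Q u = u" if u: "u \<in> U" for u
  proof -
    have "\<rho> g (P (\<rho> (inv g) u)) = u" if g: "g \<in> ?G" for g
    proof -
      have "\<rho> (inv g) u \<in> U" using U u g by (simp add: subrep_def)
      then have "\<rho> g (P (\<rho> (inv g) u)) = \<rho> (g \<circ> inv g) u"
        using g P(3) mult[of g "inv g" u] by simp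
      then show ?thesis using g one by simp
    qed
    then have "Q u = cscale ?k (\<Sum>g\<in>?G. u)" unfolding Q_def by simp
    also have "\<dots> = u"
      using card_symgroup_pos[of d] by (auto simp: sum_fun_apply cscale_apply fun_eq_iff)
    finally show ?thesis .
  qed
  have Qeq: "Q (\<rho> h v) = \<rho> h (Q v)" if h: "h \<in> ?G" for h v
  proof -
    have "(\<Sum>g\<in>?G. \<rho> g (P (\<rho> (inv g) (\<rho> h v)))) = (\<Sum>g\<in>?G. \<rho> (h \<circ> g) (P (\<rho> (inv (h \<circ> g)) (\<rho> h v))))"
      by (rule sum_symgroup_left[OF h, symmetric])
    also have "\<dots> = (\<Sum>g\<in>?G. \<rho> h (\<rho> g (P (\<rho> (inv g) v))))"
    proof (intro sum.cong refl)
      fix g assume g: "g \<in> ?G"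
      have "\<rho> (inv (h \<circ> g)) (\<rho> h v) = \<rho> (inv g \<circ> inv h \<circ> h) v"
        using g h mult[of "inv g \<circ> inv h" h v] by (simp add: symgroup_inv_comp)
      then show "\<rho> (h \<circ> g) (P (\<rho> (inv (h \<circ> g)) (\<rho> h v))) = \<rho> h (\<rho> g (P (\<rho> (inv g) v)))"
        using g h by (simp add: mult o_assoc[symmetric])
    qed
    finally show ?thesis
      unfolding Q_def using linear[OF h]
      by (simp add: cfun_pair.linear_sum cfun_pair.linear_scale)
  qed
  define U' where "U' = {w \<in> W. Q w = 0}"
  show ?thesis
  proof
    show "subrep ?G \<rho> U'" unfolding U'_def
      by (rule subrep_kernel[OF W Qlin, where \<sigma> = \<rho>]) (use Qeq zero in auto)
    show "U' \<subseteq> W" by (auto simp: U'_def)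
    have "0 \<in> U" "0 \<in> W" "Q 0 = 0"
      using U W Qlin cfun_pair.linear_0 by (auto simp: subrep_def cfun.subspace_0)
    then show "U \<inter> U' = {0}" using Qid by (auto simp: U'_def)
    fix w assume w: "w \<in> W"
    have "w - Q w \<in> U'"
      unfolding U'_def using w QU[of w] UW Qid[OF QU[of w]] W
      by (auto simp: cfun_pair.linear_diff[OF Qlin] subrep_def intro!: cfun.subspace_diff)
    then show "\<exists>u\<in>U. \<exists>u'\<in>U'. w = u + u'"
      using QU[of w] by (metis add_diff_cancel_left' diff_add_cancel add.commute)
  qed
qed

text \<open>A nonzero subrepresentation of least dimension is irreducible; \<open>maschke\<close>
  splits it off, and the complement has smaller dimension.\<close>

lemma irreducible_decomposition_exists:
  assumes "subrep (symgroup d) \<rho> W" "finite_dim W"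
  shows "\<exists>N U. irreducible_decomposition (symgroup d) \<rho> W N U"
  using assms
proof (induction "cfun.dim W" arbitrary: W rule: less_induct)
  case less
  let ?G = "symgroup d"
  show ?case
  proof (cases "W = {0}")
    case True
    then have "irreducible_decomposition ?G \<rho> W 0 (\<lambda>_. {})"
      by (simp add: irreducible_decomposition_def bij_betw_def)
    then show ?thesis by blast
  next
    case False
    let ?P = "\<lambda>U. subrep ?G \<rho> U \<and> U \<subseteq> W \<and> U \<noteq> {0}"
    obtain V where V: "?P V" and min: "\<And>U. ?P U \<Longrightarrow> cfun.dim V \<le> cfun.dim U"
      using ex_has_least_nat[of ?P W cfun.dim] less.prems(1) False by auto
    have irr: "irreducible_rep ?G \<rho> V"
      unfolding irreducible_rep_def
    proof (intro conjI allI impI)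
      fix U assume U: "subrep ?G \<rho> U \<and> U \<subseteq> V"
      show "U = {0} \<or> U = V"
      proof (rule ccontr)
        assume "\<not> (U = {0} \<or> U = V)"
        with U V have "?P U" "U \<subset> V" by auto
        moreover have "cfun.dim U < cfun.dim V"
          using U V \<open>U \<subset> V\<close> less.prems(2)
          by (intro dim_strict_mono_finite_dim) (auto intro: subrep_subspace finite_dim_subset)
        ultimately show False using min by fastforce
      qed
    qed (use V in auto)
    obtain W' where W': "subrep ?G \<rho> W'" "W' \<subseteq> W" "V \<inter> W' = {0}"
        "\<And>w. w \<in> W \<Longrightarrow> \<exists>u\<in>V. \<exists>u'\<in>W'. w = u + u'"
      using maschke[OF less.prems(1), of V] V by blast
    have "W' \<noteq> W"
      using V W'(3) by (metis cfun.subspace_0 inf.absorb_iff1 subrep_subspace)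
    then have "cfun.dim W' < cfun.dim W"
      using W' less.prems by (intro dim_strict_mono_finite_dim) (auto intro: subrep_subspace)
    then obtain N U where NU: "irreducible_decomposition ?G \<rho> W' N U"
      using less.hyps W'(1,2) finite_dim_subset[OF W'(2) less.prems(2)] by metis
    have "irreducible_decomposition ?G \<rho> W (Suc N) (U(N := V))"
      unfolding irreducible_decomposition_def
      using NU irr V W' less.prems unfolding irreducible_decomposition_def
      by (intro conjI direct_sum_bij_betw_Suc) (auto simp: less_Suc_eq intro: subrep_subspace)
    then show ?thesis by blast
  qed
qed

end

lemma symgroup_action_left: "symgroup_action d left_action"
proof (rule symgroup_action.intro)
  show "clinear (left_action g)" if "g \<in> symgroup d" for g
    by (rule clinearI) (auto simp: left_action_def cscale_def)
  show "left_action id v = v" for v :: "(nat \<Rightarrow> nat) \<Rightarrow> complex"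
    by (simp add: left_action_def)
  show "left_action (g \<circ> h) v = left_action g (left_action h v)"
    if "g \<in> symgroup d" "h \<in> symgroup d" for g h and v :: "(nat \<Rightarrow> nat) \<Rightarrow> complex"
    using that by (simp add: left_action_def symgroup_inv_comp o_assoc)
qed

interpretation left: symgroup_action d left_action for d
  by (rule symgroup_action_left)

section \<open>Primitive elements of the group algebra\<close>

text \<open>The adjoint for the standard Hermitian form: convolving with \<open>star d f\<close> on
  the left is adjoint to convolving with \<open>f\<close>. Positivity of the form excludes nilpotent
  left ideals.\<close>

definition star :: "nat \<Rightarrow> ((nat \<Rightarrow> nat) \<Rightarrow> complex) \<Rightarrow> (nat \<Rightarrow> nat) \<Rightarrow> complex"
  where "star d f g = (if g \<in> symgroup d then cnj (f (inv g)) else 0)"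

lemma comp_in_symgroup_iff:
  assumes "p \<in> symgroup d"
  shows "p \<circ> g \<in> symgroup d \<longleftrightarrow> g \<in> symgroup d" "g \<circ> p \<in> symgroup d \<longleftrightarrow> g \<in> symgroup d"
proof -
  have "g = inv p \<circ> (p \<circ> g)" "g = (g \<circ> p) \<circ> inv p"
    using assms by (simp_all add: o_assoc[symmetric] symgroup_cancel)
  then show "p \<circ> g \<in> symgroup d \<longleftrightarrow> g \<in> symgroup d" "g \<circ> p \<in> symgroup d \<longleftrightarrow> g \<in> symgroup d"
    using assms comp_in_symgroup inv_in_symgroup by metis+
qed

lemma convolution_in_group_algebra [simp]:
  "h \<in> group_algebra d \<Longrightarrow> convolution d f h \<in> group_algebra d"
  by (auto simp: group_algebra_def convolution_def comp_in_symgroup_iff intro!: sum.neutral)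

lemma convolution_assoc:
  "convolution d (convolution d f h) k = convolution d f (convolution d h k)"
  using left.act_convolution[of d f h k] by (simp add: convolution_eq_act)

lemma convolution_cscale_right: "convolution d f (cscale k h) = cscale k (convolution d f h)"
  unfolding convolution_eq_act by (rule cfun_pair.linear_scale[OF left.clinear_act])

lemma star_in_group_algebra [simp]: "star d f \<in> group_algebra d"
  by (simp add: star_def group_algebra_def)

lemma star_convolution: "star d (convolution d f h) = convolution d (star d h) (star d f)"
proof
  fix g
  show "star d (convolution d f h) g = convolution d (star d h) (star d f) g"
  proof (cases "g \<in> symgroup d")
    case True
    have "convolution d (star d h) (star d f) g = (\<Sum>p\<in>symgroup d. cnj (h (inv p)) * cnj (f (inv g \<circ> p)))"
      unfolding convolution_def using True
      using symgroup_inv_comp[of "inv _" d g]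
      by (intro sum.cong) (auto simp: star_def comp_in_symgroup_iff)
    also have "\<dots> = (\<Sum>p\<in>symgroup d. cnj (h (inv (g \<circ> p))) * cnj (f (inv g \<circ> (g \<circ> p))))"
      by (rule sum_symgroup_left[OF True, symmetric])
    also have "\<dots> = star d (convolution d f h) g"
      using True by (simp add: star_def convolution_def symgroup_cancel symgroup_inv_comp mult.commute)
    finally show ?thesis by simp
  next
    case False
    have "convolution d (star d h) (star d f) \<in> group_algebra d" by simp
    then show ?thesis using False by (simp add: star_def group_algebra_def)
  qed
qed

lemma star_star: "f \<in> group_algebra d \<Longrightarrow> star d (star d f) = f"
  by (rule ext) (auto simp: star_def group_algebra_def)

text \<open>The value at \<open>id\<close> is the sum of the squares of the moduli of the values of
  \<open>f\<close>.\<close>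

lemma star_convolution_self_neq_0:
  assumes f: "f \<in> group_algebra d" "f \<noteq> 0"
  shows "convolution d (star d f) f \<noteq> 0"
proof
  assume "convolution d (star d f) f = 0"
  then have "0 = convolution d (star d f) f id" by simp
  also have "\<dots> = (\<Sum>p\<in>symgroup d. cnj (f (inv p)) * f (inv p))"
    by (simp add: convolution_def star_def)
  also have "\<dots> = (\<Sum>p\<in>symgroup d. cnj (f p) * f p)"
    by (rule sum_symgroup_inv)
  also have "\<dots> = of_real (\<Sum>p\<in>symgroup d. (cmod (f p))\<^sup>2)"
    unfolding of_real_sum by (intro sum.cong) (simp_all add: complex_norm_square[symmetric] mult.commute)
  finally have "(\<Sum>p\<in>symgroup d. (cmod (f p))\<^sup>2) = 0" by (metis of_real_eq_0_iff)
  then have "\<forall>p\<in>symgroup d. f p = 0" by (simp add: sum_nonneg_eq_0_iff)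
  with f show False by (auto simp: group_algebra_def fun_eq_iff)
qed

lemma subspace_group_algebra: "cfun.subspace (group_algebra d)"
  by (auto simp: cfun.subspace_def group_algebra_def cscale_def)

lemma subrep_group_algebra: "subrep (symgroup d) left_action (group_algebra d)"
  using subspace_group_algebra
  by (auto simp: subrep_def group_algebra_def left_action_def comp_in_symgroup_iff)

text \<open>The left ideal of such an element \<open>c\<close> is irreducible, and its multiplicity in any
  representation is the rank of \<open>c\<close>; this takes the place of character theory.\<close>

locale primitive_element =
  fixes d :: nat and c :: "(nat \<Rightarrow> nat) \<Rightarrow> complex"
  assumes c_alg: "c \<in> group_algebra d" and c_neq_0: "c \<noteq> 0"
    and sandwich: "x \<in> group_algebra d \<Longrightarrow> \<exists>k. convolution d c (convolution d x c) = cscale k c"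
begin

definition ideal :: "((nat \<Rightarrow> nat) \<Rightarrow> complex) set"
  where "ideal = (\<lambda>f. convolution d f c) ` group_algebra d"

lemma subrep_ideal: "subrep (symgroup d) left_action ideal"
  unfolding ideal_def
proof (rule subrep_image[OF subrep_group_algebra])
  show "clinear (\<lambda>f. convolution d f c)"
    unfolding convolution_eq_act by (rule clinearI) (simp_all add: act_add_left act_cscale_left)
  show "convolution d (left_action g v) c = left_action g (convolution d v c)"
    if "g \<in> symgroup d" for g v
    using left.act_left_action[OF that] by (simp add: convolution_eq_act)
qed

lemma ideal_alg: "v \<in> ideal \<Longrightarrow> v \<in> group_algebra d"
  using c_alg by (auto simp: ideal_def)

lemma c_in_ideal: "c \<in> ideal"
proof -
  let ?e = "\<lambda>p. if p = id then 1 else 0 :: complex"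
  have "convolution d ?e c = c"
  proof
    fix g
    have "convolution d ?e c g = (\<Sum>p\<in>symgroup d. if p = id then c g else 0)"
      unfolding convolution_def by (intro sum.cong) auto
    then show "convolution d ?e c g = c g" by simp
  qed
  moreover have "?e \<in> group_algebra d" by (auto simp: group_algebra_def)
  ultimately show ?thesis unfolding ideal_def by (metis (no_types, lifting) imageI)
qed

lemma convolution_c_ideal: "v \<in> ideal \<Longrightarrow> \<exists>k. convolution d c v = cscale k c"
  using sandwich by (auto simp: ideal_def)

text \<open>The product \<open>y\<close> of \<open>star d z\<close> and \<open>z\<close> lies in
  \<open>Z\<close> and is self-adjoint, so \<open>y y\<close> is not 0. Writing
  \<open>y = f c\<close> gives \<open>y y = f (c y) = k y\<close>, hence \<open>k\<close> is not 0.
  Thus \<open>c\<close> does not kill any nonzero part of its ideal.\<close>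

lemma convolution_c_neq_0:
  assumes Z: "subrep (symgroup d) left_action Z" "Z \<subseteq> ideal" "Z \<noteq> {0}"
  obtains z k where "z \<in> Z" "k \<noteq> 0" "convolution d c z = cscale k c"
proof -
  obtain z where z: "z \<in> Z" "z \<noteq> 0"
    using Z cfun.subspace_0[OF subrep_subspace[OF Z(1)]] by blast
  have zA: "z \<in> group_algebra d" using z Z ideal_alg by blast
  define y where "y = convolution d (star d z) z"
  have y0: "y \<noteq> 0" and yA: "y \<in> group_algebra d"
    unfolding y_def using star_convolution_self_neq_0[OF zA z(2)] zA by simp_all
  have yZ: "y \<in> Z"
    unfolding y_def convolution_eq_act by (rule act_mem_subrep[OF Z(1) z(1)])
  have "star d y = y"
    unfolding y_def star_convolution by (simp add: star_star zA)
  then have yy: "convolution d y y \<noteq> 0"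
    using star_convolution_self_neq_0[OF yA y0] by simp
  obtain f where f: "y = convolution d f c" using yZ Z(2) by (auto simp: ideal_def)
  obtain k where k: "convolution d c y = cscale k c" using convolution_c_ideal yZ Z(2) by blast
  have "convolution d y y = cscale k y"
    using k f by (metis convolution_assoc convolution_cscale_right)
  then have "k \<noteq> 0" using yy by auto
  then show thesis using that yZ k by blast
qed

lemma irreducible_ideal: "irreducible_rep (symgroup d) left_action ideal"
  unfolding irreducible_rep_def
proof (intro conjI allI impI subrep_ideal)
  show "ideal \<noteq> {0}" using c_in_ideal c_neq_0 by blast
  fix Z assume "subrep (symgroup d) left_action Z \<and> Z \<subseteq> ideal"
  then have Z: "subrep (symgroup d) left_action Z" "Z \<subseteq> ideal" by auto
  show "Z = {0} \<or> Z = ideal"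
  proof (cases "Z = {0}")
    case False
    then obtain z k where zk: "z \<in> Z" "k \<noteq> 0" "convolution d c z = cscale k c"
      using convolution_c_neq_0[OF Z] by blast
    have "cscale k c \<in> Z"
      unfolding zk(3)[symmetric] convolution_eq_act by (rule act_mem_subrep[OF Z(1) zk(1)])
    then have "cscale (1 / k) (cscale k c) \<in> Z"
      by (rule cfun.subspace_scale[OF subrep_subspace[OF Z(1)]])
    then have "c \<in> Z" using zk(2) by simp
    then have "ideal \<subseteq> Z"
      unfolding ideal_def convolution_eq_act using act_mem_subrep[OF Z(1)] by blast
    then show ?thesis using Z by blast
  qed simp
qed

text \<open>On a copy of the ideal \<open>c\<close> has rank one: its image is contained in the line
  through the image of \<open>c\<close> by \<open>convolution_c_ideal\<close>, and is not 0 by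
  \<open>convolution_c_neq_0\<close>.\<close>

lemma act_iso_image:
  assumes iso: "rep_iso (symgroup d) left_action ideal \<rho> U"
  shows "\<exists>z\<in>U. z \<noteq> 0 \<and> act d \<rho> c ` U = range (\<lambda>k. cscale k z)"
proof -
  obtain T where T: "clinear T" "bij_betw T ideal U"
    and eq: "\<And>g v. g \<in> symgroup d \<Longrightarrow> v \<in> ideal \<Longrightarrow> T (left_action g v) = \<rho> g (T v)"
    using iso unfolding rep_iso_def by blast
  have aT: "act d \<rho> c (T v) = T (convolution d c v)" if "v \<in> ideal" for v
    unfolding convolution_eq_act using act_equivariant[OF T(1)] eq that by metis
  have sub: "cfun.subspace ideal" using subrep_ideal by (rule subrep_subspace)
  have "T c \<noteq> 0"
    using T c_in_ideal c_neq_0 sub clinear_inj_on_iff[OF T(1) sub] by (auto simp: bij_betw_def)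
  moreover have "T c \<in> U" using T(2) c_in_ideal by (auto simp: bij_betw_def)
  moreover have "act d \<rho> c ` U = range (\<lambda>k. cscale k (T c))"
  proof (intro equalityI subsetI)
    fix w assume "w \<in> act d \<rho> c ` U"
    then obtain v where v: "v \<in> ideal" "w = T (convolution d c v)"
      using T(2) aT by (auto simp: bij_betw_def)
    then show "w \<in> range (\<lambda>k. cscale k (T c))"
      using convolution_c_ideal[OF v(1)] by (auto simp: cfun_pair.linear_scale[OF T(1)])
  next
    fix w assume "w \<in> range (\<lambda>k. cscale k (T c))"
    then obtain k where w: "w = cscale k (T c)" by blast
    have "ideal \<noteq> {0}" using c_in_ideal c_neq_0 by blast
    then obtain z m where zm: "z \<in> ideal" "m \<noteq> 0" "convolution d c z = cscale m c"
      using convolution_c_neq_0[OF subrep_ideal] by blast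
    have "act d \<rho> c (T (cscale (k / m) z)) = w"
      using zm sub by (subst aT)
        (simp_all add: cfun.subspace_scale convolution_cscale_right w cfun_pair.linear_scale[OF T(1)])
    moreover have "T (cscale (k / m) z) \<in> U"
      using T(2) zm sub by (auto simp: bij_betw_def cfun.subspace_scale)
    ultimately show "w \<in> act d \<rho> c ` U" by blast
  qed
  ultimately show ?thesis by blast
qed

text \<open>Schur's lemma for the map \<open>f \<mapsto> f u\<close>: the image is a nonzero
  subrepresentation of \<open>U\<close>, the kernel a proper one of the ideal, and both modules are
  irreducible.\<close>

lemma rep_isoI_act:
  assumes "symgroup_action d \<rho>" and irr: "irreducible_rep (symgroup d) \<rho> U"
    and u: "u \<in> U" "act d \<rho> c u \<noteq> 0"
  shows "rep_iso (symgroup d) left_action ideal \<rho> U"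
proof -
  interpret symgroup_action d \<rho> by fact
  let ?T = "\<lambda>f. act d \<rho> f u"
  have U: "subrep (symgroup d) \<rho> U" using irr by (simp add: irreducible_rep_def)
  have T: "clinear ?T" by (rule clinearI) (simp_all add: act_add_left act_cscale_left)
  have sub: "cfun.subspace ideal" using subrep_ideal by (rule subrep_subspace)
  have "subrep (symgroup d) \<rho> (?T ` ideal)"
    by (rule subrep_image[OF subrep_ideal T]) (simp add: act_left_action)
  moreover have "?T ` ideal \<subseteq> U" using act_mem_subrep[OF U u(1)] by blast
  moreover have "?T ` ideal \<noteq> {0}" using c_in_ideal u(2) by blast
  ultimately have im: "?T ` ideal = U" using irr unfolding irreducible_rep_def by metis
  have "subrep (symgroup d) left_action {f \<in> ideal. ?T f = 0}"
    by (rule subrep_kernel[OF subrep_ideal T, where \<sigma> = \<rho>]) (simp_all add: act_left_action zero)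
  moreover have "{f \<in> ideal. ?T f = 0} \<noteq> ideal" using c_in_ideal u(2) by blast
  ultimately have "{f \<in> ideal. ?T f = 0} = {0}"
    using irreducible_ideal unfolding irreducible_rep_def by blast
  then have "inj_on ?T ideal"
    unfolding clinear_inj_on_iff[OF T sub] by blast
  then show ?thesis
    unfolding rep_iso_def using T im act_left_action by (intro exI[of _ ?T]) (auto simp: bij_betw_def)
qed

text \<open>\<open>c\<close> has rank one on each summand isomorphic to the ideal and kills the
  others by \<open>rep_isoI_act\<close>; the vectors \<open>z i\<close> spanning the lines form a
  basis of the image. As the right-hand side does not mention the decomposition, the
  \<open>THE\<close> in the definition of the multiplicity is well defined.\<close>

lemma card_iso_summands:
  assumes "symgroup_action d \<rho>" and W: "subrep (symgroup d) \<rho> W"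
    and dec: "irreducible_decomposition (symgroup d) \<rho> W N U"
  shows "card {i. i < N \<and> rep_iso (symgroup d) left_action ideal \<rho> (U i)} = cfun.dim (act d \<rho> c ` W)"
proof -
  interpret symgroup_action d \<rho> by fact
  let ?A = "act d \<rho> c" and ?S = "\<lambda>u. \<Sum>i<N. u i :: 'a \<Rightarrow> complex"
  define I where "I = {i. i < N \<and> rep_iso (symgroup d) left_action ideal \<rho> (U i)}"
  have fin: "finite I" by (simp add: I_def)
  have irr: "\<And>i. i < N \<Longrightarrow> irreducible_rep (symgroup d) \<rho> (U i)"
    and bij: "bij_betw ?S (\<Pi>\<^sub>E i\<in>{..<N}. U i) W"
    using dec by (auto simp: irreducible_decomposition_def)
  have sub: "cfun.subspace (U i)" if "i < N" for i
    using irr[OF that] by (auto simp: irreducible_rep_def intro: subrep_subspace)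
  have "\<exists>z. z \<in> U i \<and> z \<noteq> 0 \<and> ?A ` U i = range (\<lambda>k. cscale k z)" if "i \<in> I" for i
    using act_iso_image[of \<rho> "U i"] that unfolding I_def by blast
  then obtain z where z: "\<And>i. i \<in> I \<Longrightarrow> z i \<in> U i \<and> z i \<noteq> 0 \<and> ?A ` U i = range (\<lambda>k. cscale k (z i))"
    by metis
  have A0: "?A u = 0" if "i < N" "i \<notin> I" "u \<in> U i" for i u
    using rep_isoI_act[OF \<open>symgroup_action d \<rho>\<close> irr[OF that(1)] that(3)] that by (auto simp: I_def)
  have indep: "\<forall>i\<in>I. a i = 0" if a: "(\<Sum>i\<in>I. cscale (a i) (z i)) = 0" for a
  proof -
    let ?u = "\<lambda>i\<in>{..<N}. if i \<in> I then cscale (a i) (z i) else 0" and ?o = "\<lambda>i\<in>{..<N}. 0 :: 'a \<Rightarrow> complex"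
    have "?u \<in> (\<Pi>\<^sub>E i\<in>{..<N}. U i)" "?o \<in> (\<Pi>\<^sub>E i\<in>{..<N}. U i)"
      using sub z by (auto simp: cfun.subspace_0 cfun.subspace_scale)
    moreover have "?S ?u = (\<Sum>i\<in>I. cscale (a i) (z i))"
      by (rule sum.mono_neutral_cong_right) (auto simp: I_def)
    moreover have "?S ?o = 0" by simp
    ultimately have "?u = ?o" using bij a unfolding bij_betw_def by (metis (lifting) inj_onD)
    then have "cscale (a i) (z i) = 0" if "i \<in> I" for i
    proof -
      have "?u i = ?o i" using \<open>?u = ?o\<close> by (rule fun_cong)
      moreover have "i < N" using that by (simp add: I_def)
      ultimately show ?thesis using that by simp
    qed
    then show ?thesis using z by (metis cfun.scale_eq_0_iff)
  qed
  have inj: "inj_on z I"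
  proof (rule inj_onI, rule ccontr)
    fix i j assume ij: "i \<in> I" "j \<in> I" "z i = z j" "i \<noteq> j"
    let ?a = "\<lambda>k. if k = i then 1 else if k = j then -1 else 0 :: complex"
    have "(\<Sum>k\<in>I. cscale (?a k) (z k)) = (\<Sum>k\<in>{i, j}. cscale (?a k) (z k))"
      using fin ij by (intro sum.mono_neutral_right) auto
    also have "\<dots> = 0" using ij by simp
    finally show False using indep[of ?a] ij by auto
  qed
  have "cfun.independent (z ` I)"
  proof (rule cfun.independent_if_scalars_zero)
    fix f x assume "(\<Sum>x\<in>z ` I. cscale (f x) x) = 0" and x: "x \<in> z ` I"
    then have "(\<Sum>i\<in>I. cscale (f (z i)) (z i)) = 0" by (simp add: sum.reindex[OF inj])
    then show "f x = 0" using indep[of "\<lambda>i. f (z i)"] x by auto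
  qed (use fin in simp)
  moreover have "cfun.span (z ` I) = cfun.span (?A ` W)"
  proof (rule antisym)
    have "z i \<in> ?A ` W" if "i \<in> I" for i
    proof -
      have "z i \<in> ?A ` U i" using z[OF that] by (auto intro: range_eqI[of _ _ 1])
      then obtain u where u: "u \<in> U i" "z i = ?A u" by blast
      let ?v = "\<lambda>j\<in>{..<N}. if j = i then u else 0"
      have "?v \<in> (\<Pi>\<^sub>E i\<in>{..<N}. U i)"
        using sub u by (auto simp: cfun.subspace_0)
      then have "?S ?v \<in> W" using bij_betwE[OF bij] by blast
      moreover have "?S ?v = u"
        using that by (simp add: I_def)
      ultimately show ?thesis using u by auto
    qed
    then show "cfun.span (z ` I) \<subseteq> cfun.span (?A ` W)"
      by (intro cfun.span_mono) auto
    have "?A w \<in> cfun.span (z ` I)" if w: "w \<in> W" for w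
    proof -
      obtain u where u: "u \<in> (\<Pi>\<^sub>E i\<in>{..<N}. U i)" "w = ?S u"
        using w bij by (auto simp: bij_betw_def)
      have "?A w = (\<Sum>i<N. ?A (u i))"
        unfolding u(2) by (rule cfun_pair.linear_sum[OF clinear_act])
      also have "\<dots> \<in> cfun.span (z ` I)"
      proof (rule cfun.span_sum)
        fix i assume "i \<in> {..<N}"
        then have i: "i < N" "u i \<in> U i" using u(1) by auto
        show "?A (u i) \<in> cfun.span (z ` I)"
        proof (cases "i \<in> I")
          case True
          then obtain k where k: "?A (u i) = cscale k (z i)" using z i by blast
          have "z i \<in> cfun.span (z ` I)" using True by (intro cfun.span_base imageI)
          then show ?thesis unfolding k by (rule cfun.span_scale)
        qed (use A0 i cfun.span_zero in auto)
      qed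
      finally show ?thesis .
    qed
    then have "?A ` W \<subseteq> cfun.span (z ` I)" by blast
    then show "cfun.span (?A ` W) \<subseteq> cfun.span (z ` I)"
      by (intro cfun.span_minimal cfun.subspace_span)
  qed
  ultimately have "cfun.dim (?A ` W) = card (z ` I)" by (intro cfun.dim_eq_card)
  then show ?thesis using card_image[OF inj] by (simp add: I_def)
qed

theorem multiplicity_eq_dim:
  assumes "symgroup_action d \<rho>" "subrep (symgroup d) \<rho> W" "finite_dim W"
  shows "Defs.multiplicity (symgroup d) left_action ideal \<rho> W = cfun.dim (act d \<rho> c ` W)"
  unfolding Defs.multiplicity_def
  using symgroup_action.irreducible_decomposition_exists[OF assms]
    card_iso_summands[OF assms(1,2)]
  by (intro the_equality) metis+

end

section \<open>Young symmetrizers\<close>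

definition diagram :: "nat list \<Rightarrow> (nat \<times> nat) set"
  where "diagram \<alpha> = {(r, c). r < length \<alpha> \<and> c < \<alpha> ! r}"

definition box_of :: "nat list \<Rightarrow> nat \<Rightarrow> nat \<times> nat"
  where "box_of \<alpha> x = (row_of \<alpha> x, col_of \<alpha> x)"

lemma sum_list_take_Suc: "r < length \<alpha> \<Longrightarrow> sum_list (take (Suc r) \<alpha>) = sum_list (take r \<alpha>) + (\<alpha> ! r :: nat)"
  by (simp add: take_Suc_conv_app_nth)

lemma sum_list_take_mono: "r \<le> s \<Longrightarrow> sum_list (take r \<alpha>) \<le> (sum_list (take s \<alpha>) :: nat)"
  by (metis le_add1 le_add_diff_inverse sum_list_append take_add)

lemma box_of_position:
  assumes "r < length \<alpha>" "c < \<alpha> ! r"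
  shows "box_of \<alpha> (sum_list (take r \<alpha>) + c) = (r, c)"
proof -
  have "row_of \<alpha> (sum_list (take r \<alpha>) + c) = r"
    unfolding row_of_def
  proof (rule Least_equality)
    show "sum_list (take r \<alpha>) + c < sum_list (take (Suc r) \<alpha>)"
      using assms by (simp add: sum_list_take_Suc)
    fix s assume "sum_list (take r \<alpha>) + c < sum_list (take (Suc s) \<alpha>)"
    then show "r \<le> s"
      using sum_list_take_mono[of "Suc s" r \<alpha>] by (metis add.commute le_add2 not_less not_less_eq_eq order_trans)
  qed
  then show ?thesis by (simp add: box_of_def col_of_def)
qed

lemma position_exists:
  fixes \<alpha> :: "nat list"
  assumes "x < sum_list \<alpha>"
  obtains r c where "r < length \<alpha>" "c < \<alpha> ! r" "x = sum_list (take r \<alpha>) + c"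
proof -
  have ex: "x < sum_list (take (Suc (length \<alpha>)) \<alpha>)" using assms by simp
  define r where "r = row_of \<alpha> x"
  have r: "x < sum_list (take (Suc r) \<alpha>)"
    unfolding r_def row_of_def by (rule LeastI[of "\<lambda>r. x < sum_list (take (Suc r) \<alpha>)", OF ex])
  have r': "sum_list (take r \<alpha>) \<le> x"
  proof (cases r)
    case (Suc s)
    then have "\<not> x < sum_list (take (Suc s) \<alpha>)"
      using not_less_Least[of s "\<lambda>r. x < sum_list (take (Suc r) \<alpha>)"] by (simp add: r_def row_of_def)
    then show ?thesis using Suc by simp
  qed simp
  have "r < length \<alpha>"
    using r r' by (metis le_SucI not_le take_all order.strict_iff_not)
  then show thesis
    using that[of r "x - sum_list (take r \<alpha>)"] r r' by (simp add: sum_list_take_Suc)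
qed

lemma bij_betw_box_of: "bij_betw (box_of \<alpha>) {..<sum_list \<alpha>} (diagram \<alpha>)"
proof (rule bij_betw_imageI)
  show "inj_on (box_of \<alpha>) {..<sum_list \<alpha>}"
  proof (rule inj_onI)
    fix x y assume x: "x \<in> {..<sum_list \<alpha>}" and y: "y \<in> {..<sum_list \<alpha>}" and eq: "box_of \<alpha> x = box_of \<alpha> y"
    obtain r c where "r < length \<alpha>" "c < \<alpha> ! r" "x = sum_list (take r \<alpha>) + c"
      using position_exists[of x \<alpha>] x by auto
    moreover obtain s e where "s < length \<alpha>" "e < \<alpha> ! s" "y = sum_list (take s \<alpha>) + e"
      using position_exists[of y \<alpha>] y by auto
    ultimately show "x = y" using box_of_position eq by simp
  qed
  show "box_of \<alpha> ` {..<sum_list \<alpha>} = diagram \<alpha>"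
  proof (intro equalityI subsetI)
    fix b assume "b \<in> box_of \<alpha> ` {..<sum_list \<alpha>}"
    then obtain x where x: "x < sum_list \<alpha>" "b = box_of \<alpha> x" by auto
    obtain r c where "r < length \<alpha>" "c < \<alpha> ! r" "x = sum_list (take r \<alpha>) + c"
      using position_exists[OF x(1)] .
    then show "b \<in> diagram \<alpha>" using box_of_position x(2) by (simp add: diagram_def)
  next
    fix b assume "b \<in> diagram \<alpha>"
    then obtain r c where b: "b = (r, c)" "r < length \<alpha>" "c < \<alpha> ! r" by (auto simp: diagram_def)
    have "sum_list (take r \<alpha>) + c < sum_list \<alpha>"
      using b sum_list_take_mono[of "Suc r" "length \<alpha>" \<alpha>] by (simp add: sum_list_take_Suc)
    then show "b \<in> box_of \<alpha> ` {..<sum_list \<alpha>}"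
      using box_of_position[OF b(2,3)] b(1) by (metis image_eqI lessThan_iff)
  qed
qed

section \<open>Row and column groups\<close>

definition preserving :: "nat \<Rightarrow> (nat \<Rightarrow> 'a) \<Rightarrow> (nat \<Rightarrow> nat) set"
  where "preserving d f = {p \<in> symgroup d. \<forall>x<d. f (p x) = f x}"

lemma symgroup_less [simp]: "p \<in> symgroup d \<Longrightarrow> p x < d \<longleftrightarrow> x < d"
  using permutes_in_image[of p "{..<d}" x] by (simp add: symgroup_def)

lemma preserving_symgroup: "p \<in> preserving d f \<Longrightarrow> p \<in> symgroup d"
  by (simp add: preserving_def)

lemma id_preserving [simp]: "id \<in> preserving d f"
  by (simp add: preserving_def)

lemma comp_preserving: "p \<in> preserving d f \<Longrightarrow> q \<in> preserving d f \<Longrightarrow> p \<circ> q \<in> preserving d f"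
  by (auto simp: preserving_def)

lemma inv_preserving: "p \<in> preserving d f \<Longrightarrow> inv p \<in> preserving d f"
  unfolding preserving_def
proof (safe, goal_cases)
  case (2 x)
  then have "inv p x < d" by simp
  with 2 have "f (p (inv p x)) = f (inv p x)" by blast
  with 2 show ?case by simp
qed simp

lemma finite_preserving [simp]: "finite (preserving d f)"
  by (simp add: preserving_def)

lemma transpose_preserving: "x < d \<Longrightarrow> y < d \<Longrightarrow> f x = f y \<Longrightarrow> Transposition.transpose x y \<in> preserving d f"
  by (auto simp: preserving_def symgroup_def Transposition.transpose_def permutes_swap_id)

lemma preserving_comp_iff:
  assumes "p \<in> preserving d f"
  shows "p \<circ> g \<in> preserving d f \<longleftrightarrow> g \<in> preserving d f" "g \<circ> p \<in> preserving d f \<longleftrightarrow> g \<in> preserving d f"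
proof -
  have "g = inv p \<circ> (p \<circ> g)" "g = (g \<circ> p) \<circ> inv p"
    using preserving_symgroup[OF assms] by (simp_all add: o_assoc[symmetric] symgroup_cancel)
  then show "p \<circ> g \<in> preserving d f \<longleftrightarrow> g \<in> preserving d f" "g \<circ> p \<in> preserving d f \<longleftrightarrow> g \<in> preserving d f"
    using assms comp_preserving inv_preserving by metis+
qed

lemma sign_comp_symgroup: "p \<in> symgroup d \<Longrightarrow> q \<in> symgroup d \<Longrightarrow> sign (p \<circ> q) = sign p * sign q"
  by (intro sign_compose) (auto simp: symgroup_def permutation_permutes)

lemma row_sum_eq: "row_sum d \<alpha> p = (if p \<in> preserving d (row_of \<alpha>) then 1 else 0)"
  by (simp add: row_sum_def preserving_def)

lemma col_sum_eq: "col_sum d \<alpha> p = (if p \<in> preserving d (col_of \<alpha>) then of_int (sign p) else 0)"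
  by (simp add: col_sum_def preserving_def)

locale partition_of =
  fixes \<alpha> :: "nat list" and d :: nat
  assumes decreasing: "sorted_wrt (\<ge>) \<alpha>" and size: "sum_list \<alpha> = d"
begin

abbreviation "P \<equiv> preserving d (row_of \<alpha>)"
abbreviation "Q \<equiv> preserving d (col_of \<alpha>)"
abbreviation "c \<equiv> young_symmetrizer d \<alpha>"

lemma bij_box: "bij_betw (box_of \<alpha>) {..<d} (diagram \<alpha>)"
  using bij_betw_box_of[of \<alpha>] size by simp

lemma box_in_diagram: "x < d \<Longrightarrow> row_of \<alpha> x < length \<alpha>" "x < d \<Longrightarrow> col_of \<alpha> x < \<alpha> ! row_of \<alpha> x"
  using bij_betwE[OF bij_box] by (auto simp: box_of_def diagram_def)

lemma box_eqI: "x < d \<Longrightarrow> y < d \<Longrightarrow> row_of \<alpha> x = row_of \<alpha> y \<Longrightarrow> col_of \<alpha> x = col_of \<alpha> y \<Longrightarrow> x = y"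
  using inj_onD[OF bij_betw_imp_inj_on[OF bij_box], of x y] by (simp add: box_of_def)

lemma box_exists:
  assumes "r < length \<alpha>" "j < \<alpha> ! r"
  shows "\<exists>x<d. row_of \<alpha> x = r \<and> col_of \<alpha> x = j"
proof -
  have "(r, j) \<in> box_of \<alpha> ` {..<d}"
    using assms bij_betw_imp_surj_on[OF bij_box] by (simp add: diagram_def)
  then show ?thesis by (auto simp: box_of_def)
qed

lemma card_row:
  assumes r: "r < length \<alpha>"
  shows "card {y. y < d \<and> row_of \<alpha> y = r} = \<alpha> ! r"
proof -
  have "bij_betw (col_of \<alpha>) {y. y < d \<and> row_of \<alpha> y = r} {..<\<alpha> ! r}"
  proof (rule bij_betw_imageI)
    show "inj_on (col_of \<alpha>) {y. y < d \<and> row_of \<alpha> y = r}" using box_eqI by (auto intro: inj_onI)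
    show "col_of \<alpha> ` {y. y < d \<and> row_of \<alpha> y = r} = {..<\<alpha> ! r}"
      using box_in_diagram(2) box_exists[OF r] by (fastforce simp: image_def)
  qed
  then show ?thesis by (simp add: bij_betw_same_card)
qed

text \<open>Von Neumann's argument without permuting tableaux: column \<open>j\<close> of the second filling has
  as many boxes as there are rows longer than \<open>j\<close>, and by induction each of these rows already
  contributes one entry to it.\<close>

lemma col_bound:
  assumes h: "h \<in> symgroup d"
    and transversal: "\<And>x y. x < d \<Longrightarrow> y < d \<Longrightarrow> x \<noteq> y \<Longrightarrow> row_of \<alpha> x = row_of \<alpha> y \<Longrightarrow> col_of \<alpha> (h x) \<noteq> col_of \<alpha> (h y)"
    and y: "y < d"
  shows "col_of \<alpha> (h y) < \<alpha> ! row_of \<alpha> y"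
  using y
proof (induction "row_of \<alpha> y" arbitrary: y rule: less_induct)
  case less
  show ?case
  proof (rule ccontr)
    assume neg: "\<not> ?case"
    define j where "j = col_of \<alpha> (h y)"
    define S where "S = {s. s < length \<alpha> \<and> j < \<alpha> ! s}"
    define C where "C = {z. z < d \<and> col_of \<alpha> z = j}"
    have S_less: "s < row_of \<alpha> y" if "s \<in> S" for s
    proof (rule ccontr)
      assume "\<not> s < row_of \<alpha> y"
      then have "\<alpha> ! s \<le> \<alpha> ! row_of \<alpha> y"
        using that decreasing unfolding S_def sorted_wrt_iff_nth_less
        by (cases "s = row_of \<alpha> y") auto
      then show False using that neg by (simp add: S_def j_def)
    qed
    have ex: "\<exists>x<d. row_of \<alpha> x = s \<and> col_of \<alpha> (h x) = j" if s: "s \<in> S" for s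
    proof -
      let ?R = "{x. x < d \<and> row_of \<alpha> x = s}"
      have "inj_on (\<lambda>x. col_of \<alpha> (h x)) ?R"
      proof (rule inj_onI, rule ccontr)
        fix x y assume "x \<in> ?R" "y \<in> ?R" "col_of \<alpha> (h x) = col_of \<alpha> (h y)" "x \<noteq> y"
        then show False using transversal[of x y] by simp
      qed
      moreover have "(\<lambda>x. col_of \<alpha> (h x)) ` ?R \<subseteq> {..<\<alpha> ! s}"
        using less.hyps S_less[OF s] by auto
      ultimately have "(\<lambda>x. col_of \<alpha> (h x)) ` ?R = {..<\<alpha> ! s}"
        using card_row s by (intro card_subset_eq) (auto simp: card_image S_def)
      moreover have "j \<in> {..<\<alpha> ! s}" using s by (simp add: S_def)
      ultimately have "j \<in> (\<lambda>x. col_of \<alpha> (h x)) ` ?R" by blast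
      then show ?thesis by auto
    qed
    then obtain x where x: "\<And>s. s \<in> S \<Longrightarrow> x s < d \<and> row_of \<alpha> (x s) = s \<and> col_of \<alpha> (h (x s)) = j"
      by metis
    have "inj_on (\<lambda>s. h (x s)) S"
    proof (rule inj_onI)
      fix s t assume st: "s \<in> S" "t \<in> S" "h (x s) = h (x t)"
      then have "x s = x t" using symgroup_inv_o(3)[OF h] by metis
      then show "s = t" using x st by metis
    qed
    moreover have sub: "(\<lambda>s. h (x s)) ` S \<subseteq> C" using x h by (auto simp: C_def)
    moreover have "card C \<le> card S"
    proof (rule card_inj_on_le)
      show "inj_on (row_of \<alpha>) C" using box_eqI by (auto simp: C_def intro!: inj_onI)
      show "row_of \<alpha> ` C \<subseteq> S" using box_in_diagram by (auto simp: C_def S_def)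
      show "finite S" by (simp add: S_def)
    qed
    moreover have "finite C" by (simp add: C_def)
    ultimately have "(\<lambda>s. h (x s)) ` S = C"
      by (intro card_seteq) (auto simp: card_image)
    moreover have "h y \<in> C" using less.prems h by (simp add: C_def j_def)
    ultimately obtain s where s: "s \<in> S" "h y = h (x s)" by blast
    then have "y = x s" using symgroup_inv_o(3)[OF h] by metis
    then show False using S_less[OF s(1)] x[OF s(1)] by simp
  qed
qed

text \<open>The permutation \<open>p\<close> moves \<open>y\<close> along its row into the column of
  \<open>inv g y\<close>. That box exists by \<open>col_bound\<close>, and transversality makes
  \<open>p\<close> injective. Then \<open>p \<circ> g\<close> preserves columns.\<close>

lemma row_col_factorization:
  assumes g: "g \<in> symgroup d"
    and transversal: "\<And>x y. x < d \<Longrightarrow> y < d \<Longrightarrow> x \<noteq> y \<Longrightarrow> row_of \<alpha> x = row_of \<alpha> y \<Longrightarrow> col_of \<alpha> (inv g x) \<noteq> col_of \<alpha> (inv g y)"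
  obtains p q where "p \<in> P" "q \<in> Q" "g = p \<circ> q"
proof -
  have "\<exists>z<d. row_of \<alpha> z = row_of \<alpha> y \<and> col_of \<alpha> z = col_of \<alpha> (inv g y)" if "y < d" for y
    using box_exists[of "row_of \<alpha> y" "col_of \<alpha> (inv g y)"] box_in_diagram(1)[OF that]
      col_bound[OF inv_in_symgroup[OF g] transversal that] by blast
  then obtain f where f: "\<And>y. y < d \<Longrightarrow> f y < d \<and> row_of \<alpha> (f y) = row_of \<alpha> y \<and> col_of \<alpha> (f y) = col_of \<alpha> (inv g y)"
    by metis
  define p where "p y = (if y < d then f y else y)" for y
  have "inj_on p {..<d}"
  proof (rule inj_onI)
    fix x y assume "x \<in> {..<d}" "y \<in> {..<d}" "p x = p y"
    then show "x = y" using f[of x] f[of y] transversal[of x y] by (auto simp: p_def)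
  qed
  moreover have "p ` {..<d} \<subseteq> {..<d}" using f by (auto simp: p_def)
  ultimately have "bij_betw p {..<d} {..<d}"
    by (simp add: bij_betw_def endo_inj_surj)
  then have "p permutes {..<d}" by (rule bij_imp_permutes) (simp add: p_def)
  then have p: "p \<in> P" using f by (simp add: preserving_def symgroup_def p_def)
  have "p \<circ> g \<in> Q"
    using preserving_symgroup[OF p] g f by (auto simp: preserving_def p_def)
  then show thesis
    using that[of "inv p" "p \<circ> g"] p by (simp add: inv_preserving symgroup_cancel[OF preserving_symgroup])
qed

lemma preserving_both: "p \<in> P \<Longrightarrow> p \<in> Q \<Longrightarrow> p = id"
proof (rule ext)
  fix x assume "p \<in> P" "p \<in> Q"
  then show "p x = id x"
    using box_eqI[of "p x" x] permutes_not_in[of p "{..<d}" x] by (cases "x < d") (auto simp: preserving_def symgroup_def)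
qed

lemma col_sum_alg: "col_sum d \<alpha> \<in> group_algebra d"
  by (simp add: group_algebra_def col_sum_def)

lemma young_alg: "c \<in> group_algebra d"
  by (simp add: young_symmetrizer_def col_sum_alg)

lemma col_sum_right: "q \<in> Q \<Longrightarrow> col_sum d \<alpha> (g \<circ> q) = of_int (sign q) * col_sum d \<alpha> g"
  by (auto simp: col_sum_eq preserving_comp_iff sign_comp_symgroup[OF preserving_symgroup preserving_symgroup])

lemma convolution_right:
  assumes "\<And>g. h (g \<circ> q) = k * h g"
  shows "convolution d f h (g \<circ> q) = k * convolution d f h g"
  using assms by (simp add: convolution_def sum_distrib_left o_assoc mult.left_commute)

lemma convolution_left_inv:
  assumes "left_action p f = f" "p \<in> symgroup d"
  shows "left_action p (convolution d f h) = convolution d f h"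
  using left.act_left_action[OF assms(2), of f h] assms(1) by (simp add: convolution_eq_act)

lemma row_sum_left: "p \<in> P \<Longrightarrow> left_action p (row_sum d \<alpha>) = row_sum d \<alpha>"
  by (rule ext) (simp add: left_action_def row_sum_eq preserving_comp_iff[OF inv_preserving])

lemma young_left: "p \<in> P \<Longrightarrow> left_action p c = c"
  unfolding young_symmetrizer_def by (rule convolution_left_inv[OF row_sum_left preserving_symgroup])

lemma young_right: "q \<in> Q \<Longrightarrow> c (g \<circ> q) = of_int (sign q) * c g"
  unfolding young_symmetrizer_def by (rule convolution_right) (rule col_sum_right)

text \<open>\<open>P\<close> and \<open>Q\<close> meet only in \<open>id\<close>, so the convolution
  at \<open>id\<close> has a single nonzero term.\<close>

lemma young_id: "c id = 1"
proof -
  have "c id = (\<Sum>p\<in>symgroup d. if p = id then 1 else 0)"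
    unfolding young_symmetrizer_def convolution_def
  proof (intro sum.cong refl)
    fix p assume p: "p \<in> symgroup d"
    have "p = id" if "p \<in> P" "inv p \<in> Q"
      using preserving_both[of p] that inv_preserving[of "inv p"] p by auto
    then show "row_sum d \<alpha> p * col_sum d \<alpha> (inv p \<circ> id) = (if p = id then 1 else 0)"
      by (auto simp: row_sum_eq col_sum_eq)
  qed
  then show ?thesis by simp
qed

text \<open>If \<open>g\<close> is not a product \<open>p \<circ> q\<close>, two boxes of one row
  have preimages under \<open>g\<close> in one column. The corresponding transpositions satisfy
  \<open>t \<circ> g = g \<circ> q\<close>, and invariance under \<open>t\<close> with antisymmetry
  under \<open>q\<close> gives \<open>y g = - y g\<close>. On the products, \<open>y\<close> is
  determined up to sign by its value at \<open>id\<close>.\<close>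

lemma semi_invariant_unique:
  assumes y: "y \<in> group_algebra d" "\<And>p. p \<in> P \<Longrightarrow> left_action p y = y"
    "\<And>q g. q \<in> Q \<Longrightarrow> y (g \<circ> q) = of_int (sign q) * y g" and y0: "y id = 0"
  shows "y = 0"
proof
  fix g
  show "y g = 0 g"
  proof (cases "g \<in> symgroup d")
    case g: True
    have left: "y (p \<circ> g) = y g" if "p \<in> P" for p g
      using fun_cong[OF y(2)[OF inv_preserving[OF that]], of g] preserving_symgroup[OF that]
      by (simp add: left_action_def)
    show ?thesis
    proof (cases "\<exists>p\<in>P. \<exists>q\<in>Q. g = p \<circ> q")
      case True
      then obtain p q where "p \<in> P" "q \<in> Q" "g = p \<circ> (id \<circ> q)" by auto
      then show ?thesis using left y(3) y0 by (metis mult_zero_right zero_fun_apply)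
    next
      case False
      then obtain x x' where x: "x < d" "x' < d" "x \<noteq> x'" "row_of \<alpha> x = row_of \<alpha> x'"
        "col_of \<alpha> (inv g x) = col_of \<alpha> (inv g x')"
        using row_col_factorization[OF g] by metis
      let ?t = "Transposition.transpose x x'" and ?q = "Transposition.transpose (inv g x) (inv g x')"
      have "?t \<in> P" using x by (intro transpose_preserving)
      moreover have "?q \<in> Q" using x g by (intro transpose_preserving) auto
      moreover have "?t \<circ> g = g \<circ> ?q"
      proof
        fix z
        have "g z = x \<longleftrightarrow> z = inv g x" "g z = x' \<longleftrightarrow> z = inv g x'"
          using symgroup_inv_o(3,4)[OF g] by metis+
        then show "(?t \<circ> g) z = (g \<circ> ?q) z"
          using symgroup_inv_o(4)[OF g] by (auto simp: Transposition.transpose_def)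
      qed
      moreover have "sign ?q = -1"
        using x(3) symgroup_inv_o(4)[OF g] by (metis sign_swap_id)
      ultimately have "y g = - y g" using left y(3) by (metis mult_minus1 of_int_1 of_int_minus)
      then show ?thesis by simp
    qed
  qed (use y(1) in \<open>simp add: group_algebra_def\<close>)
qed

text \<open>Like \<open>c\<close>, the element \<open>c x c\<close> is invariant under
  \<open>P\<close> on the left and alternating under \<open>Q\<close> on the right. Since
  \<open>c id = 1\<close>, the scalar is the value of \<open>c x c\<close> at
  \<open>id\<close>.\<close>

sublocale primitive_element d c
proof
  show "c \<in> group_algebra d" by (rule young_alg)
  show "c \<noteq> 0" using young_id by auto
  fix x assume x: "x \<in> group_algebra d"
  define y where "y = convolution d c (convolution d x c)"
  have yA: "y \<in> group_algebra d" by (simp add: y_def young_alg)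
  have left: "left_action p y = y" if "p \<in> P" for p
    unfolding y_def by (rule convolution_left_inv[OF young_left[OF that] preserving_symgroup[OF that]])
  have right: "y (g \<circ> q) = of_int (sign q) * y g" if "q \<in> Q" for g q
    unfolding y_def by (rule convolution_right, rule convolution_right, rule young_right[OF that])
  have "y - cscale (y id) c = 0"
  proof (rule semi_invariant_unique)
    show "y - cscale (y id) c \<in> group_algebra d"
      using yA young_alg by (intro cfun.subspace_diff cfun.subspace_scale subspace_group_algebra)
    show "left_action p (y - cscale (y id) c) = y - cscale (y id) c" if "p \<in> P" for p
      using left[OF that] young_left[OF that] by (simp add: left_action_def fun_eq_iff cscale_def)
    show "(y - cscale (y id) c) (g \<circ> q) = of_int (sign q) * (y - cscale (y id) c) g" if "q \<in> Q" for g q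
      using right[OF that, of g] young_right[OF that, of g] by (simp add: cscale_def algebra_simps)
    show "(y - cscale (y id) c) id = 0" by (simp add: cscale_def young_id)
  qed
  then show "\<exists>k. convolution d c (convolution d x c) = cscale k c" unfolding y_def by (metis eq_iff_diff_eq_0)
qed

lemma ideal_eq_specht: "ideal = specht d \<alpha>"
  by (simp add: ideal_def specht_def)

end

section \<open>Two-row Specht modules\<close>

definition set_action :: "(nat \<Rightarrow> nat) \<Rightarrow> (nat set \<Rightarrow> complex) \<Rightarrow> nat set \<Rightarrow> complex"
  where "set_action g \<phi> = (\<lambda>A. \<phi> (inv g ` A))"

text \<open>Inside the permutation module on \<open>i\<close>-subsets this is the kernel of the map
  that sums over supersets to the smaller subsets, the classical model of the Specht module of a
  two-row shape.\<close>

definition harmonic :: "nat \<Rightarrow> nat \<Rightarrow> (nat set \<Rightarrow> complex) set"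
  where "harmonic d i = {\<phi>. (\<forall>A. \<phi> A \<noteq> 0 \<longrightarrow> A \<subseteq> {..<d} \<and> card A = i) \<and>
    (\<forall>B. B \<subseteq> {..<d} \<longrightarrow> (\<Sum>x\<in>{..<d} - B. \<phi> (insert x B)) = 0)}"

lemma symgroup_action_set: "symgroup_action d set_action"
proof (rule symgroup_action.intro)
  show "clinear (set_action g)" if "g \<in> symgroup d" for g
    by (rule clinearI) (auto simp: set_action_def cscale_def)
  show "set_action id v = v" for v
    by (simp add: set_action_def)
  show "set_action (g \<circ> h) v = set_action g (set_action h v)"
    if "g \<in> symgroup d" "h \<in> symgroup d" for g h v
    using that by (simp add: set_action_def symgroup_inv_comp image_comp)
qed

interpretation sets: symgroup_action d set_action for d
  by (rule symgroup_action_set)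

lemma symgroup_image_subset_iff [simp]: "p \<in> symgroup d \<Longrightarrow> p ` A \<subseteq> {..<d} \<longleftrightarrow> A \<subseteq> {..<d}"
  by auto

lemma inj_symgroup: "p \<in> symgroup d \<Longrightarrow> inj_on p A"
  by (rule inj_on_inverseI[where g = "inv p"]) simp

lemma card_image_symgroup [simp]: "p \<in> symgroup d \<Longrightarrow> card (p ` A) = card A"
  by (intro card_image inj_symgroup)

lemma symgroup_image_image [simp]:
  "p \<in> symgroup d \<Longrightarrow> inv p ` p ` A = A" "p \<in> symgroup d \<Longrightarrow> p ` inv p ` A = A"
  by (simp_all add: image_image)

lemma symgroup_image_Diff: "p \<in> symgroup d \<Longrightarrow> p ` ({..<d} - B) = {..<d} - p ` B"
proof -
  assume p: "p \<in> symgroup d"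
  then have "p ` {..<d} = {..<d}" by (simp add: symgroup_def permutes_image)
  then show ?thesis using image_set_diff[OF inj_symgroup[OF p, of UNIV]] by simp
qed

lemma symgroup_transitive_on_sets:
  assumes "A \<subseteq> {..<d}" "B \<subseteq> {..<d}" "card A = card B"
  obtains p where "p \<in> symgroup d" "p ` A = B"
proof -
  have fin: "finite A" "finite B" using assms finite_subset by blast+
  then obtain f where f: "bij_betw f A B" using assms finite_same_card_bij[of A B] by auto
  have "card ({..<d} - A) = card ({..<d} - B)"
    using assms fin by (simp add: card_Diff_subset)
  then obtain h where h: "bij_betw h ({..<d} - A) ({..<d} - B)"
    using finite_same_card_bij[of "{..<d} - A" "{..<d} - B"] by auto
  define p where "p x = (if x \<in> A then f x else if x < d then h x else x)" for x
  have 1: "bij_betw p A B" using f by (subst bij_betw_cong[of A p f]) (auto simp: p_def)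
  moreover have "bij_betw p ({..<d} - A) ({..<d} - B)"
    using h by (subst bij_betw_cong[of "{..<d} - A" p h]) (auto simp: p_def)
  ultimately have "bij_betw p (A \<union> ({..<d} - A)) (B \<union> ({..<d} - B))"
    by (rule bij_betw_combine) auto
  moreover have "A \<union> ({..<d} - A) = {..<d}" "B \<union> ({..<d} - B) = {..<d}" using assms by auto
  ultimately have "bij_betw p {..<d} {..<d}" by simp
  then have "p permutes {..<d}"
    by (rule bij_imp_permutes) (use assms(1) in \<open>auto simp: p_def\<close>)
  moreover have "p ` A = B" using 1 by (simp add: bij_betw_def)
  ultimately show thesis using that by (simp add: symgroup_def)
qed

lemma subrep_harmonic: "subrep (symgroup d) set_action (harmonic d i)"
  unfolding subrep_def
proof (intro conjI ballI)
  show "cfun.subspace (harmonic d i)"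
  proof (rule cfun.subspaceI)
    show "0 \<in> harmonic d i" by (simp add: harmonic_def)
    show "\<phi> + \<psi> \<in> harmonic d i" if "\<phi> \<in> harmonic d i" "\<psi> \<in> harmonic d i" for \<phi> \<psi>
    proof -
      have "A \<subseteq> {..<d} \<and> card A = i" if "(\<phi> + \<psi>) A \<noteq> 0" for A
      proof -
        have "\<phi> A \<noteq> 0 \<or> \<psi> A \<noteq> 0" using that by auto
        then show ?thesis using \<open>\<phi> \<in> _\<close> \<open>\<psi> \<in> _\<close> unfolding harmonic_def by blast
      qed
      then show ?thesis using that by (simp add: harmonic_def sum.distrib)
    qed
    show "cscale k \<phi> \<in> harmonic d i" if "\<phi> \<in> harmonic d i" for k \<phi>
      using that by (auto simp: harmonic_def cscale_apply simp flip: sum_distrib_left)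
  qed
  fix g \<phi> assume g: "g \<in> symgroup d" and \<phi>: "\<phi> \<in> harmonic d i"
  have "(\<Sum>x\<in>{..<d} - B. set_action g \<phi> (insert x B)) = 0" if "B \<subseteq> {..<d}" for B
  proof -
    let ?h = "inv g"
    have h: "?h \<in> symgroup d" using g by simp
    have "(\<Sum>x\<in>{..<d} - B. set_action g \<phi> (insert x B)) = (\<Sum>x\<in>{..<d} - B. \<phi> (insert (?h x) (?h ` B)))"
      by (simp add: set_action_def)
    also have "\<dots> = (\<Sum>x\<in>?h ` ({..<d} - B). \<phi> (insert x (?h ` B)))"
      by (simp add: sum.reindex[OF inj_symgroup[OF h]])
    also have "\<dots> = 0"
      unfolding symgroup_image_Diff[OF h] using \<phi> that h by (simp add: harmonic_def)
    finally show ?thesis .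
  qed
  moreover have "A \<subseteq> {..<d} \<and> card A = i" if "set_action g \<phi> A \<noteq> 0" for A
    using that \<phi> g symgroup_image_subset_iff[of "inv g" d A] card_image_symgroup[of "inv g" d A]
    by (auto simp: set_action_def harmonic_def)
  ultimately show "set_action g \<phi> \<in> harmonic d i" by (simp add: harmonic_def)
qed

lemma sum_eq_neg_imp_0: "(a :: complex) = - a \<Longrightarrow> a = 0"
  by simp

locale two_row =
  fixes d i :: nat
  assumes le: "2 * i \<le> d"
begin

abbreviation "\<alpha> \<equiv> padded (row_partition i) d"
text \<open>The boxes of the second row, a base point among the \<open>i\<close>-subsets whose
  stabilizer is the row group \<open>P\<close>.\<close>

abbreviation "m \<equiv> {d - i..<d}"

lemma \<alpha>_eq: "\<alpha> = row_partition (d - i) @ row_partition i"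
  by (simp add: padded_def row_partition_def)

sublocale partition_of \<alpha> d
proof
  show "sorted_wrt (\<ge>) \<alpha>" using le unfolding \<alpha>_eq by (auto simp: row_partition_def)
  show "sum_list \<alpha> = d" using le unfolding \<alpha>_eq by (auto simp: row_partition_def)
qed

lemma box_of_two_row:
  assumes "x < d"
  shows "box_of \<alpha> x = (if x < d - i then (0, x) else (1, x - (d - i)))"
proof (cases "x < d - i")
  case True
  then show ?thesis using box_of_position[of 0 \<alpha> x] unfolding \<alpha>_eq by (auto simp: row_partition_def)
next
  case False
  then show ?thesis
    using assms le box_of_position[of 1 \<alpha> "x - (d - i)"]
    unfolding \<alpha>_eq by (auto simp: row_partition_def)
qed

lemma row_of_two_row: "x < d \<Longrightarrow> row_of \<alpha> x = (if x < d - i then 0 else 1)"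
  and col_of_two_row: "x < d \<Longrightarrow> col_of \<alpha> x = (if x < d - i then x else x - (d - i))"
  using box_of_two_row[of x] by (auto simp: box_of_def split: if_splits)

lemma m_subset: "m \<subseteq> {..<d}" "card m = i" "finite m"
  using le by auto

lemma preserving_m_iff: "p \<in> symgroup d \<Longrightarrow> p \<in> P \<longleftrightarrow> p ` m = m"
proof
  assume p: "p \<in> symgroup d" "p \<in> P"
  have "p x \<in> m" if "x \<in> m" for x
  proof -
    have x: "x < d" "p x < d" using that p(1) by auto
    have "row_of \<alpha> (p x) = row_of \<alpha> x" using p(2) x(1) by (simp add: preserving_def)
    then show ?thesis using that x row_of_two_row by (auto split: if_splits)
  qed
  then have "p ` m \<subseteq> m" by blast
  then show "p ` m = m" using p(1) by (intro card_subset_eq) auto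
next
  assume p: "p \<in> symgroup d" "p ` m = m"
  have "p x \<in> m \<longleftrightarrow> x \<in> m" for x
    using p symgroup_inv_o(3)[OF p(1)] by (metis image_iff)
  then have "row_of \<alpha> (p x) = row_of \<alpha> x" if "x < d" for x
    using that p(1) by (simp add: row_of_two_row) (metis atLeastLessThan_iff not_less symgroup_less)
  then show "p \<in> P" using p(1) by (simp add: preserving_def)
qed

text \<open>Induction on \<open>card (A - m)\<close>. For \<open>y\<close> in \<open>A\<close>
  outside \<open>m\<close>, consider the harmonic condition at \<open>A - {y}\<close>: adding a
  point of \<open>m\<close> gives 0 by induction, and adding a point outside \<open>m\<close> gives
  \<open>u A\<close>, since a row transposition moves that point to \<open>y\<close>. At least one
  summand is of the second kind, namely that of \<open>y\<close>.\<close>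

lemma row_invariant_harmonic_0:
  assumes u: "u \<in> harmonic d i" and inv: "\<And>p. p \<in> P \<Longrightarrow> set_action p u = u" and um: "u m = 0"
  shows "u = 0"
proof -
  have *: "u A = 0" if "A \<subseteq> {..<d}" "card A = i" "card (A - m) = k" for A k
    using that
  proof (induction k arbitrary: A)
    case 0
    have finA: "finite A" using 0 finite_subset by blast
    then have "A \<subseteq> m" using 0 by auto
    then have "A = m" using 0 le by (intro card_subset_eq) auto
    then show ?case using um by simp
  next
    case (Suc k)
    have finA: "finite A" using Suc.prems finite_subset by blast
    obtain y where y: "y \<in> A" "y \<notin> m" using Suc.prems by (metis DiffE card.empty ex_in_conv nat.distinct(1))
    define B where "B = A - {y}"
    have A: "A = insert y B" and yB: "y \<notin> B" and Bd: "B \<subseteq> {..<d}" and yd: "y < d"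
      using y Suc.prems by (auto simp: B_def)
    have finB: "finite B" using finA by (simp add: B_def)
    have cardB: "Suc (card B) = i"
      using Suc.prems(2) A card_insert_disjoint[OF finB yB] by simp
    have Bm: "card (B - m) = k"
    proof -
      have "A - m = insert y (B - m)" using A y by auto
      then show ?thesis using Suc.prems yB finA by (simp add: B_def)
    qed
    have in_m: "u (insert x B) = 0" if "x \<in> {..<d} - B" "x \<in> m" for x
    proof (rule Suc.IH)
      show "insert x B \<subseteq> {..<d}" using that Bd by auto
      show "card (insert x B) = i" using that(1) cardB finB by simp
      show "card (insert x B - m) = k" using that Bm by simp
    qed
    have out_m: "u (insert x B) = u A" if "x \<in> {..<d} - B" "x \<notin> m" for x
    proof -
      let ?t = "Transposition.transpose x y"
      have "?t \<in> P" using that y yd row_of_two_row by (intro transpose_preserving) auto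
      then have "u (inv ?t ` insert x B) = u (insert x B)"
        using inv by (metis set_action_def)
      moreover have "inv ?t ` insert x B = A"
      proof -
        have "?t ` B = id ` B"
          using that yB by (intro image_cong) (auto simp: Transposition.transpose_def)
        then show ?thesis using A by (simp add: inv_swap_id)
      qed
      ultimately show ?thesis by simp
    qed
    have "0 = (\<Sum>x\<in>{..<d} - B. u (insert x B))" using u Bd by (simp add: harmonic_def)
    also have "\<dots> = (\<Sum>x\<in>{..<d} - B - m. u (insert x B))"
      using in_m by (intro sum.mono_neutral_right) auto
    also have "\<dots> = (\<Sum>x\<in>{..<d} - B - m. u A)" by (rule sum.cong) (use out_m in auto)
    also have "\<dots> = of_nat (card ({..<d} - B - m)) * u A" by simp
    finally have "card ({..<d} - B - m) = 0 \<or> u A = 0"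
      by (metis mult_eq_0_iff of_nat_eq_0_iff)
    moreover have "card ({..<d} - B - m) \<noteq> 0"
      using y yB yd by (subst card_0_eq) auto
    ultimately show ?case by simp
  qed
  show ?thesis
  proof
    fix A show "u A = 0 A" using * u by (cases "u A = 0") (auto simp: harmonic_def)
  qed
qed

text \<open>A set where some element of \<open>U\<close> does not vanish is moved to
  \<open>m\<close>. Summing over the stabilizer \<open>P\<close> then multiplies the value at
  \<open>m\<close> by \<open>card P\<close>, which keeps it nonzero.\<close>

lemma row_invariant_in_subrep:
  assumes U: "subrep (symgroup d) set_action U" "U \<subseteq> harmonic d i" "U \<noteq> {0}"
  shows "\<exists>v\<in>U. v m = 1 \<and> (\<forall>p\<in>P. set_action p v = v)"
proof -
  have sub: "cfun.subspace U" using U(1) by (rule subrep_subspace)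
  obtain u where u: "u \<in> U" "u \<noteq> 0" using U(3) cfun.subspace_0[OF sub] by blast
  then obtain A where A: "u A \<noteq> 0" by (auto simp: fun_eq_iff)
  then have "A \<subseteq> {..<d}" "card A = i" using u U(2) unfolding harmonic_def by blast+
  then obtain p where p: "p \<in> symgroup d" "p ` A = m"
    using symgroup_transitive_on_sets[of A d m] m_subset by auto
  define u' where "u' = set_action p u"
  have u': "u' \<in> U" "u' m \<noteq> 0"
    using u U(1) p A by (auto simp: u'_def subrep_def set_action_def simp flip: p(2))
  define w where "w = (\<Sum>p\<in>P. set_action p u')"
  have wU: "w \<in> U"
    unfolding w_def using U(1) u'(1) unfolding subrep_def
    by (intro cfun.subspace_sum[OF sub]) (blast dest: preserving_symgroup)
  have winv: "set_action q w = w" if q: "q \<in> P" for q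
  proof -
    have qs: "q \<in> symgroup d" using q by (rule preserving_symgroup)
    have "set_action q w = (\<Sum>p\<in>P. set_action (q \<circ> p) u')"
      unfolding w_def cfun_pair.linear_sum[OF sets.linear[OF qs]]
      by (rule sum.cong[OF refl], rule sets.mult[OF qs preserving_symgroup, symmetric])
    also have "\<dots> = w"
      unfolding w_def
      by (rule sum.reindex_bij_witness[where i = "\<lambda>p. inv q \<circ> p" and j = "\<lambda>p. q \<circ> p"])
         (use qs comp_preserving[OF q] comp_preserving[OF inv_preserving[OF q]] in \<open>auto simp: symgroup_cancel\<close>)
    finally show ?thesis .
  qed
  have "w m = (\<Sum>p\<in>P. u' m)"
    unfolding w_def sum_fun_apply
  proof (rule sum.cong)
    fix p assume "p \<in> P"
    then have "inv p ` m = m" using preserving_m_iff inv_preserving preserving_symgroup by metis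
    then show "set_action p u' m = u' m" by (simp add: set_action_def)
  qed simp
  moreover have "card P \<noteq> 0" using id_preserving by (metis card_0_eq empty_iff finite_preserving)
  ultimately have wm: "w m \<noteq> 0" using u'(2) by simp
  show ?thesis
  proof (intro bexI conjI ballI)
    show "cscale (1 / w m) w \<in> U" by (rule cfun.subspace_scale[OF sub wU])
    show "cscale (1 / w m) w m = 1" using wm by (simp add: cscale_apply)
    show "set_action p (cscale (1 / w m) w) = cscale (1 / w m) w" if "p \<in> P" for p
      using winv[OF that] cfun_pair.linear_scale[OF sets.linear[OF preserving_symgroup[OF that]]] by metis
  qed
qed

text \<open>A nonzero complement of \<open>U\<close> would contain a row-invariant vector with value
  1 at \<open>m\<close>, as \<open>U\<close> does. By \<open>row_invariant_harmonic_0\<close> the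
  two vectors agree, against the trivial intersection.\<close>

lemma harmonic_irreducible:
  assumes U: "subrep (symgroup d) set_action U" "U \<subseteq> harmonic d i" "U \<noteq> {0}"
  shows "U = harmonic d i"
proof -
  obtain U' where U': "subrep (symgroup d) set_action U'" "U' \<subseteq> harmonic d i" "U \<inter> U' = {0}"
    and sum: "\<And>w. w \<in> harmonic d i \<Longrightarrow> \<exists>u\<in>U. \<exists>u'\<in>U'. w = u + u'"
    using sets.maschke[OF subrep_harmonic U(1,2)] by metis
  have "U' = {0}"
  proof (rule ccontr)
    assume "U' \<noteq> {0}"
    obtain v where v: "v \<in> U" "v m = 1" "\<And>p. p \<in> P \<Longrightarrow> set_action p v = v"
      using row_invariant_in_subrep[OF U] by blast
    obtain v' where v': "v' \<in> U'" "v' m = 1" "\<And>p. p \<in> P \<Longrightarrow> set_action p v' = v'"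
      using row_invariant_in_subrep[OF U'(1,2) \<open>U' \<noteq> {0}\<close>] by blast
    have "v - v' = 0"
    proof (rule row_invariant_harmonic_0)
      show "v - v' \<in> harmonic d i"
        using v v' U U' subrep_subspace[OF subrep_harmonic] by (intro cfun.subspace_diff) auto
      show "set_action p (v - v') = v - v'" if "p \<in> P" for p
        using v(3)[OF that] v'(3)[OF that] by (simp add: set_action_def fun_eq_iff)
    qed (use v v' in simp)
    then have "v \<in> U \<inter> U'" using v v' by simp
    then show False using U'(3) v(2) by auto
  qed
  then show ?thesis using sum U(2) by fastforce
qed

section \<open>The isomorphism of the Specht module with the harmonic functions\<close>

definition base :: "nat set \<Rightarrow> complex"
  where "base A = (if A = m then 1 else 0)"

definition specht_map :: "((nat \<Rightarrow> nat) \<Rightarrow> complex) \<Rightarrow> nat set \<Rightarrow> complex"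
  where "specht_map f = act d set_action f base"

lemma clinear_specht_map: "clinear specht_map"
  by (rule clinearI) (simp_all add: specht_map_def act_add_left act_cscale_left)

lemma specht_map_left_action:
  "g \<in> symgroup d \<Longrightarrow> specht_map (left_action g f) = set_action g (specht_map f)"
  by (simp add: specht_map_def sets.act_left_action)

text \<open>If \<open>B\<close> has \<open>i - 1\<close> elements, one of the \<open>i\<close>
  columns of length two avoids \<open>B\<close>. Exchanging the boxes of this column permutes the
  summands of the condition at \<open>B\<close> and changes the sign of each, so their sum equals
  its own negative.\<close>

lemma col_sum_base_harmonic: "act d set_action (col_sum d \<alpha>) base \<in> harmonic d i"
proof -
  let ?b = "col_sum d \<alpha>"
  define \<phi> where "\<phi> = act d set_action ?b base"
  have supp: "A \<subseteq> {..<d} \<and> card A = i" if "\<phi> A \<noteq> 0" for A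
  proof -
    have "\<exists>g\<in>symgroup d. ?b g * set_action g base A \<noteq> 0"
      using that unfolding \<phi>_def act_apply by (metis (no_types, lifting) sum.neutral)
    then obtain g where g: "g \<in> symgroup d" "inv g ` A = m"
      by (auto simp: set_action_def base_def split: if_splits)
    then have "A = g ` m" by (metis symgroup_image_image(2))
    then show ?thesis using g(1) m_subset by simp
  qed
  have anti: "\<phi> (Transposition.transpose x y ` A) = - \<phi> A"
    if xy: "x < d" "y < d" "x \<noteq> y" "col_of \<alpha> x = col_of \<alpha> y" for x y A
  proof -
    let ?t = "Transposition.transpose x y"
    have t: "?t \<in> Q" using xy by (intro transpose_preserving)
    then have ts: "?t \<in> symgroup d" by (rule preserving_symgroup)
    have "left_action ?t ?b = cscale (-1) ?b"
    proof
      fix g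
      have "sign (?t \<circ> g) = - sign g" if "g \<in> Q"
        using sign_comp_symgroup[OF ts preserving_symgroup[OF that]] xy(3) by (simp add: sign_swap_id)
      then show "left_action ?t ?b g = cscale (-1) ?b g"
        using preserving_comp_iff(1)[OF t] by (simp add: left_action_def col_sum_eq cscale_apply inv_swap_id)
    qed
    then have "set_action ?t \<phi> = cscale (-1) \<phi>"
      using sets.act_left_action[OF ts, of ?b base] unfolding \<phi>_def by (metis act_cscale_left)
    then have "set_action ?t \<phi> A = - \<phi> A" by (simp add: cscale_apply)
    then show ?thesis by (simp add: set_action_def inv_swap_id)
  qed
  have "(\<Sum>x\<in>{..<d} - B. \<phi> (insert x B)) = 0" if B: "B \<subseteq> {..<d}" for B
  proof (cases "Suc (card B) = i")
    case False
    have "finite B" using B finite_subset by blast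
    then have "\<phi> (insert x B) = 0" if "x \<in> {..<d} - B" for x
      using supp[of "insert x B"] that False by auto
    then show ?thesis by simp
  next
    case True
    have "\<exists>j<i. j \<notin> B \<and> d - i + j \<notin> B"
    proof (rule ccontr)
      assume neg: "\<not> ?thesis"
      let ?f = "\<lambda>j. if j \<in> B then j else d - i + j"
      have "inj_on ?f {..<i}" using le by (auto intro!: inj_onI split: if_splits)
      moreover have "?f ` {..<i} \<subseteq> B" using neg by auto
      ultimately have "card {..<i} \<le> card B"
        using finite_subset[OF B] by (intro card_inj_on_le[of ?f]) auto
      then show False using True by simp
    qed
    then obtain j where j: "j < i" "j \<notin> B" "d - i + j \<notin> B" by blast
    let ?t = "Transposition.transpose j (d - i + j)"
    have lt: "j < d" "d - i + j < d" "j \<noteq> d - i + j" "col_of \<alpha> j = col_of \<alpha> (d - i + j)"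
      using j le by (auto simp: col_of_two_row)
    have ts: "?t \<in> symgroup d"
      using transpose_preserving[OF lt(1,2,4)] by (rule preserving_symgroup)
    have tB: "?t ` B = B"
    proof -
      have "?t ` B = id ` B"
        using j by (intro image_cong) (auto simp: Transposition.transpose_def)
      then show ?thesis by simp
    qed
    have "(\<Sum>x\<in>{..<d} - B. \<phi> (insert x B)) = (\<Sum>x\<in>?t ` ({..<d} - B). \<phi> (insert x B))"
      using symgroup_image_Diff[OF ts, of B] tB by simp
    also have "\<dots> = (\<Sum>x\<in>{..<d} - B. \<phi> (?t ` insert x B))"
      using tB by (simp add: sum.reindex[OF inj_symgroup[OF ts]])
    also have "\<dots> = - (\<Sum>x\<in>{..<d} - B. \<phi> (insert x B))"
      by (simp only: anti[OF lt] sum_negf)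
    finally show ?thesis by (rule sum_eq_neg_imp_0)
  qed
  then show ?thesis using supp unfolding \<phi>_def harmonic_def by blast
qed

text \<open>\<open>c\<close> is the row sum times the column sum, and the column sum already makes
  \<open>base\<close> harmonic.\<close>

lemma specht_map_young_harmonic: "specht_map c \<in> harmonic d i"
  unfolding specht_map_def young_symmetrizer_def sets.act_convolution
  by (intro act_mem_subrep[OF subrep_harmonic] col_sum_base_harmonic)

text \<open>Only the elements fixing \<open>m\<close>, that is those of \<open>P\<close>, contribute
  to the value at \<open>m\<close>, and \<open>c\<close> is 1 on them.\<close>

lemma specht_map_young_neq_0: "specht_map c \<noteq> 0"
proof -
  have "specht_map c m = (\<Sum>g\<in>symgroup d. if g \<in> P then 1 else 0)"
    unfolding specht_map_def act_apply
  proof (intro sum.cong refl)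
    fix g assume g: "g \<in> symgroup d"
    have "inv g ` m = m \<longleftrightarrow> g \<in> P"
      using g preserving_m_iff by (metis symgroup_image_image)
    moreover have "c g = 1" if "g \<in> P"
      using fun_cong[OF young_left[OF that], of g] young_id symgroup_inv_o(1)[OF g] by (simp add: left_action_def)
    ultimately show "c g * set_action g base m = (if g \<in> P then 1 else 0)"
      by (simp add: set_action_def base_def)
  qed
  also have "\<dots> = of_nat (card (symgroup d \<inter> P))"
    by (simp add: sum.If_cases Int_def)
  also have "\<dots> \<noteq> 0"
    by (metis IntI card_0_eq empty_iff finite_Int finite_symgroup id_in_symgroup id_preserving of_nat_eq_0_iff)
  finally show ?thesis by auto
qed

text \<open>Schur's lemma again: the image is a nonzero submodule of the irreducible harmonic space,
  the kernel a proper submodule of the irreducible ideal.\<close>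

lemma bij_betw_specht_map: "bij_betw specht_map (specht d \<alpha>) (harmonic d i)"
proof -
  have sub: "cfun.subspace ideal" using subrep_ideal by (rule subrep_subspace)
  have "specht_map ` ideal \<subseteq> harmonic d i"
    unfolding ideal_def using specht_map_young_harmonic
    by (auto simp: specht_map_def sets.act_convolution intro: act_mem_subrep[OF subrep_harmonic])
  moreover have "subrep (symgroup d) set_action (specht_map ` ideal)"
    by (rule subrep_image[OF subrep_ideal clinear_specht_map]) (rule specht_map_left_action)
  moreover have "specht_map ` ideal \<noteq> {0}" using specht_map_young_neq_0 c_in_ideal by blast
  ultimately have im: "specht_map ` ideal = harmonic d i" using harmonic_irreducible by blast
  have "subrep (symgroup d) left_action {f \<in> ideal. specht_map f = 0}"
    by (rule subrep_kernel[OF subrep_ideal clinear_specht_map, where \<sigma> = set_action])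
       (simp_all add: specht_map_left_action sets.zero)
  moreover have "{f \<in> ideal. specht_map f = 0} \<noteq> ideal"
    using c_in_ideal specht_map_young_neq_0 by blast
  ultimately have "{f \<in> ideal. specht_map f = 0} = {0}"
    using irreducible_ideal unfolding irreducible_rep_def by blast
  then have "inj_on specht_map ideal"
    unfolding clinear_inj_on_iff[OF clinear_specht_map sub] by blast
  then show ?thesis using im by (simp add: bij_betw_def ideal_eq_specht)
qed

end

section \<open>Tensor products\<close>

text \<open>This is \<open>S \<otimes> T\<close>: \<open>T\<close> in the second variable, then
  \<open>S\<close> in the first. It makes sense on all functions of two variables because
  \<open>S\<close> and \<open>T\<close> are maps of the ambient spaces.\<close>

definition tensor_map :: "(('x \<Rightarrow> complex) \<Rightarrow> 'a \<Rightarrow> complex) \<Rightarrow> (('y \<Rightarrow> complex) \<Rightarrow> 'b \<Rightarrow> complex)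
    \<Rightarrow> ('x \<times> 'y \<Rightarrow> complex) \<Rightarrow> 'a \<times> 'b \<Rightarrow> complex"
  where "tensor_map S T F = (\<lambda>(a, b). S (\<lambda>x. T (\<lambda>y. F (x, y)) b) a)"

lemma clinear_tensor_map:
  fixes S :: "('x \<Rightarrow> complex) \<Rightarrow> 'a \<Rightarrow> complex" and T :: "('y \<Rightarrow> complex) \<Rightarrow> 'b \<Rightarrow> complex"
  assumes S: "clinear S" and T: "clinear T"
  shows "clinear (tensor_map S T)"
proof (rule clinearI)
  fix F F' and k :: complex
  show "tensor_map S T (F + F') = tensor_map S T F + tensor_map S T F'"
  proof
    fix z :: "'a \<times> 'b" obtain a b where z: "z = (a, b)" by force
    have "T (\<lambda>y. F (x, y) + F' (x, y)) = T (\<lambda>y. F (x, y)) + T (\<lambda>y. F' (x, y))" for x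
      using cfun_pair.linear_add[OF T, of "\<lambda>y. F (x, y)" "\<lambda>y. F' (x, y)"] by (simp add: plus_fun_def)
    then show "tensor_map S T (F + F') z = (tensor_map S T F + tensor_map S T F') z"
      using cfun_pair.linear_add[OF S, of "\<lambda>x. T (\<lambda>y. F (x, y)) b" "\<lambda>x. T (\<lambda>y. F' (x, y)) b"]
      by (simp add: z tensor_map_def plus_fun_def)
  qed
  show "tensor_map S T (cscale k F) = cscale k (tensor_map S T F)"
  proof
    fix z :: "'a \<times> 'b" obtain a b where z: "z = (a, b)" by force
    have "T (\<lambda>y. k * F (x, y)) = cscale k (T (\<lambda>y. F (x, y)))" for x
      using cfun_pair.linear_scale[OF T, of k "\<lambda>y. F (x, y)"] by (simp add: cscale_def)
    then show "tensor_map S T (cscale k F) z = cscale k (tensor_map S T F) z"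
      using cfun_pair.linear_scale[OF S, of k "\<lambda>x. T (\<lambda>y. F (x, y)) b"]
      by (simp add: z tensor_map_def cscale_def)
  qed
qed

lemma tensor_map_tensor_vec:
  assumes S: "clinear S" and T: "clinear T"
  shows "tensor_map S T (tensor_vec f h) = tensor_vec (S f) (T h)"
proof -
  have "T (\<lambda>y. f x * h y) = (\<lambda>b. f x * T h b)" for x
    using cfun_pair.linear_scale[OF T, of "f x" h] by (simp add: cscale_def)
  moreover have "S (\<lambda>x. f x * T h b) = (\<lambda>a. T h b * S f a)" for b
    using cfun_pair.linear_scale[OF S, of "T h b" f] by (simp add: cscale_def mult.commute)
  ultimately show ?thesis
    by (auto simp: tensor_map_def tensor_vec_def fun_eq_iff)
qed

lemma tensor_map_image:
  assumes S: "clinear S" and T: "clinear T"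
  shows "tensor_map S T ` tensor_space V W = tensor_space (S ` V) (T ` W)"
proof -
  have "tensor_map S T ` {tensor_vec v w | v w. v \<in> V \<and> w \<in> W} =
      {tensor_vec v w | v w. v \<in> S ` V \<and> w \<in> T ` W}"
    using tensor_map_tensor_vec[OF S T] by (fastforce simp: image_def)
  then show ?thesis
    unfolding tensor_space_def using cfun_pair.linear_span_image[OF clinear_tensor_map[OF S T]] by metis
qed

lemma tensor_space_induct [consumes 3, case_names vec]:
  assumes "F \<in> tensor_space V W" "cfun.subspace V'" "clinear L"
    and "\<And>v w. v \<in> V \<Longrightarrow> w \<in> W \<Longrightarrow> L (tensor_vec v w) \<in> V'"
  shows "L F \<in> V'"
proof -
  have "cfun.subspace {F. L F \<in> V'}"
    using cfun_pair.linear_subspace_linear_preimage[OF assms(3,2)] by simp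
  then have "tensor_space V W \<subseteq> {F. L F \<in> V'}"
    unfolding tensor_space_def using assms(4) by (intro cfun.span_minimal) auto
  then show ?thesis using assms(1) by blast
qed

lemma tensor_space_slice_right:
  assumes "F \<in> tensor_space V W" "cfun.subspace W"
  shows "(\<lambda>y. F (x, y)) \<in> W"
proof (rule tensor_space_induct[OF assms])
  show "clinear (\<lambda>F y. F (x, y))" by (rule clinearI) (auto simp: cscale_def)
  show "(\<lambda>y. tensor_vec v w (x, y)) \<in> W" if "w \<in> W" for v w
    using cfun.subspace_scale[OF assms(2) that, of "v x"] by (simp add: tensor_vec_def cscale_def)
qed

lemma tensor_space_partial_left:
  fixes V :: "('x \<Rightarrow> complex) set"
  assumes "F \<in> tensor_space V W" "cfun.subspace V" and T: "clinear T"
  shows "(\<lambda>x. T (\<lambda>y. F (x, y)) b) \<in> V"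
proof (rule tensor_space_induct[OF assms(1,2)])
  have *: "(\<lambda>x. T (\<lambda>y. F (x, y)) b) = (\<lambda>x. tensor_map (\<lambda>f. f) T F (x, b))" for F
    by (simp add: tensor_map_def)
  have C: "clinear (tensor_map (\<lambda>f :: 'x \<Rightarrow> complex. f) T)"
    by (rule clinear_tensor_map[OF cfun.linear_ident T])
  show "clinear (\<lambda>F (x :: 'x). T (\<lambda>y. F (x, y)) b)"
    unfolding *
    by (intro clinearI ext) (simp_all add: cfun_pair.linear_add[OF C] cfun_pair.linear_scale[OF C] cscale_apply)
  show "(\<lambda>x. T (\<lambda>y. tensor_vec v w (x, y)) b) \<in> V" if "v \<in> V" for v w
    unfolding * tensor_map_tensor_vec[OF cfun.linear_ident T]
    using cfun.subspace_scale[OF assms(2) that, of "T w b"]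
    by (simp add: tensor_vec_def cscale_def mult.commute)
qed

lemma tensor_space_slice_left:
  assumes "F \<in> tensor_space V W" "cfun.subspace V"
  shows "(\<lambda>x. F (x, y)) \<in> V"
  using tensor_space_partial_left[OF assms cfun.linear_ident] .

text \<open>The factors are undone one at a time. For fixed \<open>b\<close>, applying
  \<open>T\<close> in the second variable leaves a vector of \<open>V\<close> by
  \<open>tensor_space_partial_left\<close>, and \<open>S\<close> kills it only if it is 0; then
  \<open>T\<close> is injective on every slice.\<close>

lemma inj_on_tensor_map:
  assumes S: "clinear S" "cfun.subspace V" "inj_on S V" and T: "clinear T" "cfun.subspace W" "inj_on T W"
  shows "inj_on (tensor_map S T) (tensor_space V W)"
proof -
  have "F = 0" if F: "F \<in> tensor_space V W" "tensor_map S T F = 0" for F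
  proof -
    have "S (\<lambda>x. T (\<lambda>y. F (x, y)) b) = 0" for b
      using F(2) by (auto simp: tensor_map_def fun_eq_iff)
    then have "(\<lambda>x. T (\<lambda>y. F (x, y)) b) = 0" for b
      using tensor_space_partial_left[OF F(1) S(2) T(1)] S(3) clinear_inj_on_iff[OF S(1,2)] by metis
    then have "T (\<lambda>y. F (x, y)) = 0" for x by (auto simp: fun_eq_iff)
    then have "(\<lambda>y. F (x, y)) = 0" for x
      using tensor_space_slice_right[OF F(1) T(2)] T(3) clinear_inj_on_iff[OF T(1,2)] by metis
    then show ?thesis by (auto simp: fun_eq_iff)
  qed
  then show ?thesis
    unfolding tensor_space_def
    by (subst clinear_inj_on_iff[OF clinear_tensor_map[OF S(1) T(1)] cfun.subspace_span])
       (simp flip: tensor_space_def)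
qed

text \<open>The slices in the first variable are fixed by a projection \<open>P\<close> onto
  \<open>V\<close>. Applying \<open>P\<close> to their expansion in delta functions on
  \<open>X\<close> writes \<open>F\<close> as a finite sum of pure tensors, with the projected delta
  functions on the left and slices of \<open>F\<close> on the right.\<close>

lemma tensor_spaceI:
  fixes X :: "'x set"
  assumes V: "cfun.subspace V" and X: "finite X" "\<And>v x. v \<in> V \<Longrightarrow> x \<notin> X \<Longrightarrow> v x = 0"
    and slices: "\<And>y. (\<lambda>x. F (x, y)) \<in> V" "\<And>x. (\<lambda>y. F (x, y)) \<in> W"
  shows "F \<in> tensor_space V W"
proof -
  obtain P where P: "clinear P" "range P \<subseteq> V" "\<And>v. v \<in> V \<Longrightarrow> P v = v"
    using clinear_projection[OF V] by blast
  let ?e = "\<lambda>x' x. if x = (x' :: 'x) then 1 else 0 :: complex"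
  have "F = (\<Sum>x'\<in>X. tensor_vec (P (?e x')) (\<lambda>y. F (x', y)))"
  proof
    fix z :: "'x \<times> 'a" obtain x y where z: "z = (x, y)" by force
    have "(\<lambda>x. F (x, y)) = (\<Sum>x'\<in>X. cscale (F (x', y)) (?e x'))"
    proof
      fix x
      have "(\<Sum>x'\<in>X. cscale (F (x', y)) (?e x')) x = (\<Sum>x'\<in>X. if x = x' then F (x', y) else 0)"
        unfolding sum_fun_apply by (intro sum.cong) (auto simp: cscale_apply)
      also have "\<dots> = F (x, y)" using X(1) X(2)[OF slices(1), of x y] by (simp add: sum.delta')
      finally show "F (x, y) = (\<Sum>x'\<in>X. cscale (F (x', y)) (?e x')) x" by simp
    qed
    then have "P (\<lambda>x. F (x, y)) = (\<Sum>x'\<in>X. cscale (F (x', y)) (P (?e x')))"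
      by (simp add: cfun_pair.linear_sum[OF P(1)] cfun_pair.linear_scale[OF P(1)])
    then have "F (x, y) = (\<Sum>x'\<in>X. cscale (F (x', y)) (P (?e x'))) x"
      using P(3)[OF slices(1), of y] by metis
    then show "F z = (\<Sum>x'\<in>X. tensor_vec (P (?e x')) (\<lambda>y. F (x', y))) z"
      by (simp add: z sum_fun_apply cscale_apply tensor_vec_def mult.commute)
  qed
  also have "\<dots> \<in> tensor_space V W"
    unfolding tensor_space_def using P(2) slices(2)
    by (intro cfun.span_sum cfun.span_base) blast
  finally show ?thesis .
qed

lemma symgroup_action_diagonal: "symgroup_action d diagonal_action"
proof (rule symgroup_action.intro)
  show "clinear (diagonal_action g)" if "g \<in> symgroup d" for g
    by (rule clinearI) (auto simp: diagonal_action_def cscale_def)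
  show "diagonal_action id v = v" for v
    by (simp add: diagonal_action_def)
  show "diagonal_action (g \<circ> h) v = diagonal_action g (diagonal_action h v)"
    if "g \<in> symgroup d" "h \<in> symgroup d" for g h v
    using that by (auto simp: diagonal_action_def symgroup_inv_comp o_assoc)
qed

interpretation diagonal: symgroup_action d diagonal_action for d
  by (rule symgroup_action_diagonal)

lemma subrep_tensor_space:
  assumes "subrep (symgroup d) left_action V" "subrep (symgroup d) left_action W"
  shows "subrep (symgroup d) diagonal_action (tensor_space V W)"
  unfolding subrep_def
proof (intro conjI ballI)
  show sub: "cfun.subspace (tensor_space V W)" by (simp add: tensor_space_def)
  fix g F assume g: "g \<in> symgroup d" and F: "F \<in> tensor_space V W"
  show "diagonal_action g F \<in> tensor_space V W"
  proof (rule tensor_space_induct[OF F sub diagonal.linear[OF g]])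
    fix v w assume "v \<in> V" "w \<in> W"
    then have "left_action g v \<in> V" "left_action g w \<in> W" using assms g by (auto simp: subrep_def)
    then show "diagonal_action g (tensor_vec v w) \<in> tensor_space V W"
      unfolding diagonal_action_tensor_vec tensor_space_def by (intro cfun.span_base) blast
  qed
qed

section \<open>Tensors as functions on words\<close>

text \<open>Extensional functions, so that a finite set of positions and a finite alphabet give
  finitely many words.\<close>

definition words :: "'p set \<Rightarrow> ('p \<Rightarrow> 'l) set"
  where "words S = PiE S (\<lambda>_. UNIV)"

lemma finite_words [simp]: "finite S \<Longrightarrow> finite (words S :: ('p \<Rightarrow> 'l :: finite) set)"
  by (simp add: words_def finite_PiE)

lemma words_upd [simp]: "x \<in> S \<Longrightarrow> w(x := a) \<in> words S \<longleftrightarrow> w \<in> words S"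
  by (auto simp: words_def PiE_iff extensional_def)

lemma restrict_in_words [simp]: "restrict f S \<in> words S"
  by (simp add: words_def)

lemma words_eqI: "w \<in> words S \<Longrightarrow> w' \<in> words S \<Longrightarrow> (\<And>x. x \<in> S \<Longrightarrow> w x = w' x) \<Longrightarrow> w = w'"
  unfolding words_def by (rule PiE_ext)

lemma words_comp:
  assumes "p permutes S"
  shows "w \<circ> p \<in> words S \<longleftrightarrow> w \<in> words S"
proof -
  have "p x \<in> S \<longleftrightarrow> x \<in> S" and "x \<notin> S \<Longrightarrow> p x = x" for x
    using assms by (auto simp: permutes_in_image permutes_not_in)
  then show ?thesis
    unfolding words_def PiE_iff extensional_def by auto
qed

text \<open>Permutations act on words from the right by composition, so the action on functions of
  words is a left action without an inverse.\<close>

definition word_action :: "(nat \<Rightarrow> nat) \<Rightarrow> ((nat \<Rightarrow> 'l) \<Rightarrow> complex) \<Rightarrow> (nat \<Rightarrow> 'l) \<Rightarrow> complex"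
  where "word_action g F = (\<lambda>w. F (w \<circ> g))"

lemma symgroup_action_word: "symgroup_action d word_action"
proof (rule symgroup_action.intro)
  show "clinear (word_action g)" if "g \<in> symgroup d" for g
    by (rule clinearI) (auto simp: word_action_def cscale_def)
  show "word_action id v = v" for v :: "(nat \<Rightarrow> 'l) \<Rightarrow> complex"
    by (simp add: word_action_def)
  show "word_action (g \<circ> h) v = word_action g (word_action h v)"
    if "g \<in> symgroup d" "h \<in> symgroup d" for g h and v :: "(nat \<Rightarrow> 'l) \<Rightarrow> complex"
    by (simp add: word_action_def o_assoc)
qed

interpretation word: symgroup_action d word_action for d
  by (rule symgroup_action_word)

text \<open>A matrix on the alphabet acts as a derivation on the tensor power indexed by \<open>S\<close>.\<close>

definition derivation :: "'p set \<Rightarrow> ('l \<Rightarrow> 'l \<Rightarrow> complex) \<Rightarrow> (('p \<Rightarrow> 'l :: finite) \<Rightarrow> complex) \<Rightarrow> ('p \<Rightarrow> 'l) \<Rightarrow> complex"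
  where "derivation S m F = (\<lambda>w. if w \<in> words S then \<Sum>x\<in>S. \<Sum>a\<in>UNIV. m (w x) a * F (w(x := a)) else 0)"

text \<open>A subset pair \<open>(A, B)\<close> is encoded by the word with letters \<open>(x \<in> A, x \<in> B)\<close>; the matrices \<open>e1\<close> and
  \<open>e2\<close> delete an element of \<open>A\<close> and of \<open>B\<close>.\<close>

type_synonym letter = "bool \<times> bool"

definition e1 :: "letter \<Rightarrow> letter \<Rightarrow> complex"
  where "e1 a b = (if \<not> fst a \<and> fst b \<and> snd a = snd b then 1 else 0)"

definition e2 :: "letter \<Rightarrow> letter \<Rightarrow> complex"
  where "e2 a b = (if \<not> snd a \<and> snd b \<and> fst a = fst b then 1 else 0)"

definition fsts :: "'p set \<Rightarrow> ('p \<Rightarrow> letter) \<Rightarrow> 'p set"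
  where "fsts S w = {x \<in> S. fst (w x)}"

definition snds :: "'p set \<Rightarrow> ('p \<Rightarrow> letter) \<Rightarrow> 'p set"
  where "snds S w = {x \<in> S. snd (w x)}"

definition weight_space :: "'p set \<Rightarrow> nat \<Rightarrow> nat \<Rightarrow> (('p \<Rightarrow> letter) \<Rightarrow> complex) set"
  where "weight_space S i l = {F. \<forall>w. F w \<noteq> 0 \<longrightarrow> w \<in> words S \<and> card (fsts S w) = i \<and> card (snds S w) = l}"

definition highest_weight_space :: "'p set \<Rightarrow> nat \<Rightarrow> nat \<Rightarrow> (('p \<Rightarrow> letter) \<Rightarrow> complex) set"
  where "highest_weight_space S i l = {F \<in> weight_space S i l. derivation S e1 F = 0 \<and> derivation S e2 F = 0}"

definition pair_word :: "'p set \<Rightarrow> 'p set \<Rightarrow> 'p set \<Rightarrow> 'p \<Rightarrow> letter"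
  where "pair_word S A B = restrict (\<lambda>x. (x \<in> A, x \<in> B)) S"

lemma fsts_pair_word [simp]: "A \<subseteq> S \<Longrightarrow> fsts S (pair_word S A B) = A"
  and snds_pair_word [simp]: "B \<subseteq> S \<Longrightarrow> snds S (pair_word S A B) = B"
  by (auto simp: fsts_def snds_def pair_word_def)

lemma pair_word_in_words [simp]: "pair_word S A B \<in> words S"
  by (simp add: pair_word_def)

lemma pair_word_fsts_snds: "w \<in> words S \<Longrightarrow> pair_word S (fsts S w) (snds S w) = w"
  by (rule words_eqI) (auto simp: pair_word_def fsts_def snds_def)

lemma sum_letter: "(\<Sum>a\<in>UNIV. f (a :: letter)) = f (False, False) + f (False, True) + f (True, False) + f (True, True)"
  by (simp add: UNIV_Times_UNIV[symmetric] UNIV_bool add_ac del: UNIV_Times_UNIV flip: sum.cartesian_product)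

lemma derivation_e1:
  assumes "finite S" "A \<subseteq> S"
  shows "derivation S e1 F (pair_word S A B) = (\<Sum>x\<in>S - A. F (pair_word S (insert x A) B))"
proof -
  have "derivation S e1 F (pair_word S A B) =
      (\<Sum>x\<in>S. if x \<in> S - A then F (pair_word S (insert x A) B) else 0)"
    unfolding derivation_def if_P[OF pair_word_in_words]
  proof (intro sum.cong refl)
    fix x assume "x \<in> S"
    then have "(pair_word S A B)(x := (True, x \<in> B)) = pair_word S (insert x A) B"
      by (auto simp: pair_word_def)
    then show "(\<Sum>a\<in>UNIV. e1 (pair_word S A B x) a * F ((pair_word S A B)(x := a))) =
        (if x \<in> S - A then F (pair_word S (insert x A) B) else 0)"
      using \<open>x \<in> S\<close> by (cases "x \<in> B") (auto simp: sum_letter e1_def pair_word_def)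
  qed
  also have "\<dots> = (\<Sum>x\<in>S - A. F (pair_word S (insert x A) B))"
    using assms by (intro sum.mono_neutral_cong_right) auto
  finally show ?thesis .
qed

lemma derivation_e2:
  assumes "finite S" "B \<subseteq> S"
  shows "derivation S e2 F (pair_word S A B) = (\<Sum>x\<in>S - B. F (pair_word S A (insert x B)))"
proof -
  have "derivation S e2 F (pair_word S A B) =
      (\<Sum>x\<in>S. if x \<in> S - B then F (pair_word S A (insert x B)) else 0)"
    unfolding derivation_def if_P[OF pair_word_in_words]
  proof (intro sum.cong refl)
    fix x assume "x \<in> S"
    then have "(pair_word S A B)(x := (x \<in> A, True)) = pair_word S A (insert x B)"
      by (auto simp: pair_word_def)
    then show "(\<Sum>a\<in>UNIV. e2 (pair_word S A B x) a * F ((pair_word S A B)(x := a))) =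
        (if x \<in> S - B then F (pair_word S A (insert x B)) else 0)"
      using \<open>x \<in> S\<close> by (cases "x \<in> A") (auto simp: sum_letter e2_def pair_word_def)
  qed
  also have "\<dots> = (\<Sum>x\<in>S - B. F (pair_word S A (insert x B)))"
    using assms by (intro sum.mono_neutral_cong_right) auto
  finally show ?thesis .
qed

section \<open>From pairs of subsets to words\<close>

definition to_words :: "nat \<Rightarrow> (nat set \<times> nat set \<Rightarrow> complex) \<Rightarrow> (nat \<Rightarrow> letter) \<Rightarrow> complex"
  where "to_words d F = (\<lambda>w. if w \<in> words {..<d} then F (fsts {..<d} w, snds {..<d} w) else 0)"

lemma clinear_to_words: "clinear (to_words d)"
  by (rule clinearI) (auto simp: to_words_def cscale_def)

lemma subspace_harmonic: "cfun.subspace (harmonic d i)"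
  by (rule subrep_subspace[OF subrep_harmonic])

lemma harmonic_supp: "\<phi> \<in> harmonic d i \<Longrightarrow> \<phi> A \<noteq> 0 \<Longrightarrow> A \<subseteq> {..<d} \<and> card A = i"
  by (simp add: harmonic_def)

lemma tensor_harmonic_supp:
  assumes F: "F \<in> tensor_space (harmonic d i) (harmonic d l)" and "F (A, B) \<noteq> 0"
  shows "A \<subseteq> {..<d} \<and> card A = i \<and> B \<subseteq> {..<d} \<and> card B = l"
  using harmonic_supp[OF tensor_space_slice_left[OF F subspace_harmonic, of B], of A]
    harmonic_supp[OF tensor_space_slice_right[OF F subspace_harmonic, of A], of B] assms(2) by blast

lemma inj_on_to_words: "inj_on (to_words d) (tensor_space (harmonic d i) (harmonic d l))"
proof -
  have "F = 0" if F: "F \<in> tensor_space (harmonic d i) (harmonic d l)" and 0: "to_words d F = 0" for F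
  proof
    fix z :: "nat set \<times> nat set" obtain A B where z: "z = (A, B)" by force
    show "F z = 0 z"
    proof (rule ccontr)
      assume "F z \<noteq> 0 z"
      then have nz: "F (A, B) \<noteq> 0" by (simp add: z)
      then have "to_words d F (pair_word {..<d} A B) = F (A, B)"
        using tensor_harmonic_supp[OF F nz] by (simp add: to_words_def)
      then show False using 0 nz by simp
    qed
  qed
  then show ?thesis
    by (subst clinear_inj_on_iff[OF clinear_to_words]) (auto simp: tensor_space_def)
qed

text \<open>For fixed \<open>B\<close> the condition of \<open>e1\<close> is the harmonic condition
  in \<open>A\<close>, and for fixed \<open>A\<close> that of \<open>e2\<close> is the one in
  \<open>B\<close>. So all slices are harmonic, and \<open>tensor_spaceI\<close> gives membership in
  the tensor product.\<close>

lemma to_words_image: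
  "to_words d ` tensor_space (harmonic d i) (harmonic d l) = highest_weight_space {..<d} i l"
proof (intro equalityI subsetI)
  fix H assume "H \<in> to_words d ` tensor_space (harmonic d i) (harmonic d l)"
  then obtain F where F: "F \<in> tensor_space (harmonic d i) (harmonic d l)" and H: "H = to_words d F" by blast
  have HF: "H (pair_word {..<d} A B) = F (A, B)" if "A \<subseteq> {..<d}" "B \<subseteq> {..<d}" for A B
    using that by (simp add: H to_words_def)
  have "H \<in> weight_space {..<d} i l"
    using tensor_harmonic_supp[OF F] by (auto simp: weight_space_def H to_words_def split: if_splits)
  moreover have "derivation {..<d} e1 H w = 0" "derivation {..<d} e2 H w = 0" for w
  proof -
    let ?A = "fsts {..<d} w" and ?B = "snds {..<d} w"
    have sub: "?A \<subseteq> {..<d}" "?B \<subseteq> {..<d}" by (auto simp: fsts_def snds_def)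
    have "derivation {..<d} e1 H (pair_word {..<d} ?A ?B) = (\<Sum>x\<in>{..<d} - ?A. F (insert x ?A, ?B))"
      unfolding derivation_e1[OF finite_lessThan sub(1)] using sub by (intro sum.cong HF) auto
    also have "\<dots> = 0"
      using tensor_space_slice_left[OF F subspace_harmonic, of ?B] sub by (simp add: harmonic_def)
    finally show "derivation {..<d} e1 H w = 0"
      by (cases "w \<in> words {..<d}") (simp_all add: pair_word_fsts_snds derivation_def)
    have "derivation {..<d} e2 H (pair_word {..<d} ?A ?B) = (\<Sum>x\<in>{..<d} - ?B. F (?A, insert x ?B))"
      unfolding derivation_e2[OF finite_lessThan sub(2)] using sub by (intro sum.cong HF) auto
    also have "\<dots> = 0"
      using tensor_space_slice_right[OF F subspace_harmonic, of ?A] sub by (simp add: harmonic_def)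
    finally show "derivation {..<d} e2 H w = 0"
      by (cases "w \<in> words {..<d}") (simp_all add: pair_word_fsts_snds derivation_def)
  qed
  ultimately show "H \<in> highest_weight_space {..<d} i l"
    by (auto simp: highest_weight_space_def fun_eq_iff)
next
  fix H assume H: "H \<in> highest_weight_space {..<d} i l"
  define F where "F = (\<lambda>(A, B). if A \<subseteq> {..<d} \<and> B \<subseteq> {..<d} then H (pair_word {..<d} A B) else 0)"
  have supp: "card A = i \<and> card B = l" if "A \<subseteq> {..<d}" "B \<subseteq> {..<d}" "H (pair_word {..<d} A B) \<noteq> 0" for A B
    using H that by (auto simp: highest_weight_space_def weight_space_def)
  have left: "(\<lambda>A. F (A, B)) \<in> harmonic d i" for B
  proof (cases "B \<subseteq> {..<d}")
    case True
    have "(\<Sum>x\<in>{..<d} - A. F (insert x A, B)) = 0" if "A \<subseteq> {..<d}" for A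
    proof -
      have "(\<Sum>x\<in>{..<d} - A. F (insert x A, B)) = derivation {..<d} e1 H (pair_word {..<d} A B)"
        unfolding derivation_e1[OF finite_lessThan that]
        using that True by (intro sum.cong) (auto simp: F_def)
      then show ?thesis using H by (simp add: highest_weight_space_def)
    qed
    then show ?thesis using supp True by (auto simp: harmonic_def F_def split: if_splits)
  next
    case False
    then have "(\<lambda>A. F (A, B)) = 0" by (auto simp: F_def)
    then show ?thesis using cfun.subspace_0[OF subspace_harmonic] by simp
  qed
  have right: "(\<lambda>B. F (A, B)) \<in> harmonic d l" for A
  proof (cases "A \<subseteq> {..<d}")
    case True
    have "(\<Sum>x\<in>{..<d} - B. F (A, insert x B)) = 0" if "B \<subseteq> {..<d}" for B
    proof -
      have "(\<Sum>x\<in>{..<d} - B. F (A, insert x B)) = derivation {..<d} e2 H (pair_word {..<d} A B)"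
        unfolding derivation_e2[OF finite_lessThan that]
        using that True by (intro sum.cong) (auto simp: F_def)
      then show ?thesis using H by (simp add: highest_weight_space_def)
    qed
    then show ?thesis using supp True by (auto simp: harmonic_def F_def split: if_splits)
  next
    case False
    then have "(\<lambda>B. F (A, B)) = 0" by (auto simp: F_def)
    then show ?thesis using cfun.subspace_0[OF subspace_harmonic] by simp
  qed
  have "F \<in> tensor_space (harmonic d i) (harmonic d l)"
    by (rule tensor_spaceI[OF subspace_harmonic _ _ left right, of "Pow {..<d}"])
       (use harmonic_supp in \<open>blast, blast\<close>)
  moreover have "H = to_words d F"
  proof
    fix w
    have "H w = 0" if "w \<notin> words {..<d}" using H that by (auto simp: highest_weight_space_def weight_space_def)
    then show "H w = to_words d F w"
      by (auto simp: to_words_def F_def pair_word_fsts_snds) (auto simp: fsts_def snds_def)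
  qed
  ultimately show "H \<in> to_words d ` tensor_space (harmonic d i) (harmonic d l)" by blast
qed

lemma to_words_equivariant:
  assumes g: "g \<in> symgroup d"
  shows "to_words d (\<lambda>(A, B). F (inv g ` A, inv g ` B)) = word_action g (to_words d F)"
proof
  fix w :: "nat \<Rightarrow> letter"
  have *: "inv g ` {x. x < d \<and> R (w x)} = {x. x < d \<and> R (w (g x))}" for R
  proof (intro equalityI subsetI)
    fix y assume "y \<in> {x. x < d \<and> R (w (g x))}"
    then have "y = inv g (g y)" "g y \<in> {x. x < d \<and> R (w x)}" using g by auto
    then show "y \<in> inv g ` {x. x < d \<and> R (w x)}" by blast
  qed (use g in auto)
  show "to_words d (\<lambda>(A, B). F (inv g ` A, inv g ` B)) w = word_action g (to_words d F) w"
    using words_comp[of g "{..<d}" w] g *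
    by (auto simp: to_words_def word_action_def symgroup_def fsts_def snds_def)
qed

text \<open>\<open>multiplicity_eq_dim\<close> gives the rank of the Young symmetrizer on the tensor
  product of the Specht modules. The map \<open>L\<close> in the proof is injective and equivariant
  with the highest weight tensors as image, so it carries this rank over.\<close>

theorem kronecker_eq_dim:
  assumes "partition_of \<gamma> d" "2 * i \<le> d" "2 * l \<le> d"
  shows "kronecker d (padded (row_partition i) d) (padded (row_partition l) d) \<gamma> =
    cfun.dim (act d word_action (young_symmetrizer d \<gamma>) ` highest_weight_space {..<d} i l)"
proof -
  interpret \<gamma>: partition_of \<gamma> d by fact
  interpret i: two_row d i by unfold_locales fact
  interpret l: two_row d l by unfold_locales fact
  let ?V = "specht d (padded (row_partition i) d)" and ?W = "specht d (padded (row_partition l) d)"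
  let ?c = "young_symmetrizer d \<gamma>"
  have V: "subrep (symgroup d) left_action ?V" and W: "subrep (symgroup d) left_action ?W"
    using i.subrep_ideal l.subrep_ideal by (simp_all add: i.ideal_eq_specht l.ideal_eq_specht)
  have TS: "subrep (symgroup d) diagonal_action (tensor_space ?V ?W)"
    by (rule subrep_tensor_space[OF V W])
  have "finite_dim (tensor_space ?V ?W)"
  proof (rule finite_dim_subset[OF _ finite_dim_finite_support])
    show "finite (symgroup d \<times> symgroup d)" by simp
    have "F z = 0" if F: "F \<in> tensor_space ?V ?W" and z: "z \<notin> symgroup d \<times> symgroup d" for F z
    proof -
      obtain x y where xy: "z = (x, y)" by force
      have "(\<lambda>x. F (x, y)) \<in> group_algebra d" "(\<lambda>y. F (x, y)) \<in> group_algebra d"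
        using tensor_space_slice_left[OF F subrep_subspace[OF V]] i.ideal_alg
          tensor_space_slice_right[OF F subrep_subspace[OF W]] l.ideal_alg
        by (simp_all add: i.ideal_eq_specht l.ideal_eq_specht)
      then show ?thesis using z by (auto simp: xy group_algebra_def)
    qed
    then show "tensor_space ?V ?W \<subseteq> {f. \<forall>x. x \<notin> symgroup d \<times> symgroup d \<longrightarrow> f x = 0}" by blast
  qed
  then have "kronecker d (padded (row_partition i) d) (padded (row_partition l) d) \<gamma> =
      cfun.dim (act d diagonal_action ?c ` tensor_space ?V ?W)"
    unfolding kronecker_def \<gamma>.ideal_eq_specht[symmetric]
    by (rule \<gamma>.multiplicity_eq_dim[OF symgroup_action_diagonal TS])
  also have "\<dots> = cfun.dim (act d word_action ?c ` highest_weight_space {..<d} i l)"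
  proof -
    let ?T = "tensor_map i.specht_map l.specht_map" and ?K = "tensor_space (harmonic d i) (harmonic d l)"
    define L where "L = (\<lambda>F. to_words d (?T F))"
    have T: "clinear ?T" by (rule clinear_tensor_map[OF i.clinear_specht_map l.clinear_specht_map])
    have Tim: "?T ` tensor_space ?V ?W = ?K"
      using tensor_map_image[OF i.clinear_specht_map l.clinear_specht_map, of ?V ?W]
        i.bij_betw_specht_map l.bij_betw_specht_map by (simp add: bij_betw_def)
    have L: "clinear L" unfolding L_def by (rule clinear_compose[OF clinear_to_words T])
    have Linj: "inj_on L (tensor_space ?V ?W)"
    proof -
      have "inj_on ?T (tensor_space ?V ?W)"
        using i.bij_betw_specht_map l.bij_betw_specht_map
        by (intro inj_on_tensor_map i.clinear_specht_map l.clinear_specht_map subrep_subspace[OF V] subrep_subspace[OF W])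
           (auto simp: bij_betw_def)
      then show ?thesis
        using comp_inj_on[of ?T "tensor_space ?V ?W" "to_words d"] inj_on_to_words Tim
        by (simp add: L_def comp_def)
    qed
    have Lim: "L ` tensor_space ?V ?W = highest_weight_space {..<d} i l"
      unfolding to_words_image[symmetric] Tim[symmetric] L_def by (simp add: image_image)
    have Leq: "L (diagonal_action g F) = word_action g (L F)" if g: "g \<in> symgroup d" for g F
    proof -
      have "?T (diagonal_action g F) (A, B) = ?T F (inv g ` A, inv g ` B)" for A B
      proof -
        have "l.specht_map (\<lambda>y. diagonal_action g F (x, y)) B = l.specht_map (\<lambda>y. F (inv g \<circ> x, y)) (inv g ` B)" for x
          using fun_cong[OF l.specht_map_left_action[OF g, of "\<lambda>y. F (inv g \<circ> x, y)"], of B]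
          by (simp add: left_action_def set_action_def diagonal_action_def)
        then show ?thesis
          using fun_cong[OF i.specht_map_left_action[OF g, of "\<lambda>x. l.specht_map (\<lambda>y. F (x, y)) (inv g ` B)"], of A]
          by (simp add: left_action_def set_action_def tensor_map_def)
      qed
      then have "?T (diagonal_action g F) = (\<lambda>(A, B). ?T F (inv g ` A, inv g ` B))" by auto
      then show ?thesis unfolding L_def using to_words_equivariant[OF g] by metis
    qed
    have "act d word_action ?c ` highest_weight_space {..<d} i l = L ` act d diagonal_action ?c ` tensor_space ?V ?W"
      unfolding Lim[symmetric] image_image using act_equivariant[OF L] Leq by metis
    moreover have "act d diagonal_action ?c ` tensor_space ?V ?W \<subseteq> tensor_space ?V ?W"
      using act_mem_subrep[OF TS] by blast
    moreover have "cfun.subspace (act d diagonal_action ?c ` tensor_space ?V ?W)"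
      using cfun_pair.linear_subspace_image[OF diagonal.clinear_act] TS by (simp add: subrep_subspace)
    ultimately show ?thesis
      using dim_inj_image[OF L] Linj inj_on_subset by metis
  qed
  finally show ?thesis .
qed

section \<open>Tensors as multilinear functions, and one-parameter groups\<close>

definition tensor_eval :: "'p set \<Rightarrow> (('p \<Rightarrow> 'l) \<Rightarrow> complex) \<Rightarrow> ('p \<Rightarrow> 'l \<Rightarrow> complex) \<Rightarrow> complex"
  where "tensor_eval S F Y = (\<Sum>w\<in>words S. F w * (\<Prod>x\<in>S. Y x (w x)))"

definition row_mult :: "('l :: finite \<Rightarrow> complex) \<Rightarrow> ('l \<Rightarrow> 'l \<Rightarrow> complex) \<Rightarrow> 'l \<Rightarrow> complex"
  where "row_mult y m = (\<lambda>a. \<Sum>b\<in>UNIV. y b * m b a)"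

lemma tensor_eval_add: "tensor_eval S (F + G) Y = tensor_eval S F Y + tensor_eval S G Y"
  by (simp add: tensor_eval_def sum.distrib algebra_simps)

lemma tensor_eval_cscale: "tensor_eval S (cscale k F) Y = k * tensor_eval S F Y"
  by (simp add: tensor_eval_def cscale_apply sum_distrib_left algebra_simps)

lemma tensor_eval_0 [simp]: "tensor_eval S 0 Y = 0"
  by (simp add: tensor_eval_def)

lemma tensor_eval_sum: "tensor_eval S (\<Sum>i\<in>I. f i) Y = (\<Sum>i\<in>I. tensor_eval S (f i) Y)"
  unfolding tensor_eval_def sum_fun_apply sum_distrib_right by (rule sum.swap)

lemma tensor_eval_cong:
  "(\<And>x. x \<in> S \<Longrightarrow> Y x = Y' x) \<Longrightarrow> tensor_eval S F Y = tensor_eval S F Y'"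
  by (simp add: tensor_eval_def)

text \<open>Exchanging the letter at \<open>x\<close> with the summation letter is an involution on
  pairs. It transposes a matrix from the tensor to its arguments.\<close>

lemma sum_words_swap_letter:
  assumes "finite S" "x \<in> S"
  shows "(\<Sum>w\<in>words S. \<Sum>a\<in>(UNIV :: 'l :: finite set). h w a (w(x := a)) (w x)) =
    (\<Sum>w\<in>words S. \<Sum>b\<in>UNIV. h (w(x := b)) (w x) w b)"
  unfolding sum.cartesian_product
  by (rule sum.reindex_bij_witness[where i = "\<lambda>(w, b). (w(x := b), w x)" and j = "\<lambda>(w, a). (w(x := a), w x)"])
     (use assms in auto)

lemma tensor_eval_derivation:
  assumes S: "finite S"
  shows "tensor_eval S (derivation S m F) Y = (\<Sum>x\<in>S. tensor_eval S F (Y(x := row_mult (Y x) m)))"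
proof -
  have "tensor_eval S (derivation S m F) Y =
      (\<Sum>x\<in>S. \<Sum>w\<in>words S. \<Sum>a\<in>UNIV. m (w x) a * F (w(x := a)) * (\<Prod>y\<in>S. Y y (w y)))"
    unfolding tensor_eval_def derivation_def
    by (subst sum.swap) (simp add: sum_distrib_right cong: sum.cong)
  also have "\<dots> = (\<Sum>x\<in>S. tensor_eval S F (Y(x := row_mult (Y x) m)))"
  proof (rule sum.cong[OF refl])
    fix x assume x: "x \<in> S"
    have *: "(\<Prod>y\<in>S. Y y (w y)) = Y x (w x) * (\<Prod>y\<in>S - {x}. Y y ((w(x := a)) y))" for w a
      unfolding prod.remove[OF S x] by (intro arg_cong2[where f = "(*)"] refl prod.cong) auto
    have "(\<Sum>w\<in>words S. \<Sum>a\<in>UNIV. m (w x) a * F (w(x := a)) * (\<Prod>y\<in>S. Y y (w y))) =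
        (\<Sum>w\<in>words S. \<Sum>a\<in>UNIV. m (w x) a * F (w(x := a)) * (Y x (w x) * (\<Prod>y\<in>S - {x}. Y y ((w(x := a)) y))))"
      using * by (intro sum.cong refl arg_cong2[where f = "(*)"])
    also have "\<dots> = (\<Sum>w\<in>words S. \<Sum>b\<in>UNIV. m b (w x) * F w * (Y x b * (\<Prod>y\<in>S - {x}. Y y (w y))))"
      by (rule sum_words_swap_letter[OF S x, where h = "\<lambda>w a w' b. m b a * F w' * (Y x b * (\<Prod>y\<in>S - {x}. Y y (w' y)))"])
    also have "\<dots> = tensor_eval S F (Y(x := row_mult (Y x) m))"
      unfolding tensor_eval_def
    proof (rule sum.cong[OF refl])
      fix w
      have "(\<Prod>y\<in>S. (Y(x := row_mult (Y x) m)) y (w y)) =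
          (\<Sum>b\<in>UNIV. Y x b * m b (w x)) * (\<Prod>y\<in>S - {x}. Y y (w y))"
      proof -
        have "(\<Prod>y\<in>S - {x}. (Y(x := y')) y (w y)) = (\<Prod>y\<in>S - {x}. Y y (w y))" for y'
          by (intro prod.cong) auto
        then show ?thesis unfolding prod.remove[OF S x] by (simp add: row_mult_def)
      qed
      then show "(\<Sum>b\<in>UNIV. m b (w x) * F w * (Y x b * (\<Prod>y\<in>S - {x}. Y y (w y)))) =
          F w * (\<Prod>y\<in>S. (Y(x := row_mult (Y x) m)) y (w y))"
        by (simp add: sum_distrib_left sum_distrib_right mult_ac)
    qed
    finally show "(\<Sum>w\<in>words S. \<Sum>a\<in>UNIV. m (w x) a * F (w(x := a)) * (\<Prod>y\<in>S. Y y (w y))) =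
        tensor_eval S F (Y(x := row_mult (Y x) m))" .
  qed
  finally show ?thesis .
qed

lemma row_mult_line:
  assumes "\<And>a c. (\<Sum>b\<in>UNIV. m a b * m b c) = 0"
  shows "row_mult (\<lambda>a. y a + t * row_mult y m a) m = row_mult y m"
proof
  fix c
  have "(\<Sum>b\<in>UNIV. row_mult y m b * m b c) = (\<Sum>a\<in>UNIV. y a * (\<Sum>b\<in>UNIV. m a b * m b c))"
    unfolding row_mult_def sum_distrib_left sum_distrib_right
    by (subst sum.swap) (simp add: mult_ac)
  then have "(\<Sum>b\<in>UNIV. row_mult y m b * m b c) = 0" using assms by simp
  then have "t * (\<Sum>b\<in>UNIV. row_mult y m b * m b c) = 0" by simp
  then show "row_mult (\<lambda>a. y a + t * row_mult y m a) m c = row_mult y m c"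
    unfolding sum_distrib_left by (subst (1 3) row_mult_def) (simp add: algebra_simps sum.distrib)
qed

text \<open>Since \<open>m\<close> squares to 0, \<open>1 + t m\<close> is the one-parameter group
  \<open>exp (t m)\<close>. Differentiating along it inserts \<open>m\<close> into one argument at a
  time, and by \<open>row_mult_line\<close> the inserted vector does not depend on
  \<open>t\<close>.\<close>

lemma tensor_eval_has_derivative:
  fixes t :: complex and Y :: "'p \<Rightarrow> 'l :: finite \<Rightarrow> complex"
  assumes S: "finite S" and m: "\<And>a c. (\<Sum>b\<in>UNIV. m a b * m b c) = 0"
  defines "Z \<equiv> \<lambda>t x a. Y x a + t * row_mult (Y x) m a"
  shows "((\<lambda>t. tensor_eval S F (Z t)) has_field_derivative tensor_eval S (derivation S m F) (Z t)) (at t)"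
proof -
  have "((\<lambda>t. \<Prod>x\<in>S. Z t x (w x)) has_field_derivative
      (\<Sum>x\<in>S. row_mult (Y x) m (w x) * (\<Prod>y\<in>S - {x}. Z t y (w y)))) (at t)" for w
    by (rule has_field_derivative_prod) (auto simp: Z_def intro!: derivative_eq_intros)
  then have "((\<lambda>t. tensor_eval S F (Z t)) has_field_derivative
      (\<Sum>w\<in>words S. F w * (\<Sum>x\<in>S. row_mult (Y x) m (w x) * (\<Prod>y\<in>S - {x}. Z t y (w y))))) (at t)"
    unfolding tensor_eval_def by (intro DERIV_sum DERIV_cmult)
  moreover have "(\<Sum>w\<in>words S. F w * (\<Sum>x\<in>S. row_mult (Y x) m (w x) * (\<Prod>y\<in>S - {x}. Z t y (w y)))) =
      tensor_eval S (derivation S m F) (Z t)"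
  proof -
    have "tensor_eval S F ((Z t)(x := row_mult (Z t x) m)) =
        (\<Sum>w\<in>words S. F w * (row_mult (Y x) m (w x) * (\<Prod>y\<in>S - {x}. Z t y (w y))))" if x: "x \<in> S" for x
    proof -
      have "row_mult (Z t x) m = row_mult (Y x) m"
        unfolding Z_def by (rule row_mult_line[OF m])
      moreover have "(\<Prod>y\<in>S - {x}. ((Z t)(x := y')) y (w y)) = (\<Prod>y\<in>S - {x}. Z t y (w y))" for y' w
        by (intro prod.cong) auto
      ultimately show ?thesis
        unfolding tensor_eval_def prod.remove[OF S x] by simp
    qed
    then show ?thesis
      unfolding tensor_eval_derivation[OF S] sum_distrib_left by (subst sum.swap) (simp cong: sum.cong)
  qed
  ultimately show ?thesis by simp
qed

lemma tensor_eval_invariant: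
  assumes S: "finite S" and m: "\<And>a c. (\<Sum>b\<in>UNIV. m a b * m b c) = 0" and F: "derivation S m F = 0"
  shows "tensor_eval S F (\<lambda>x a. Y x a + t * row_mult (Y x) m a) = tensor_eval S F Y"
proof -
  let ?f = "\<lambda>t. tensor_eval S F (\<lambda>x a. Y x a + t * row_mult (Y x) m a)"
  have "\<exists>c. \<forall>t\<in>UNIV. ?f t = c"
    using tensor_eval_has_derivative[OF S m, of F Y] F
    by (intro has_field_derivative_zero_constant) auto
  then obtain c where "\<And>t. ?f t = c" by auto
  then have "?f t = ?f 0" by metis
  then show ?thesis by simp
qed

lemma e1_square: "(\<Sum>b\<in>UNIV. e1 a b * e1 b c) = 0"
  and e2_square: "(\<Sum>b\<in>UNIV. e2 a b * e2 b c) = 0"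
  by (simp_all add: sum_letter e1_def e2_def)

lemma row_mult_e1: "row_mult y e1 (p, q) = (if p then y (False, q) else 0)"
  and row_mult_e2: "row_mult y e2 (p, q) = (if q then y (p, False) else 0)"
  by (cases p; cases q; simp add: row_mult_def sum_letter e1_def e2_def)+

section \<open>Polynomial functions\<close>

text \<open>Multiplying by \<open>z\<close> extends the vanishing from nonzero \<open>z\<close> to
  all \<open>z\<close>, at the price of shifting the coefficients by one.\<close>

lemma univariate_coeffs_0:
  fixes c :: "nat \<Rightarrow> complex"
  assumes "\<And>z. z \<noteq> 0 \<Longrightarrow> (\<Sum>k\<le>n. c k * z ^ k) = 0" "k \<le> n"
  shows "c k = 0"
proof -
  have "(\<Sum>j\<le>Suc n. (if j = 0 then 0 else c (j - 1)) * z ^ j) = 0" for z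
  proof -
    have "(\<Sum>j\<le>Suc n. (if j = 0 then 0 else c (j - 1)) * z ^ j) = z * (\<Sum>k\<le>n. c k * z ^ k)"
      by (subst sum.atMost_Suc_shift) (simp add: sum_distrib_left mult_ac)
    then show ?thesis using assms(1)[of z] by (cases "z = 0") auto
  qed
  then have "\<forall>j\<le>Suc n. (if j = 0 then 0 else c (j - 1)) = 0"
    using polyfun_eq_0[of "\<lambda>j. if j = 0 then 0 else c (j - 1)" "Suc n"] by blast
  from this[rule_format, of "Suc k"] assms(2) show ?thesis by simp
qed

text \<open>Vanishing is assumed only at points with nonzero coordinates, because the normalization
  to the slice divides by an entry. In the induction on the variables, exponents are grouped by
  their value at \<open>v\<close> and the groups are separated by
  \<open>univariate_coeffs_0\<close>.\<close>

lemma monomials_independent: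
  fixes c :: "('v \<Rightarrow> nat) \<Rightarrow> complex"
  assumes "finite V" "finite N" "\<And>n n'. n \<in> N \<Longrightarrow> n' \<in> N \<Longrightarrow> (\<And>v. v \<in> V \<Longrightarrow> n v = n' v) \<Longrightarrow> n = n'"
    and "\<And>X. (\<forall>v. X v \<noteq> 0) \<Longrightarrow> (\<Sum>n\<in>N. c n * (\<Prod>v\<in>V. X v ^ n v)) = 0" and "n \<in> N"
  shows "c n = 0"
  using assms
proof (induction V arbitrary: N n rule: finite_induct)
  case empty
  then have "N = {n}" by auto
  then show ?case using empty.prems(3)[of "\<lambda>_. 1"] by simp
next
  case (insert v V)
  define K where "K = Max ((\<lambda>n. n v) ` N)"
  define N' where "N' k = {n \<in> N. n v = k}" for k
  have le_K: "n v \<le> K" if "n \<in> N" for n using insert.prems(1) that by (auto simp: K_def)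
  have "(\<Sum>n\<in>N' k. c n * (\<Prod>u\<in>V. X u ^ n u)) = 0" if X: "\<forall>u. X u \<noteq> 0" and k: "k \<le> K" for X k
  proof (rule univariate_coeffs_0[where n = K and c = "\<lambda>k. \<Sum>n\<in>N' k. c n * (\<Prod>u\<in>V. X u ^ n u)", OF _ k])
    fix z :: complex assume z: "z \<noteq> 0"
    have "(\<Sum>k\<le>K. (\<Sum>n\<in>N' k. c n * (\<Prod>u\<in>V. X u ^ n u)) * z ^ k) =
        (\<Sum>k\<le>K. \<Sum>n\<in>{n \<in> N. n v = k}. c n * (z ^ n v * (\<Prod>u\<in>V. X u ^ n u)))"
      unfolding N'_def sum_distrib_right by (intro sum.cong) (auto simp: mult_ac)
    also have "\<dots> = (\<Sum>n\<in>N. c n * (z ^ n v * (\<Prod>u\<in>V. X u ^ n u)))"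
      using le_K insert.prems(1) by (intro sum.group) auto
    also have "\<dots> = (\<Sum>n\<in>N. c n * (\<Prod>u\<in>insert v V. (X(v := z)) u ^ n u))"
    proof (intro sum.cong refl)
      fix n
      have "(\<Prod>u\<in>V. (X(v := z)) u ^ n u) = (\<Prod>u\<in>V. X u ^ n u)"
        using insert.hyps by (intro prod.cong) auto
      then show "c n * (z ^ n v * (\<Prod>u\<in>V. X u ^ n u)) = c n * (\<Prod>u\<in>insert v V. (X(v := z)) u ^ n u)"
        using insert.hyps by simp
    qed
    also have "\<dots> = 0" using X z by (intro insert.prems(3)) auto
    finally show "(\<Sum>k\<le>K. (\<Sum>n\<in>N' k. c n * (\<Prod>u\<in>V. X u ^ n u)) * z ^ k) = 0" .
  qed
  note 0 = this
  show ?case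
  proof (rule insert.IH[of "N' (n v)"])
    show "finite (N' (n v))" using insert.prems(1) by (simp add: N'_def)
    show "n1 = n2" if "n1 \<in> N' (n v)" "n2 \<in> N' (n v)" "\<And>u. u \<in> V \<Longrightarrow> n1 u = n2 u" for n1 n2
      by (rule insert.prems(2)) (use that in \<open>auto simp: N'_def\<close>)
    show "n \<in> N' (n v)" using insert.prems(4) by (simp add: N'_def)
    show "(\<Sum>n\<in>N' (n v). c n * (\<Prod>u\<in>V. X u ^ n u)) = 0" if "\<forall>u. X u \<noteq> 0" for X
      by (rule 0[OF that le_K[OF insert.prems(4)]])
  qed
qed

lemma prod_group_by:
  assumes "finite S" "finite V" "f ` S \<subseteq> V"
  shows "(\<Prod>x\<in>S. g (f x)) = (\<Prod>v\<in>V. g v ^ card {x \<in> S. f x = v} :: complex)"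
proof -
  have "(\<Prod>v\<in>V. g v ^ card {x \<in> S. f x = v}) = (\<Prod>v\<in>V. \<Prod>x\<in>{x \<in> S. f x = v}. g (f x))"
    by (intro prod.cong) auto
  then show ?thesis using prod.group[OF assms, of "\<lambda>x. g (f x)"] by simp
qed

text \<open>The monomial of a word counts, row by row, the letters in the boxes. Words with equal
  counts differ by a row-preserving permutation, so \<open>F\<close> is constant on them, and the
  coefficient of the monomial is this constant times their number.\<close>

lemma row_symmetric_eval_0:
  fixes row :: "'p \<Rightarrow> 'r" and F :: "('p \<Rightarrow> 'l :: finite) \<Rightarrow> complex"
  assumes S: "finite S" and supp: "\<And>w. w \<notin> words S \<Longrightarrow> F w = 0"
    and sym: "\<And>p w. p permutes S \<Longrightarrow> (\<forall>x\<in>S. row (p x) = row x) \<Longrightarrow> F (w \<circ> p) = F w"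
    and eval: "\<And>X. (\<forall>r a. X r a \<noteq> 0) \<Longrightarrow> tensor_eval S F (\<lambda>x. X (row x)) = 0"
  shows "F = 0"
proof
  fix w0
  define V where "V = row ` S \<times> (UNIV :: 'l set)"
  define n where "n w v = card {x \<in> S. (row x, w x) = v}" for w :: "'p \<Rightarrow> 'l" and v
  define N where "N = n ` words S"
  define c where "c \<nu> = (\<Sum>w\<in>{w \<in> words S. n w = \<nu>}. F w)" for \<nu>
  show "F w0 = 0 w0"
  proof (cases "w0 \<in> words S")
    case w0: True
    have fin: "finite V" "finite N" using S by (simp_all add: V_def N_def)
    have outside: "n w v = 0" if "v \<notin> V" for w v
    proof -
      have "{x \<in> S. (row x, w x) = v} = {}" using that by (auto simp: V_def)
      then show ?thesis unfolding n_def by (simp only: card.empty)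
    qed
    have "c (n w0) = 0"
    proof (rule monomials_independent[OF fin])
      show "\<nu> = \<nu>'" if "\<nu> \<in> N" "\<nu>' \<in> N" "\<And>v. v \<in> V \<Longrightarrow> \<nu> v = \<nu>' v" for \<nu> \<nu>'
      proof
        fix v
        have "\<nu> \<in> range n" "\<nu>' \<in> range n" using that(1,2) by (auto simp: N_def)
        then obtain w w' where "\<nu> = n w" "\<nu>' = n w'" by blast
        then show "\<nu> v = \<nu>' v" using that(3)[of v] outside[of v] by metis
      qed
      show "n w0 \<in> N" using w0 by (simp add: N_def)
      fix X :: "'r \<times> 'l \<Rightarrow> complex" assume X: "\<forall>v. X v \<noteq> 0"
      have mon: "(\<Prod>x\<in>S. X (row x, w x)) = (\<Prod>v\<in>V. X v ^ n w v)" for w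
        unfolding n_def using S fin by (intro prod_group_by) (auto simp: V_def)
      have "0 = tensor_eval S F (\<lambda>x a. X (row x, a))"
        using eval[of "\<lambda>r a. X (r, a)"] X by simp
      also have "\<dots> = (\<Sum>\<nu>\<in>N. \<Sum>w\<in>{w \<in> words S. n w = \<nu>}. F w * (\<Prod>v\<in>V. X v ^ n w v))"
        unfolding tensor_eval_def mon N_def by (rule sum.image_gen) (use S in simp)
      also have "\<dots> = (\<Sum>\<nu>\<in>N. c \<nu> * (\<Prod>v\<in>V. X v ^ \<nu> v))"
        unfolding c_def sum_distrib_right by (intro sum.cong) auto
      finally show "(\<Sum>\<nu>\<in>N. c \<nu> * (\<Prod>v\<in>V. X v ^ \<nu> v)) = 0" by simp
    qed
    moreover have "F w = F w0" if w: "w \<in> words S" "n w = n w0" for w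
    proof -
      have "image_mset (\<lambda>x. (row x, w x)) (mset_set S) = image_mset (\<lambda>x. (row x, w0 x)) (mset_set S)"
      proof (rule multiset_eqI)
        fix v
        show "count (image_mset (\<lambda>x. (row x, w x)) (mset_set S)) v = count (image_mset (\<lambda>x. (row x, w0 x)) (mset_set S)) v"
          using fun_cong[OF w(2), of v] S
          by (simp add: n_def count_image_mset_eq_card_vimage)
      qed
      then obtain p where p: "p permutes S" "\<forall>x\<in>S. (row x, w x) = (row (p x), w0 (p x))"
        using image_mset_eq_implies_permutes[OF S] by blast
      have "w = w0 \<circ> p"
        using p w w0 by (intro words_eqI[of _ S]) (auto simp: words_comp)
      then show ?thesis using sym[OF p(1), of w0] p(2) by simp
    qed
    ultimately have "of_nat (card {w \<in> words S. n w = n w0}) * F w0 = 0"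
      by (simp add: c_def)
    moreover have "card {w \<in> words S. n w = n w0} \<noteq> 0"
      using S w0 by (subst card_0_eq) auto
    ultimately show ?thesis by simp
  qed (simp add: supp)
qed

section \<open>Restriction to the slice\<close>

text \<open>The unipotent group of \<open>e1\<close> and \<open>e2\<close> and the scaling of row 0 move every matrix with nonzero
  entries to one whose row 0 is \<open>1, 0, 0, z\<close>.\<close>

definition slice :: "(nat \<Rightarrow> letter \<Rightarrow> complex) \<Rightarrow> nat \<Rightarrow> letter \<Rightarrow> complex"
  where "slice X = (\<lambda>r a. if r = 0 then if a = (False, False) then 1 else if a = (True, True) then X 0 a else 0 else X r a)"

lemma slice_eq_self:
  "X 0 (False, False) = 1 \<Longrightarrow> X 0 (True, False) = 0 \<Longrightarrow> X 0 (False, True) = 0 \<Longrightarrow> slice X = X"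
  by (auto simp: slice_def fun_eq_iff)

text \<open>When the entry of row 0 at \<open>(False, False)\<close> is 1, a shift along
  \<open>e1\<close> by the negative of the entry at \<open>(True, False)\<close> clears the latter,
  and likewise for \<open>e2\<close> and \<open>(False, True)\<close>. By
  \<open>tensor_eval_invariant\<close> neither shift changes the value.\<close>

lemma highest_weight_slice_0:
  fixes row :: "'p \<Rightarrow> nat" and F :: "('p \<Rightarrow> letter) \<Rightarrow> complex"
  assumes S: "finite S" and F: "derivation S e1 F = 0" "derivation S e2 F = 0"
    and 0: "\<And>X. tensor_eval S F (\<lambda>x. slice X (row x)) = 0" and X: "X 0 (False, False) \<noteq> 0"
  shows "tensor_eval S F (\<lambda>x. X (row x)) = 0"
proof -
  have norm: "tensor_eval S F (\<lambda>x. X (row x)) = 0" if X: "X 0 (False, False) = 1" for X :: "nat \<Rightarrow> letter \<Rightarrow> complex"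
  proof -
    define X1 where "X1 r a = X r a + (- X 0 (True, False)) * row_mult (X r) e1 a" for r a
    define X2 where "X2 r a = X1 r a + (- X 0 (False, True)) * row_mult (X1 r) e2 a" for r a
    have "tensor_eval S F (\<lambda>x. X (row x)) = tensor_eval S F (\<lambda>x. X1 (row x))"
      using tensor_eval_invariant[OF S e1_square F(1), of "\<lambda>x. X (row x)" "- X 0 (True, False)"] by (simp add: X1_def[abs_def])
    also have "\<dots> = tensor_eval S F (\<lambda>x. X2 (row x))"
      using tensor_eval_invariant[OF S e2_square F(2), of "\<lambda>x. X1 (row x)" "- X 0 (False, True)"] by (simp add: X2_def[abs_def])
    also have "slice X2 = X2"
      by (rule slice_eq_self) (simp_all add: X2_def X1_def row_mult_e1 row_mult_e2 X)
    then have "tensor_eval S F (\<lambda>x. X2 (row x)) = 0" using 0[of X2] by simp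
    finally show ?thesis .
  qed
  \<comment> \<open>The general case: the value is linear in the vector at each box, so dividing row
    0 by \<open>k\<close> only splits off a power of \<open>k\<close>.\<close>
  define k where "k = X 0 (False, False)"
  define s where "s r = (if r = 0 then k else 1)" for r :: nat
  have "tensor_eval S F (\<lambda>x. X (row x)) =
      (\<Prod>x\<in>S. s (row x)) * tensor_eval S F (\<lambda>x a. X (row x) a / s (row x))"
    unfolding tensor_eval_def sum_distrib_left
  proof (rule sum.cong[OF refl])
    fix w
    have "(\<Prod>x\<in>S. X (row x) (w x)) = (\<Prod>x\<in>S. s (row x)) * (\<Prod>x\<in>S. X (row x) (w x) / s (row x))"
      unfolding prod.distrib[symmetric] using X by (intro prod.cong) (auto simp: s_def k_def)
    then show "F w * (\<Prod>x\<in>S. X (row x) (w x)) =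
        (\<Prod>x\<in>S. s (row x)) * (F w * (\<Prod>x\<in>S. X (row x) (w x) / s (row x)))"
      by (simp only: mult.left_commute)
  qed
  moreover have "tensor_eval S F (\<lambda>x a. X (row x) a / s (row x)) = 0"
    using norm[of "\<lambda>r a. X r a / s r"] X by (simp add: s_def k_def)
  ultimately show ?thesis by simp
qed

section \<open>The restriction map and the Young symmetrizer\<close>

definition col_perms :: "'p set \<Rightarrow> ('p \<Rightarrow> nat) \<Rightarrow> ('p \<Rightarrow> 'p) set"
  where "col_perms S cl = {q. q permutes S \<and> (\<forall>x\<in>S. cl (q x) = cl x)}"

text \<open>The product over all columns of the minors with the column's letters in the top rows.\<close>

definition minors :: "'p set \<Rightarrow> ('p \<Rightarrow> nat) \<Rightarrow> ('p \<Rightarrow> nat) \<Rightarrow> ('p \<Rightarrow> 'l) \<Rightarrow> (nat \<Rightarrow> 'l \<Rightarrow> complex) \<Rightarrow> complex"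
  where "minors S rw cl w X = (\<Sum>q\<in>col_perms S cl. of_int (sign q) * (\<Prod>x\<in>S. X (rw (q x)) (w x)))"

text \<open>Up to the factor \<open>card P\<close> this is the slice evaluation of the Young
  symmetrizer applied to \<open>F\<close>, by \<open>young_eval\<close>. It is defined for an
  arbitrary set of boxes, so that boxes can be added and removed.\<close>

definition theta :: "'p set \<Rightarrow> ('p \<Rightarrow> nat) \<Rightarrow> ('p \<Rightarrow> nat) \<Rightarrow> (('p \<Rightarrow> letter) \<Rightarrow> complex) \<Rightarrow> (nat \<Rightarrow> letter \<Rightarrow> complex) \<Rightarrow> complex"
  where "theta S rw cl F = (\<lambda>X. \<Sum>q\<in>col_perms S cl. of_int (sign q) * tensor_eval S F (\<lambda>x. slice X (rw (q x))))"

lemma clinear_theta: "clinear (theta S rw cl)"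
  by (rule clinearI)
     (auto simp: theta_def tensor_eval_add tensor_eval_cscale sum.distrib algebra_simps cscale_apply
       sum_distrib_left fun_eq_iff)

lemma theta_eq_minors: "theta S rw cl F X = (\<Sum>w\<in>words S. F w * minors S rw cl w (slice X))"
  unfolding theta_def tensor_eval_def minors_def sum_distrib_left
  by (subst sum.swap) (simp add: mult_ac)

lemma minors_cong: "(\<And>x. x \<in> S \<Longrightarrow> w x = w' x) \<Longrightarrow> minors S rw cl w X = minors S rw cl w' X"
  by (simp add: minors_def)

lemma tensor_eval_word_action:
  fixes F :: "(nat \<Rightarrow> 'l) \<Rightarrow> complex"
  assumes g: "g \<in> symgroup d"
  shows "tensor_eval {..<d} (word_action g F) Y = tensor_eval {..<d} F (\<lambda>x. Y (g x))"
  unfolding tensor_eval_def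
proof (rule sum.reindex_bij_witness[where i = "\<lambda>w. w \<circ> inv g" and j = "\<lambda>w. w \<circ> g"])
  have p: "g permutes {..<d}" "inv g permutes {..<d}" using g by (simp_all add: symgroup_def permutes_inv)
  show "w \<circ> g \<in> words {..<d}" if "w \<in> words {..<d}" for w :: "nat \<Rightarrow> 'l"
    using that words_comp[OF p(1)] by blast
  show "w \<circ> inv g \<in> words {..<d}" if "w \<in> words {..<d}" for w :: "nat \<Rightarrow> 'l"
    using that words_comp[OF p(2)] by blast
  fix w :: "nat \<Rightarrow> 'l"
  show "w \<circ> g \<circ> inv g = w" "w \<circ> inv g \<circ> g = w" using g by (simp_all add: o_assoc[symmetric])
  have "(\<Prod>x<d. Y (g x) (w (g x))) = (\<Prod>x<d. Y x (w x))"
    using prod.permute[OF p(1), of "\<lambda>x. Y x (w x)"] by (simp add: comp_def)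
  then show "F (w \<circ> g) * (\<Prod>x<d. Y (g x) ((w \<circ> g) x)) = word_action g F w * (\<Prod>x<d. Y x (w x))"
    by (simp add: word_action_def)
qed

lemma tensor_eval_act:
  "tensor_eval {..<d} (act d word_action f F) Y = (\<Sum>g\<in>symgroup d. f g * tensor_eval {..<d} F (\<lambda>x. Y (g x)))"
  unfolding act_def by (simp add: tensor_eval_sum tensor_eval_cscale tensor_eval_word_action)

lemma derivation_word_action:
  assumes g: "g \<in> symgroup d"
  shows "derivation {..<d} m (word_action g F) = word_action g (derivation {..<d} m F)"
proof
  fix w :: "nat \<Rightarrow> 'a"
  have p: "g permutes {..<d}" using g by (simp add: symgroup_def)
  have upd: "(w(g x := a)) \<circ> g = (w \<circ> g)(x := a)" for x a
    using symgroup_inv_o(3)[OF g] by (auto simp: fun_eq_iff) metis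
  have "(\<Sum>x<d. \<Sum>a\<in>UNIV. m (w x) a * F (w(x := a) \<circ> g)) =
      (\<Sum>x<d. \<Sum>a\<in>UNIV. m (w (g x)) a * F (w(g x := a) \<circ> g))"
    using sum.permute[OF p, of "\<lambda>x. \<Sum>a\<in>UNIV. m (w x) a * F (w(x := a) \<circ> g)"] by (simp add: comp_def)
  then show "derivation {..<d} m (word_action g F) w = word_action g (derivation {..<d} m F) w"
    using words_comp[OF p, of w] by (simp add: derivation_def word_action_def upd)
qed

lemma subspace_weight_space: "cfun.subspace (weight_space S i l)"
proof (rule cfun.subspaceI)
  show "0 \<in> weight_space S i l" by (simp add: weight_space_def)
  show "F + G \<in> weight_space S i l" if "F \<in> weight_space S i l" "G \<in> weight_space S i l" for F G
    unfolding weight_space_def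
  proof (intro CollectI allI impI)
    fix w assume "(F + G) w \<noteq> 0"
    then have "F w \<noteq> 0 \<or> G w \<noteq> 0" by auto
    then show "w \<in> words S \<and> card (fsts S w) = i \<and> card (snds S w) = l"
      using that unfolding weight_space_def by blast
  qed
  show "cscale k F \<in> weight_space S i l" if "F \<in> weight_space S i l" for k F
    using that by (auto simp: weight_space_def cscale_apply)
qed

lemma clinear_derivation: "clinear (derivation S m)"
  by (rule clinearI)
     (auto simp: derivation_def fun_eq_iff algebra_simps sum.distrib cscale_def sum_distrib_left)

lemma subrep_highest_weight_space: "subrep (symgroup d) word_action (highest_weight_space {..<d} i l)"
  unfolding subrep_def
proof (intro conjI ballI)
  have "highest_weight_space {..<d} i l = weight_space {..<d} i l \<inter> ({F. derivation {..<d} e1 F = 0} \<inter> {F. derivation {..<d} e2 F = 0})"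
    by (auto simp: highest_weight_space_def)
  then show "cfun.subspace (highest_weight_space {..<d} i l)"
    by (simp only:) (intro cfun.subspace_inter subspace_weight_space
      cfun_pair.linear_subspace_kernel[OF clinear_derivation])
  fix g and F :: "(nat \<Rightarrow> letter) \<Rightarrow> complex"
  assume g: "g \<in> symgroup d" and F: "F \<in> highest_weight_space {..<d} i l"
  have p: "g permutes {..<d}" using g by (simp add: symgroup_def)
  have card: "card (fsts {..<d} (w \<circ> g)) = card (fsts {..<d} w)" "card (snds {..<d} (w \<circ> g)) = card (snds {..<d} w)" for w
  proof -
    have "{x \<in> {..<d}. R (w x)} = g ` {x \<in> {..<d}. R ((w \<circ> g) x)}" for R
    proof (intro equalityI subsetI)
      fix x assume "x \<in> {x \<in> {..<d}. R (w x)}"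
      then have "x = g (inv g x)" "inv g x \<in> {x \<in> {..<d}. R ((w \<circ> g) x)}" using g by auto
      then show "x \<in> g ` {x \<in> {..<d}. R ((w \<circ> g) x)}" by blast
    qed (use g in auto)
    then have "fsts {..<d} w = g ` fsts {..<d} (w \<circ> g)" "snds {..<d} w = g ` snds {..<d} (w \<circ> g)"
      unfolding fsts_def snds_def by blast+
    then show "card (fsts {..<d} (w \<circ> g)) = card (fsts {..<d} w)" "card (snds {..<d} (w \<circ> g)) = card (snds {..<d} w)"
      using g by simp_all
  qed
  have "word_action g F \<in> weight_space {..<d} i l"
    using F words_comp[OF p] card by (auto simp: highest_weight_space_def weight_space_def word_action_def)
  moreover have "derivation {..<d} e1 (word_action g F) = 0" "derivation {..<d} e2 (word_action g F) = 0"
    using F word.zero[OF g] by (simp_all add: derivation_word_action[OF g] highest_weight_space_def)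
  ultimately show "word_action g F \<in> highest_weight_space {..<d} i l"
    by (simp add: highest_weight_space_def)
qed

context partition_of
begin

text \<open>Row permutations do not change arguments that depend only on the row, so the row sum
  contributes the factor \<open>card P\<close> and only the column sum remains.\<close>

lemma young_eval:
  "tensor_eval {..<d} (act d word_action c F) (\<lambda>x. slice X (row_of \<alpha> x)) =
    of_nat (card P) * theta {..<d} (row_of \<alpha>) (col_of \<alpha>) F X"
proof -
  have Q: "col_perms {..<d} (col_of \<alpha>) = Q"
    by (auto simp: col_perms_def preserving_def symgroup_def)
  let ?Y = "\<lambda>x. slice X (row_of \<alpha> x)" and ?bF = "act d word_action (col_sum d \<alpha>) F"
  have "tensor_eval {..<d} (act d word_action c F) ?Y =
      (\<Sum>g\<in>symgroup d. row_sum d \<alpha> g * tensor_eval {..<d} ?bF (\<lambda>x. ?Y (g x)))"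
    unfolding young_symmetrizer_def word.act_convolution by (rule tensor_eval_act)
  also have "\<dots> = (\<Sum>g\<in>symgroup d. if g \<in> P then tensor_eval {..<d} ?bF ?Y else 0)"
  proof (intro sum.cong refl)
    fix g
    have "tensor_eval {..<d} ?bF (\<lambda>x. ?Y (g x)) = tensor_eval {..<d} ?bF ?Y" if "g \<in> P"
      using that by (intro tensor_eval_cong) (simp add: preserving_def)
    then show "row_sum d \<alpha> g * tensor_eval {..<d} ?bF (\<lambda>x. ?Y (g x)) =
        (if g \<in> P then tensor_eval {..<d} ?bF ?Y else 0)"
      by (simp add: row_sum_eq)
  qed
  also have "\<dots> = (\<Sum>g\<in>P. tensor_eval {..<d} ?bF ?Y)"
    by (rule sum.mono_neutral_cong_right) (auto intro: preserving_symgroup)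
  also have "tensor_eval {..<d} ?bF ?Y = theta {..<d} (row_of \<alpha>) (col_of \<alpha>) F X"
    unfolding theta_def Q tensor_eval_act
    by (rule sum.mono_neutral_cong_right) (auto simp: col_sum_eq intro: preserving_symgroup)
  finally show ?thesis by simp
qed

lemma card_P: "card P \<noteq> 0"
  using id_preserving by (metis card_0_eq empty_iff finite_preserving)

text \<open>Evaluation on the slice loses nothing on the image of the symmetrizer: its elements are
  killed by \<open>e1\<close> and \<open>e2\<close>, so vanishing on the slice spreads to all
  matrices with nonzero entries, and they are symmetric in each row, so they are then 0.\<close>

lemma dim_act_eq_dim_theta:
  "cfun.dim (act d word_action c ` highest_weight_space {..<d} i l) =
    cfun.dim (theta {..<d} (row_of \<alpha>) (col_of \<alpha>) ` highest_weight_space {..<d} i l)"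
proof -
  let ?H = "highest_weight_space {..<d} i l" and ?T = "theta {..<d} (row_of \<alpha>) (col_of \<alpha>)"
  let ?k = "of_nat (card P) :: complex"
  define L where "L F = (\<lambda>X. tensor_eval {..<d} F (\<lambda>x. slice X (row_of \<alpha> x)))" for F
  have L: "clinear L"
    by (rule clinearI) (auto simp: L_def tensor_eval_add tensor_eval_cscale cscale_apply fun_eq_iff)
  have H: "cfun.subspace ?H" using subrep_highest_weight_space by (rule subrep_subspace)
  have AH: "act d word_action c ` ?H \<subseteq> ?H"
    using act_mem_subrep[OF subrep_highest_weight_space] by blast
  have subA: "cfun.subspace (act d word_action c ` ?H)"
    by (rule cfun_pair.linear_subspace_image[OF word.clinear_act H])
  have "inj_on L (act d word_action c ` ?H)"
    unfolding clinear_inj_on_iff[OF L subA]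
  proof (intro ballI impI)
    fix G assume G: "G \<in> act d word_action c ` ?H" "L G = 0"
    then have GH: "G \<in> ?H" using AH by blast
    show "G = 0"
    proof (rule row_symmetric_eval_0[of "{..<d}" _ "row_of \<alpha>"])
      show "G w = 0" if "w \<notin> words {..<d}" for w
        using GH that by (auto simp: highest_weight_space_def weight_space_def)
      show "G (w \<circ> p) = G w" if "p permutes {..<d}" "\<forall>x\<in>{..<d}. row_of \<alpha> (p x) = row_of \<alpha> x" for p w
      proof -
        have p: "p \<in> P" using that by (simp add: preserving_def symgroup_def)
        obtain F where F: "G = act d word_action c F" using G by blast
        have "word_action p G = G"
          unfolding F word.act_left_action[OF preserving_symgroup[OF p], symmetric] young_left[OF p] ..
        then show ?thesis by (metis word_action_def)
      qed
      show "tensor_eval {..<d} G (\<lambda>x. X (row_of \<alpha> x)) = 0" if "\<forall>r a. X r a \<noteq> 0" for X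
      proof (rule highest_weight_slice_0)
        show "tensor_eval {..<d} G (\<lambda>x. slice X (row_of \<alpha> x)) = 0" for X
          using fun_cong[OF G(2), of X] by (simp add: L_def)
      qed (use GH that in \<open>auto simp: highest_weight_space_def\<close>)
    qed simp
  qed
  then have "cfun.dim (act d word_action c ` ?H) = cfun.dim (L ` act d word_action c ` ?H)"
    by (rule dim_inj_image[OF L subA, symmetric])
  also have "L ` act d word_action c ` ?H = ?T ` ?H"
  proof -
    have LA: "L (act d word_action c F) = ?T (cscale ?k F)" for F
      unfolding cfun_pair.linear_scale[OF clinear_theta] by (simp add: L_def young_eval cscale_def)
    show ?thesis
    proof (intro equalityI subsetI)
      fix v assume "v \<in> L ` act d word_action c ` ?H"
      then show "v \<in> ?T ` ?H" using LA cfun.subspace_scale[OF H] by auto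
    next
      fix v assume "v \<in> ?T ` ?H"
      then obtain F where F: "F \<in> ?H" "v = ?T F" by blast
      have "F = cscale ?k (cscale (1 / ?k) F)" using card_P by simp
      then have "v = L (act d word_action c (cscale (1 / ?k) F))" using LA F(2) by metis
      then show "v \<in> L ` act d word_action c ` ?H" using cfun.subspace_scale[OF H F(1)] by blast
    qed
  qed
  finally show ?thesis .
qed

end

section \<open>Adding boxes to the first row\<close>

text \<open>\<open>Z\<close> consists of boxes of the first row, each alone in its column. The
  locale is used for several such sets in turn, so \<open>S\<close> may itself contain boxes of this
  kind.\<close>

locale tail =
  fixes S Z :: "'p set" and rw cl :: "'p \<Rightarrow> nat"
  assumes finS: "finite S" and finZ: "finite Z" and disj: "S \<inter> Z = {}"
    and row_tail: "z \<in> Z \<Longrightarrow> rw z = 0" and col_tail: "z \<in> Z \<Longrightarrow> x \<in> S \<Longrightarrow> cl x \<noteq> cl z"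
    and col_inj: "inj_on cl Z"
begin

lemma col_perms_tail: "col_perms (S \<union> Z) cl = col_perms S cl"
proof (intro equalityI subsetI)
  fix q assume q: "q \<in> col_perms (S \<union> Z) cl"
  then have perm: "q permutes S \<union> Z" and cl: "\<And>x. x \<in> S \<union> Z \<Longrightarrow> cl (q x) = cl x"
    by (auto simp: col_perms_def)
  have "q z = z" if z: "z \<in> Z" for z
  proof -
    have "q z \<in> S \<union> Z" using permutes_in_image[OF perm] z by blast
    moreover have "cl (q z) = cl z" using cl z by simp
    ultimately show ?thesis using col_tail[OF z] col_inj z by (auto dest: inj_onD)
  qed
  then have "q permutes S" by (intro permutes_superset[OF perm]) auto
  then show "q \<in> col_perms S cl" using cl by (simp add: col_perms_def)
next
  fix q assume "q \<in> col_perms S cl"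
  then have q: "q permutes S" "\<And>x. x \<in> S \<Longrightarrow> cl (q x) = cl x" by (auto simp: col_perms_def)
  have "q x = x" if "x \<in> Z" for x using permutes_not_in[OF q(1)] that disj by blast
  then show "q \<in> col_perms (S \<union> Z) cl"
    using q permutes_subset[OF q(1), of "S \<union> Z"] by (auto simp: col_perms_def)
qed

lemma minors_tail: "minors (S \<union> Z) rw cl w X = minors S rw cl w X * (\<Prod>z\<in>Z. X 0 (w z))"
  unfolding minors_def col_perms_tail sum_distrib_right
proof (rule sum.cong[OF refl])
  fix q assume "q \<in> col_perms S cl"
  then have "q permutes S" by (simp add: col_perms_def)
  then have "q z = z" if "z \<in> Z" for z
    using that disj permutes_not_in[of q S z] by blast
  then have "(\<Prod>z\<in>Z. X (rw (q z)) (w z)) = (\<Prod>z\<in>Z. X 0 (w z))"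
    using row_tail by (intro prod.cong) auto
  then show "of_int (sign q) * (\<Prod>x\<in>S \<union> Z. X (rw (q x)) (w x)) =
      of_int (sign q) * (\<Prod>x\<in>S. X (rw (q x)) (w x)) * (\<Prod>z\<in>Z. X 0 (w z))"
    by (simp add: prod.union_disjoint[OF finS finZ disj])
qed

end

lemma prod_slice_row_0:
  assumes "finite Z"
  shows "(\<Prod>z\<in>Z. slice X 0 (w z)) =
    (if w ` Z \<subseteq> {(False, False), (True, True)} then X 0 (True, True) ^ card {z \<in> Z. w z = (True, True)} else 0)"
proof (cases "w ` Z \<subseteq> {(False, False), (True, True)}")
  case True
  have "(\<Prod>z\<in>Z. slice X 0 (w z)) = (\<Prod>z\<in>Z. if w z = (True, True) then X 0 (True, True) else 1)"
    using True by (intro prod.cong) (auto simp: slice_def)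
  also have "\<dots> = (\<Prod>z\<in>{z \<in> Z. w z = (True, True)}. X 0 (True, True))"
    using assms by (intro prod.mono_neutral_cong_right) auto
  finally show ?thesis using True by simp
next
  case False
  then obtain z where "z \<in> Z" "w z \<noteq> (False, False)" "w z \<noteq> (True, True)" by blast
  then have "\<exists>z\<in>Z. slice X 0 (w z) = 0" by (auto simp: slice_def)
  then show ?thesis using assms False by (auto intro: prod_zero)
qed

text \<open>The exponent \<open>k\<close> counts tail boxes with the letter
  \<open>(True, True)\<close>, each of which adds one to both weights; tail boxes with the letter
  \<open>(False, False)\<close> contribute the factor 1. As \<open>k\<close> ranges over numbers and
  not over sets of boxes, the tail has disappeared.\<close>

definition stable_gens :: "'p set \<Rightarrow> ('p \<Rightarrow> nat) \<Rightarrow> ('p \<Rightarrow> nat) \<Rightarrow> nat \<Rightarrow> nat \<Rightarrow> ((nat \<Rightarrow> letter \<Rightarrow> complex) \<Rightarrow> complex) set"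
  where "stable_gens S rw cl i l = {\<lambda>X. minors S rw cl u (slice X) * X 0 (True, True) ^ k | u k.
    u \<in> words S \<and> card (fsts S u) + k = i \<and> card (snds S u) + k = l}"

definition stable_space :: "'p set \<Rightarrow> ('p \<Rightarrow> nat) \<Rightarrow> ('p \<Rightarrow> nat) \<Rightarrow> nat \<Rightarrow> nat \<Rightarrow> ((nat \<Rightarrow> letter \<Rightarrow> complex) \<Rightarrow> complex) set"
  where "stable_space S rw cl i l = cfun.span (stable_gens S rw cl i l)"

context tail
begin

lemma theta_weight_space_subset: "theta (S \<union> Z) rw cl ` weight_space (S \<union> Z) i l \<subseteq> stable_space S rw cl i l"
proof (intro image_subsetI)
  fix F assume F: "F \<in> weight_space (S \<union> Z) i l"
  let ?g = "\<lambda>(w :: 'p \<Rightarrow> letter) X. minors (S \<union> Z) rw cl w (slice X)"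
  have "theta (S \<union> Z) rw cl F = (\<Sum>w\<in>words (S \<union> Z). cscale (F w) (?g w))"
    by (rule ext) (simp add: theta_eq_minors sum_fun_apply cscale_apply)
  also have "\<dots> \<in> stable_space S rw cl i l"
    unfolding stable_space_def
  proof (rule cfun.span_sum)
    fix w :: "'p \<Rightarrow> letter" assume w: "w \<in> words (S \<union> Z)"
    show "cscale (F w) (?g w) \<in> cfun.span (stable_gens S rw cl i l)"
    proof (cases "F w = 0")
      case False
      then have wt: "card (fsts (S \<union> Z) w) = i" "card (snds (S \<union> Z) w) = l"
        using F by (auto simp: weight_space_def)
      let ?K = "{z \<in> Z. w z = (True, True)}"
      have g: "?g w = (\<lambda>X. minors S rw cl (restrict w S) (slice X) *
          (if w ` Z \<subseteq> {(False, False), (True, True)} then X 0 (True, True) ^ card ?K else 0))"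
        using minors_cong[of S w "restrict w S" rw cl]
        by (simp add: minors_tail prod_slice_row_0[OF finZ] cong: if_cong)
      show ?thesis
      proof (cases "w ` Z \<subseteq> {(False, False), (True, True)}")
        case True
        then have "fsts (S \<union> Z) w = fsts S (restrict w S) \<union> ?K" "snds (S \<union> Z) w = snds S (restrict w S) \<union> ?K"
          by (auto simp: fsts_def snds_def)
        moreover have "fsts S (restrict w S) \<inter> ?K = {}" "snds S (restrict w S) \<inter> ?K = {}"
          using disj by (auto simp: fsts_def snds_def)
        moreover have "finite (fsts S (restrict w S))" "finite (snds S (restrict w S))" "finite ?K"
          using finS finZ by (auto simp: fsts_def snds_def)
        ultimately have "card (fsts S (restrict w S)) + card ?K = i" "card (snds S (restrict w S)) + card ?K = l"
          using wt card_Un_disjoint by metis+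
        moreover have "?g w = (\<lambda>X. minors S rw cl (restrict w S) (slice X) * X 0 (True, True) ^ card ?K)"
          unfolding g using True by simp
        ultimately have "?g w \<in> stable_gens S rw cl i l"
          unfolding stable_gens_def using restrict_in_words[of w S] by blast
        then show ?thesis by (intro cfun.span_scale cfun.span_base)
      next
        case False
        then have "?g w = 0" unfolding g by (auto simp: fun_eq_iff)
        then have "cscale (F w) (?g w) = 0" by simp
        then show ?thesis by (simp only: cfun.span_zero)
      qed
    next
      case True
      then have "cscale (F w) (?g w) = 0" by simp
      then show ?thesis by (simp only: cfun.span_zero)
    qed
  qed
  finally show "theta (S \<union> Z) rw cl F \<in> stable_space S rw cl i l" .
qed

text \<open>For a generator \<open>k \<le> i\<close>, so the tail has room for \<open>k\<close>
  letters \<open>(True, True)\<close>. The delta function of the resulting word is mapped to the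
  generator.\<close>

lemma stable_space_subset_theta:
  assumes iZ: "i \<le> card Z"
  shows "stable_space S rw cl i l \<subseteq> theta (S \<union> Z) rw cl ` weight_space (S \<union> Z) i l"
  unfolding stable_space_def
proof (rule cfun.span_minimal)
  show "cfun.subspace (theta (S \<union> Z) rw cl ` weight_space (S \<union> Z) i l)"
    by (rule cfun_pair.linear_subspace_image[OF clinear_theta subspace_weight_space])
  show "stable_gens S rw cl i l \<subseteq> theta (S \<union> Z) rw cl ` weight_space (S \<union> Z) i l"
  proof
    fix h assume "h \<in> stable_gens S rw cl i l"
    then obtain u k where h: "h = (\<lambda>X. minors S rw cl u (slice X) * X 0 (True, True) ^ k)"
      and u: "u \<in> words S" "card (fsts S u) + k = i" "card (snds S u) + k = l"
      by (auto simp: stable_gens_def)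
    have "k \<le> card Z" using u iZ by simp
    then obtain K where K: "K \<subseteq> Z" "card K = k" by (rule obtain_subset_with_card_n)
    define w where "w = restrict (\<lambda>x. if x \<in> S then u x else (x \<in> K, x \<in> K)) (S \<union> Z)"
    define F where "F w' = (if w' = w then 1 else 0 :: complex)" for w'
    have "fsts (S \<union> Z) w = fsts S u \<union> K" "snds (S \<union> Z) w = snds S u \<union> K"
      using K disj by (auto simp: fsts_def snds_def w_def split: if_splits)
    moreover have "fsts S u \<inter> K = {}" "snds S u \<inter> K = {}"
      using K disj by (auto simp: fsts_def snds_def)
    moreover have "finite (fsts S u)" "finite (snds S u)" "finite K"
      using finS finZ K finite_subset by (auto simp: fsts_def snds_def)
    ultimately have "card (fsts (S \<union> Z) w) = i" "card (snds (S \<union> Z) w) = l"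
      using u K(2) by (simp_all add: card_Un_disjoint)
    then have "F \<in> weight_space (S \<union> Z) i l" by (auto simp: weight_space_def F_def w_def)
    moreover have "theta (S \<union> Z) rw cl F = h"
    proof
      fix X
      have "theta (S \<union> Z) rw cl F X = (\<Sum>w'\<in>words (S \<union> Z). if w' = w then minors (S \<union> Z) rw cl w (slice X) else 0)"
        unfolding theta_eq_minors by (intro sum.cong) (auto simp: F_def)
      also have "\<dots> = minors (S \<union> Z) rw cl w (slice X)"
        using finS finZ by (simp add: sum.delta' w_def)
      also have "\<dots> = minors S rw cl u (slice X) * X 0 (True, True) ^ card {z \<in> Z. w z = (True, True)}"
      proof -
        have "w ` Z \<subseteq> {(False, False), (True, True)}" using disj by (auto simp: w_def)
        moreover have "minors S rw cl w (slice X) = minors S rw cl u (slice X)"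
          by (rule minors_cong) (simp add: w_def)
        ultimately show ?thesis by (simp add: minors_tail prod_slice_row_0[OF finZ])
      qed
      also have "{z \<in> Z. w z = (True, True)} = K" using K disj by (auto simp: w_def)
      finally show "theta (S \<union> Z) rw cl F X = h X" by (simp add: h K(2))
    qed
    ultimately show "h \<in> theta (S \<union> Z) rw cl ` weight_space (S \<union> Z) i l" by blast
  qed
qed

end

section \<open>Commutators of derivations\<close>

lemma derivation_neq_0:
  assumes "derivation S m F w \<noteq> 0"
  shows "w \<in> words S" "\<exists>x\<in>S. \<exists>a. m (w x) a \<noteq> 0 \<and> F (w(x := a)) \<noteq> 0"
proof -
  show "w \<in> words S" using assms by (auto simp: derivation_def split: if_splits)
  then have "(\<Sum>x\<in>S. \<Sum>a\<in>UNIV. m (w x) a * F (w(x := a))) \<noteq> 0" using assms by (simp add: derivation_def)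
  then obtain x where "x \<in> S" "(\<Sum>a\<in>UNIV. m (w x) a * F (w(x := a))) \<noteq> 0" by (rule sum.not_neutral_contains_not_neutral)
  moreover from this(2) obtain a where "m (w x) a * F (w(x := a)) \<noteq> 0" by (rule sum.not_neutral_contains_not_neutral)
  ultimately show "\<exists>x\<in>S. \<exists>a. m (w x) a \<noteq> 0 \<and> F (w(x := a)) \<noteq> 0" by auto
qed

lemma derivation_0 [simp]: "derivation S m 0 = 0"
  by (rule cfun_pair.linear_0[OF clinear_derivation])

text \<open>Two distinct positions give the double sum; a repeated position gives the derivation of
  the matrix product. Only the latter survives in a commutator.\<close>

lemma derivation_derivation:
  assumes S: "finite S" and w: "w \<in> words S"
  shows "derivation S m (derivation S m' F) w =
    (\<Sum>x\<in>S. \<Sum>y\<in>{y \<in> S. x \<noteq> y}. \<Sum>a\<in>UNIV. \<Sum>b\<in>UNIV. m (w x) a * m' (w y) b * F (w(x := a, y := b))) +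
    derivation S (\<lambda>a b. \<Sum>c\<in>UNIV. m a c * m' c b) F w"
proof -
  have "derivation S m (derivation S m' F) w =
      (\<Sum>x\<in>S. \<Sum>a\<in>UNIV. m (w x) a * (\<Sum>y\<in>S. \<Sum>b\<in>UNIV. m' ((w(x := a)) y) b * F (w(x := a, y := b))))"
    using w by (simp add: derivation_def cong: sum.cong)
  also have "\<dots> = (\<Sum>x\<in>S. (\<Sum>y\<in>{y \<in> S. x \<noteq> y}. \<Sum>a\<in>UNIV. \<Sum>b\<in>UNIV. m (w x) a * m' (w y) b * F (w(x := a, y := b))) +
      (\<Sum>b\<in>UNIV. (\<Sum>c\<in>UNIV. m (w x) c * m' c b) * F (w(x := b))))"
  proof (rule sum.cong[OF refl])
    fix x assume x: "x \<in> S"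
    have S': "S - {x} = {y \<in> S. x \<noteq> y}" by auto
    have "(\<Sum>y\<in>S. \<Sum>b\<in>UNIV. m' ((w(x := a)) y) b * F (w(x := a, y := b))) =
        (\<Sum>b\<in>UNIV. m' a b * F (w(x := b))) +
        (\<Sum>y\<in>{y \<in> S. x \<noteq> y}. \<Sum>b\<in>UNIV. m' (w y) b * F (w(x := a, y := b)))" for a
      unfolding sum.remove[OF S x] S' by (intro arg_cong2[where f = "(+)"] sum.cong) auto
    then have "(\<Sum>a\<in>UNIV. m (w x) a * (\<Sum>y\<in>S. \<Sum>b\<in>UNIV. m' ((w(x := a)) y) b * F (w(x := a, y := b)))) =
        (\<Sum>a\<in>UNIV. \<Sum>b\<in>UNIV. m (w x) a * m' a b * F (w(x := b))) +
        (\<Sum>a\<in>UNIV. \<Sum>y\<in>{y \<in> S. x \<noteq> y}. \<Sum>b\<in>UNIV. m (w x) a * m' (w y) b * F (w(x := a, y := b)))"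
      by (simp add: distrib_left sum.distrib sum_distrib_left mult.assoc)
    moreover have "(\<Sum>a\<in>UNIV. \<Sum>b\<in>UNIV. m (w x) a * m' a b * F (w(x := b))) =
        (\<Sum>b\<in>UNIV. (\<Sum>c\<in>UNIV. m (w x) c * m' c b) * F (w(x := b)))"
      unfolding sum_distrib_right by (rule sum.swap)
    moreover have "(\<Sum>a\<in>UNIV. \<Sum>y\<in>{y \<in> S. x \<noteq> y}. \<Sum>b\<in>UNIV. m (w x) a * m' (w y) b * F (w(x := a, y := b))) =
        (\<Sum>y\<in>{y \<in> S. x \<noteq> y}. \<Sum>a\<in>UNIV. \<Sum>b\<in>UNIV. m (w x) a * m' (w y) b * F (w(x := a, y := b)))"
      by (rule sum.swap)
    ultimately show "(\<Sum>a\<in>UNIV. m (w x) a * (\<Sum>y\<in>S. \<Sum>b\<in>UNIV. m' ((w(x := a)) y) b * F (w(x := a, y := b)))) =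
        (\<Sum>y\<in>{y \<in> S. x \<noteq> y}. \<Sum>a\<in>UNIV. \<Sum>b\<in>UNIV. m (w x) a * m' (w y) b * F (w(x := a, y := b))) +
        (\<Sum>b\<in>UNIV. (\<Sum>c\<in>UNIV. m (w x) c * m' c b) * F (w(x := b)))"
      by simp
  qed
  finally show ?thesis using w by (simp add: sum.distrib derivation_def)
qed

lemma derivation_commutator:
  assumes S: "finite S" and w: "w \<in> words S"
  shows "derivation S m (derivation S m' F) w = derivation S m' (derivation S m F) w +
    (derivation S (\<lambda>a b. \<Sum>c\<in>UNIV. m a c * m' c b) F w - derivation S (\<lambda>a b. \<Sum>c\<in>UNIV. m' a c * m c b) F w)"
proof -
  have "(\<Sum>x\<in>S. \<Sum>y\<in>{y \<in> S. x \<noteq> y}. \<Sum>a\<in>UNIV. \<Sum>b\<in>UNIV. m (w x) a * m' (w y) b * F (w(x := a, y := b))) =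
      (\<Sum>y\<in>S. \<Sum>x\<in>{x \<in> S. x \<noteq> y}. \<Sum>a\<in>UNIV. \<Sum>b\<in>UNIV. m (w x) a * m' (w y) b * F (w(x := a, y := b)))"
    by (rule sum.swap_restrict[OF S S])
  also have "\<dots> = (\<Sum>x\<in>S. \<Sum>y\<in>{y \<in> S. x \<noteq> y}. \<Sum>a\<in>UNIV. \<Sum>b\<in>UNIV. m' (w x) a * m (w y) b * F (w(x := a, y := b)))"
  proof (rule sum.cong[OF refl], rule sum.cong)
    fix x y assume "y \<in> {y \<in> S. x \<noteq> y}"
    then have "w(y := a, x := b) = w(x := b, y := a)" for a b by (auto intro: fun_upd_twist)
    then show "(\<Sum>a\<in>UNIV. \<Sum>b\<in>UNIV. m (w y) a * m' (w x) b * F (w(y := a, x := b))) =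
        (\<Sum>a\<in>UNIV. \<Sum>b\<in>UNIV. m' (w x) a * m (w y) b * F (w(x := a, y := b)))"
      by (subst sum.swap) (simp add: mult.commute)
  qed auto
  finally show ?thesis
    unfolding derivation_derivation[OF S w] by simp
qed

lemma derivation_commute:
  assumes S: "finite S" and m: "\<And>a b. (\<Sum>c\<in>UNIV. m a c * m' c b) = (\<Sum>c\<in>UNIV. m' a c * m c b)"
  shows "derivation S m (derivation S m' F) = derivation S m' (derivation S m F)"
proof
  fix w show "derivation S m (derivation S m' F) w = derivation S m' (derivation S m F) w"
    using derivation_commutator[OF S, of w m m' F] by (cases "w \<in> words S") (simp_all add: m, simp add: derivation_def)
qed

lemma e1_e2_commute: "(\<Sum>c\<in>UNIV. e2 a c * e1 c b) = (\<Sum>c\<in>UNIV. e1 a c * e2 c b)"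
  by (cases a; cases b) (simp add: sum_letter e1_def e2_def)

section \<open>Lifting to highest weight tensors\<close>

text \<open>On the slice the letter \<open>\<alpha>\<close> vanishes in the first row, so only the term \<open>k = 0\<close> of the lift
  survives there. The coefficients are those of the antiderivative
  \<open>\<Sum>k. (-1)^k y^k D^k / k!\<close>, which projects onto the kernel of \<open>D\<close>, written in symmetric tensors.\<close>

definition lift_coeff :: "nat \<Rightarrow> nat \<Rightarrow> complex"
  where "lift_coeff N k = (- 1) ^ k * fact (N - k) / fact N"

text \<open>In the \<open>k\<close>-th term, \<open>k\<close> boxes of \<open>Z\<close> carry
  \<open>\<alpha>\<close>, the others \<open>(False, False)\<close>, and the part on
  \<open>S\<close> is the \<open>k\<close>-th derivative of \<open>F\<close>. The sum over all
  placements of the \<open>k\<close> letters stands for the power \<open>y^k\<close>.\<close>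

definition lift_tensor :: "'p set \<Rightarrow> 'p set \<Rightarrow> (letter \<Rightarrow> letter \<Rightarrow> complex) \<Rightarrow> letter \<Rightarrow> (('p \<Rightarrow> letter) \<Rightarrow> complex) \<Rightarrow> ('p \<Rightarrow> letter) \<Rightarrow> complex"
  where "lift_tensor S Z m \<alpha> F = (\<lambda>w. if w \<in> words (S \<union> Z) \<and> w ` Z \<subseteq> {(False, False), \<alpha>}
    then lift_coeff (card Z) (card {z \<in> Z. w z = \<alpha>}) *
      ((derivation S m ^^ card {z \<in> Z. w z = \<alpha>}) F) (restrict w S) else 0)"

text \<open>The cancellation behind \<open>lift_tensor_killed\<close>: at a word with
  \<open>k\<close> letters \<open>\<alpha>\<close> in \<open>Z\<close>, the first term comes from
  the derivation on \<open>S\<close>, the second from the \<open>N - k\<close> free boxes of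
  \<open>Z\<close>.\<close>

lemma lift_coeff_rec: "k < N \<Longrightarrow> lift_coeff N k + of_nat (N - k) * lift_coeff N (Suc k) = 0"
proof -
  assume "k < N"
  then have "fact (N - k) = (of_nat (N - k) * fact (N - Suc k) :: complex)"
    by (metis Suc_diff_Suc fact_Suc)
  then show ?thesis by (simp add: lift_coeff_def)
qed

lemma restrict_upd: "x \<in> S \<Longrightarrow> restrict (w(x := a)) S = (restrict w S)(x := a)"
  "z \<notin> S \<Longrightarrow> restrict (w(z := a)) S = restrict w S"
  by (auto simp: restrict_def fun_eq_iff)

lemma lift_tensor_upd_left:
  assumes "x \<in> S" "S \<inter> Z = {}" "w \<in> words (S \<union> Z)"
  shows "lift_tensor S Z m \<alpha> F (w(x := a)) = (if w ` Z \<subseteq> {(False, False), \<alpha>}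
    then lift_coeff (card Z) (card {z \<in> Z. w z = \<alpha>}) *
      ((derivation S m ^^ card {z \<in> Z. w z = \<alpha>}) F) ((restrict w S)(x := a)) else 0)"
proof -
  have "x \<notin> Z" using assms by blast
  then have "(w(x := a)) ` Z = w ` Z" "{z \<in> Z. (w(x := a)) z = \<alpha>} = {z \<in> Z. w z = \<alpha>}"
    by (auto simp: image_iff)
  then show ?thesis
    using assms by (simp add: lift_tensor_def restrict_upd(1) del: fun_upd_apply)
qed

lemma lift_tensor_sum_left:
  assumes "S \<inter> Z = {}" "w \<in> words (S \<union> Z)"
  shows "(\<Sum>x\<in>S. \<Sum>a\<in>UNIV. m' (w x) a * lift_tensor S Z m \<alpha> F (w(x := a))) = (if w ` Z \<subseteq> {(False, False), \<alpha>}
    then lift_coeff (card Z) (card {z \<in> Z. w z = \<alpha>}) *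
      derivation S m' ((derivation S m ^^ card {z \<in> Z. w z = \<alpha>}) F) (restrict w S) else 0)"
proof -
  have "(\<Sum>x\<in>S. \<Sum>a\<in>UNIV. m' (w x) a * lift_tensor S Z m \<alpha> F (w(x := a))) =
      (\<Sum>x\<in>S. \<Sum>a\<in>UNIV. m' (w x) a * (if w ` Z \<subseteq> {(False, False), \<alpha>}
      then lift_coeff (card Z) (card {z \<in> Z. w z = \<alpha>}) *
      ((derivation S m ^^ card {z \<in> Z. w z = \<alpha>}) F) ((restrict w S)(x := a)) else 0))"
    by (rule sum.cong[OF refl], rule sum.cong[OF refl]) (simp only: lift_tensor_upd_left[OF _ assms])
  then show ?thesis
    by (simp add: derivation_def sum_distrib_left mult.left_commute cong: sum.cong)
qed

lemma lift_tensor_upd_right: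
  assumes z: "z \<in> Z" "S \<inter> Z = {}" "finite Z" "w \<in> words (S \<union> Z)" and w: "w ` (Z - {z}) \<subseteq> {(False, False), \<alpha>}"
    and \<alpha>: "w z \<noteq> \<alpha>"
  shows "lift_tensor S Z m \<alpha> F (w(z := \<alpha>)) =
    lift_coeff (card Z) (Suc (card {z \<in> Z. w z = \<alpha>})) *
      ((derivation S m ^^ Suc (card {z \<in> Z. w z = \<alpha>})) F) (restrict w S)"
proof -
  have "(w(z := \<alpha>)) ` Z \<subseteq> {(False, False), \<alpha>}" using w by auto
  moreover have "{y \<in> Z. (w(z := \<alpha>)) y = \<alpha>} = insert z {y \<in> Z. w y = \<alpha>}" using z by auto
  then have "card {y \<in> Z. (w(z := \<alpha>)) y = \<alpha>} = Suc (card {z \<in> Z. w z = \<alpha>})"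
    using z \<alpha> by simp
  moreover have "restrict (w(z := \<alpha>)) S = restrict w S" using z by (intro restrict_upd(2)) auto
  ultimately show ?thesis using z unfolding lift_tensor_def by (simp del: fun_upd_apply funpow.simps)
qed

lemma lift_tensor_upd_0:
  assumes "z \<in> Z" "a \<noteq> (False, False)" "a \<noteq> \<alpha>"
  shows "lift_tensor S Z m \<alpha> F (w(z := a)) = 0"
proof -
  have "a \<in> (w(z := a)) ` Z" using assms(1) by (metis fun_upd_same imageI)
  then have "\<not> (w(z := a)) ` Z \<subseteq> {(False, False), \<alpha>}" using assms by blast
  then show ?thesis unfolding lift_tensor_def by (simp only: simp_thms if_False)
qed

lemma sum_single_letter:
  assumes "\<And>a. a \<noteq> \<alpha> \<Longrightarrow> f a = 0"
  shows "(\<Sum>a\<in>(UNIV :: letter set). f a) = (f \<alpha> :: complex)"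
  using assms by (subst sum.remove[of UNIV \<alpha>]) auto

text \<open>The terms cancel by \<open>lift_coeff_rec\<close> as long as \<open>Z\<close> has a free
  box. When all boxes carry \<open>\<alpha>\<close> there is nothing to cancel against, and
  \<open>nil\<close> makes the remaining term vanish.\<close>

lemma lift_tensor_killed:
  assumes SZ: "S \<inter> Z = {}" "finite S" "finite Z" and \<alpha>: "\<alpha> \<noteq> (False, False)"
    and m0: "\<And>b. m b (False, False) = 0" and m\<alpha>: "\<And>b. m b \<alpha> = (if b = (False, False) then 1 else 0)"
    and nil: "(derivation S m ^^ Suc (card Z)) F = 0"
  shows "derivation (S \<union> Z) m (lift_tensor S Z m \<alpha> F) = 0"
proof
  fix w
  let ?L = "lift_tensor S Z m \<alpha> F" and ?N = "card Z"
  show "derivation (S \<union> Z) m ?L w = 0 w"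
  proof (cases "w \<in> words (S \<union> Z)")
    case w: True
    define k where "k = card {z \<in> Z. w z = \<alpha>}"
    have right: "(\<Sum>a\<in>UNIV. m (w z) a * ?L (w(z := a))) = (if w z = (False, False) then ?L (w(z := \<alpha>)) else 0)" if "z \<in> Z" for z
    proof -
      have "(\<Sum>a\<in>UNIV. m (w z) a * ?L (w(z := a))) = m (w z) \<alpha> * ?L (w(z := \<alpha>))"
        using m0 lift_tensor_upd_0[OF that] by (intro sum_single_letter) (metis mult_zero_left mult_zero_right)
      then show ?thesis by (simp add: m\<alpha>)
    qed
    have "derivation (S \<union> Z) m ?L w =
        (\<Sum>x\<in>S. \<Sum>a\<in>UNIV. m (w x) a * ?L (w(x := a))) + (\<Sum>z\<in>Z. if w z = (False, False) then ?L (w(z := \<alpha>)) else 0)"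
      using w SZ right by (simp add: derivation_def sum.union_disjoint cong: sum.cong)
    also have "\<dots> = 0"
    proof (cases "w ` Z \<subseteq> {(False, False), \<alpha>}")
      case True
      have "(\<Sum>z\<in>Z. if w z = (False, False) then ?L (w(z := \<alpha>)) else 0) =
          (\<Sum>z\<in>Z. if w z = (False, False) then lift_coeff ?N (Suc k) * ((derivation S m ^^ Suc k) F) (restrict w S) else 0)"
      proof (rule sum.cong[OF refl])
        fix z assume z: "z \<in> Z"
        show "(if w z = (False, False) then ?L (w(z := \<alpha>)) else 0) =
            (if w z = (False, False) then lift_coeff ?N (Suc k) * ((derivation S m ^^ Suc k) F) (restrict w S) else 0)"
          using lift_tensor_upd_right[OF z SZ(1,3) w, of \<alpha> m F] True \<alpha> by (auto simp: k_def)
      qed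
      also have "\<dots> = of_nat (card {z \<in> Z. w z = (False, False)}) * (lift_coeff ?N (Suc k) * ((derivation S m ^^ Suc k) F) (restrict w S))"
        using SZ by (simp add: sum.If_cases Int_def)
      also have "card {z \<in> Z. w z = (False, False)} = ?N - k"
      proof -
        have "{z \<in> Z. w z = (False, False)} = Z - {z \<in> Z. w z = \<alpha>}" using True \<alpha> by auto
        then show ?thesis using SZ by (simp add: k_def card_Diff_subset)
      qed
      finally have "(\<Sum>x\<in>S. \<Sum>a\<in>UNIV. m (w x) a * ?L (w(x := a))) + (\<Sum>z\<in>Z. if w z = (False, False) then ?L (w(z := \<alpha>)) else 0) =
          (lift_coeff ?N k + of_nat (?N - k) * lift_coeff ?N (Suc k)) * ((derivation S m ^^ Suc k) F) (restrict w S)"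
        unfolding lift_tensor_sum_left[OF SZ(1) w] using True by (simp add: k_def algebra_simps del: restrict_apply)
      moreover have "k \<le> ?N" unfolding k_def using SZ by (intro card_mono) auto
      ultimately show ?thesis
        using lift_coeff_rec[of k ?N] nil by (cases "k = ?N") (auto simp del: funpow.simps)
    next
      case False
      then obtain z0 where z0: "z0 \<in> Z" "w z0 \<noteq> (False, False)" "w z0 \<noteq> \<alpha>" by blast
      have "?L (w(z := \<alpha>)) = 0" if "w z = (False, False)" for z
      proof -
        have "w z0 \<in> (w(z := \<alpha>)) ` Z" using z0 that by (metis fun_upd_apply imageI)
        then have "\<not> (w(z := \<alpha>)) ` Z \<subseteq> {(False, False), \<alpha>}" using z0 by blast
        then show ?thesis unfolding lift_tensor_def by (simp only: simp_thms if_False)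
      qed
      then have "(\<Sum>z\<in>Z. if w z = (False, False) then ?L (w(z := \<alpha>)) else 0) = 0"
        by (intro sum.neutral) (simp del: fun_upd_apply)
      then show ?thesis
        unfolding lift_tensor_sum_left[OF SZ(1) w] using False by simp
    qed
    finally show ?thesis by simp
  qed (simp add: derivation_def)
qed

lemma funpow_derivation_killed:
  assumes "finite S" "\<And>a b. (\<Sum>c\<in>UNIV. m a c * m' c b) = (\<Sum>c\<in>UNIV. m' a c * m c b)" "derivation S m' F = 0"
  shows "derivation S m' ((derivation S m ^^ k) F) = 0"
proof (induction k)
  case (Suc k)
  have "derivation S m' ((derivation S m ^^ Suc k) F) = derivation S m (derivation S m' ((derivation S m ^^ k) F))"
    by (simp add: derivation_commute[OF assms(1,2)])
  also have "\<dots> = 0" by (simp only: Suc.IH derivation_0)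
  finally show ?case .
qed (simp add: assms)

text \<open>\<open>m'\<close> has zero columns at both letters used on \<open>Z\<close>, so it acts
  on \<open>S\<close> alone, where it commutes with \<open>m\<close> and therefore kills all
  derivatives of \<open>F\<close>.\<close>

lemma lift_tensor_killed_other:
  assumes SZ: "S \<inter> Z = {}" "finite S" "finite Z"
    and m0: "\<And>b. m' b (False, False) = 0" "\<And>b. m' b \<alpha> = 0"
    and comm: "\<And>a b. (\<Sum>c\<in>UNIV. m a c * m' c b) = (\<Sum>c\<in>UNIV. m' a c * m c b)"
    and F: "derivation S m' F = 0"
  shows "derivation (S \<union> Z) m' (lift_tensor S Z m \<alpha> F) = 0"
proof
  fix w
  let ?L = "lift_tensor S Z m \<alpha> F"
  have right: "m' (w z) a * ?L (w(z := a)) = 0" if "z \<in> Z" for z a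
    using m0 lift_tensor_upd_0[OF that] by (metis mult_zero_left mult_zero_right)
  show "derivation (S \<union> Z) m' ?L w = 0 w"
  proof (cases "w \<in> words (S \<union> Z)")
    case w: True
    have "derivation (S \<union> Z) m' ?L w = (\<Sum>x\<in>S. \<Sum>a\<in>UNIV. m' (w x) a * ?L (w(x := a)))"
    proof -
      have "(\<Sum>z\<in>Z. \<Sum>a\<in>UNIV. m' (w z) a * ?L (w(z := a))) = 0"
        using right by (intro sum.neutral ballI)
      then show ?thesis
        unfolding derivation_def if_P[OF w] sum.union_disjoint[OF SZ(2,3,1)] by (simp only: add_0_right)
    qed
    also have "\<dots> = 0"
      unfolding lift_tensor_sum_left[OF SZ(1) w] using funpow_derivation_killed[OF SZ(2) comm F] by simp
    finally show ?thesis by simp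
  qed (simp add: derivation_def)
qed

text \<open>Weights are integers here because derivations can push them below 0, where the tensor
  must vanish. This yields the nilpotency required by the lift and by the \<open>sl2\<close>
  argument.\<close>

definition shifted_weight :: "'p set \<Rightarrow> int \<Rightarrow> int \<Rightarrow> (('p \<Rightarrow> letter) \<Rightarrow> complex) \<Rightarrow> bool"
  where "shifted_weight S i l F \<longleftrightarrow> (\<forall>w. F w \<noteq> 0 \<longrightarrow> w \<in> words S \<and> int (card (fsts S w)) = i \<and> int (card (snds S w)) = l)"

lemma shifted_weight_iff: "shifted_weight S (int i) (int l) F \<longleftrightarrow> F \<in> weight_space S i l"
  by (simp add: shifted_weight_def weight_space_def)

lemma shifted_weight_neg: "shifted_weight S i l F \<Longrightarrow> i < 0 \<or> l < 0 \<Longrightarrow> F = 0"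
  by (rule ext) (force simp: shifted_weight_def)

text \<open>The derivation reads \<open>F\<close> at the changed word, so the weight of the result
  is that of \<open>F\<close> minus the change from the letter \<open>b\<close> to the letter
  \<open>a\<close>.\<close>

lemma shifted_weight_derivation:
  assumes S: "finite S" and F: "shifted_weight S i l F"
    and m: "\<And>b a. m b a \<noteq> 0 \<Longrightarrow> of_bool (fst a) = of_bool (fst b) + p \<and> of_bool (snd a) = of_bool (snd b) + q"
  shows "shifted_weight S (i - p) (l - q) (derivation S m F)"
  unfolding shifted_weight_def
proof (intro allI impI)
  fix w assume nz: "derivation S m F w \<noteq> 0"
  obtain x a where x: "x \<in> S" "m (w x) a \<noteq> 0" "F (w(x := a)) \<noteq> 0"
    using derivation_neq_0(2)[OF nz] by blast
  have card: "int (card {y \<in> S. R (v y)}) = (\<Sum>y\<in>S. of_bool (R (v y)))" for R and v :: "'a \<Rightarrow> letter"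
    using S by (simp add: Int_def)
  have upd: "(\<Sum>y\<in>S. of_bool (R ((w(x := a)) y)) :: int) = (\<Sum>y\<in>S. of_bool (R (w y))) + (of_bool (R a) - of_bool (R (w x)))" for R
  proof -
    have "(\<Sum>y\<in>S - {x}. of_bool (R ((w(x := a)) y)) :: int) = (\<Sum>y\<in>S - {x}. of_bool (R (w y)))"
      by (intro sum.cong) auto
    then show ?thesis unfolding sum.remove[OF S x(1)] by simp
  qed
  have "int (card (fsts S (w(x := a)))) = i" "int (card (snds S (w(x := a)))) = l"
    using F x(3) unfolding shifted_weight_def by blast+
  then have "int (card (fsts S w)) = i - p" "int (card (snds S w)) = l - q"
    using m[OF x(2)] unfolding fsts_def snds_def card upd by auto
  then show "w \<in> words S \<and> int (card (fsts S w)) = i - p \<and> int (card (snds S w)) = l - q"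
    using derivation_neq_0(1)[OF nz] by simp
qed

lemma shifted_weight_funpow:
  assumes "finite S" "shifted_weight S i l F"
    and "\<And>b a. m b a \<noteq> 0 \<Longrightarrow> of_bool (fst a) = of_bool (fst b) + p \<and> of_bool (snd a) = of_bool (snd b) + q"
  shows "shifted_weight S (i - int k * p) (l - int k * q) ((derivation S m ^^ k) F)"
proof (induction k)
  case (Suc k)
  show ?case
    using shifted_weight_derivation[OF assms(1) Suc assms(3)] by (simp add: algebra_simps)
qed (simp add: assms(2))

lemma weight_e1: "e1 b a \<noteq> 0 \<Longrightarrow> of_bool (fst a) = of_bool (fst b) + (1 :: int) \<and> of_bool (snd a) = of_bool (snd b) + (0 :: int)"
  and weight_e2: "e2 b a \<noteq> 0 \<Longrightarrow> of_bool (fst a) = of_bool (fst b) + (0 :: int) \<and> of_bool (snd a) = of_bool (snd b) + (1 :: int)"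
  by (auto simp: e1_def e2_def split: if_splits)

lemma shifted_weight_lift_tensor:
  assumes SZ: "S \<inter> Z = {}" "finite S" "finite Z" and F: "shifted_weight S i l F"
    and m: "\<And>b a. m b a \<noteq> 0 \<Longrightarrow> of_bool (fst a) = of_bool (fst b) + (of_bool (fst \<alpha>) :: int) \<and> of_bool (snd a) = of_bool (snd b) + (of_bool (snd \<alpha>) :: int)"
    and \<alpha>: "\<alpha> \<noteq> (False, False)"
  shows "shifted_weight (S \<union> Z) i l (lift_tensor S Z m \<alpha> F)"
  unfolding shifted_weight_def
proof (intro allI impI)
  fix w assume nz: "lift_tensor S Z m \<alpha> F w \<noteq> 0"
  let ?K = "{z \<in> Z. w z = \<alpha>}"
  have w: "w \<in> words (S \<union> Z)" "w ` Z \<subseteq> {(False, False), \<alpha>}"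
    and D: "((derivation S m ^^ card ?K) F) (restrict w S) \<noteq> 0"
    using nz by (auto simp: lift_tensor_def split: if_splits)
  have wt: "int (card (fsts S (restrict w S))) = i - int (card ?K) * of_bool (fst \<alpha>)"
    "int (card (snds S (restrict w S))) = l - int (card ?K) * of_bool (snd \<alpha>)"
    using shifted_weight_funpow[OF SZ(2) F m, where k = "card ?K"] D unfolding shifted_weight_def by blast+
  have "fsts (S \<union> Z) w = fsts S (restrict w S) \<union> (if fst \<alpha> then ?K else {})"
    "snds (S \<union> Z) w = snds S (restrict w S) \<union> (if snd \<alpha> then ?K else {})"
    using w(2) by (auto simp: fsts_def snds_def split: if_splits)
  moreover have "fsts S (restrict w S) \<inter> ?K = {}" "snds S (restrict w S) \<inter> ?K = {}"
    using SZ by (auto simp: fsts_def snds_def)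
  moreover have "finite (fsts S (restrict w S))" "finite (snds S (restrict w S))" "finite ?K"
    using SZ by (auto simp: fsts_def snds_def)
  ultimately have "int (card (fsts (S \<union> Z) w)) = i" "int (card (snds (S \<union> Z) w)) = l"
    using wt by (auto simp: card_Un_disjoint split: if_splits)
  then show "w \<in> words (S \<union> Z) \<and> int (card (fsts (S \<union> Z) w)) = i \<and> int (card (snds (S \<union> Z) w)) = l"
    using w(1) by simp
qed

text \<open>On the slice \<open>\<alpha>\<close> vanishes in row 0, so only words equal to
  \<open>(False, False)\<close> on all of \<open>Z\<close> contribute; for these both the matrix
  entries and the coefficient for \<open>k = 0\<close> are 1.\<close>

lemma (in tail) theta_lift_tensor:
  assumes \<alpha>: "\<alpha> = (True, False) \<or> \<alpha> = (False, True)"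
  shows "theta (S \<union> Z) rw cl (lift_tensor S Z m \<alpha> F) = theta S rw cl F"
proof
  fix X
  let ?L = "lift_tensor S Z m \<alpha> F" and ?o = "(False, False)"
  let ?A = "{w \<in> words (S \<union> Z). \<forall>z\<in>Z. w z = ?o}"
  have "theta (S \<union> Z) rw cl ?L X = (\<Sum>w\<in>words (S \<union> Z). ?L w * (minors S rw cl w (slice X) * (\<Prod>z\<in>Z. slice X 0 (w z))))"
    unfolding theta_eq_minors minors_tail ..
  also have "\<dots> = (\<Sum>w\<in>?A. ?L w * (minors S rw cl w (slice X) * (\<Prod>z\<in>Z. slice X 0 (w z))))"
  proof (rule sum.mono_neutral_right)
    show "\<forall>w\<in>words (S \<union> Z) - ?A. ?L w * (minors S rw cl w (slice X) * (\<Prod>z\<in>Z. slice X 0 (w z))) = 0"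
    proof
      fix w assume w: "w \<in> words (S \<union> Z) - ?A"
      then obtain z where z: "z \<in> Z" "w z \<noteq> ?o" by blast
      show "?L w * (minors S rw cl w (slice X) * (\<Prod>z\<in>Z. slice X 0 (w z))) = 0"
      proof (cases "w z = \<alpha>")
        case True
        then have "slice X 0 (w z) = 0" using \<alpha> by (auto simp: slice_def)
        then have "(\<Prod>z\<in>Z. slice X 0 (w z)) = 0" using z(1) finZ by (metis prod_zero)
        then show ?thesis by simp
      next
        case False
        then have "\<not> w ` Z \<subseteq> {?o, \<alpha>}" using z by blast
        then have "?L w = 0" unfolding lift_tensor_def by (simp only: simp_thms if_False)
        then show ?thesis by simp
      qed
    qed
  qed (use finS finZ in auto)
  also have "\<dots> = (\<Sum>u\<in>words S. F u * minors S rw cl u (slice X))"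
  proof (rule sum.reindex_bij_witness[where j = "\<lambda>w. restrict w S" and i = "\<lambda>u. restrict (\<lambda>x. if x \<in> S then u x else ?o) (S \<union> Z)"])
    fix w assume w: "w \<in> ?A"
    then have wA: "w \<in> words (S \<union> Z)" and wo: "\<And>z. z \<in> Z \<Longrightarrow> w z = ?o" by auto
    show "restrict (\<lambda>x. if x \<in> S then restrict w S x else ?o) (S \<union> Z) = w"
      by (rule words_eqI[OF _ wA]) (use wo in auto)
    show "restrict w S \<in> words S" by simp
    have K: "{z \<in> Z. w z = \<alpha>} = {}" and "w ` Z \<subseteq> {?o, \<alpha>}" using wo \<alpha> by auto
    then have "?L w = F (restrict w S)"
      using wA unfolding lift_tensor_def K card.empty by (simp add: lift_coeff_def del: restrict_apply)
    moreover have "(\<Prod>z\<in>Z. slice X 0 (w z)) = 1" using wo by (simp add: slice_def)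
    moreover have "minors S rw cl (restrict w S) (slice X) = minors S rw cl w (slice X)"
      by (rule minors_cong) simp
    ultimately show "F (restrict w S) * minors S rw cl (restrict w S) (slice X) =
        ?L w * (minors S rw cl w (slice X) * (\<Prod>z\<in>Z. slice X 0 (w z)))" by simp
  next
    fix u :: "'p \<Rightarrow> letter" assume u: "u \<in> words S"
    let ?w = "restrict (\<lambda>x. if x \<in> S then u x else ?o) (S \<union> Z)"
    show "restrict ?w S = u" by (rule words_eqI[OF _ u]) auto
    show "?w \<in> ?A" using disj by auto
  qed
  also have "\<dots> = theta S rw cl F X" by (simp add: theta_eq_minors)
  finally show "theta (S \<union> Z) rw cl ?L X = theta S rw cl F X" .
qed

text \<open>The factor 3 comes from cutting \<open>Z\<close> into three blocks with at least
  \<open>i + l\<close> boxes each: \<open>Z0\<close> has room for the letters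
  \<open>(True, True)\<close> of the generators, \<open>Z1\<close> serves the lift for
  \<open>e1\<close>, and \<open>Z2\<close> the lift for \<open>e2\<close>.\<close>

theorem (in tail) theta_highest_weight_space:
  assumes Z: "3 * (i + l) \<le> card Z"
  shows "theta (S \<union> Z) rw cl ` highest_weight_space (S \<union> Z) i l = stable_space S rw cl i l"
proof (rule antisym)
  show "theta (S \<union> Z) rw cl ` highest_weight_space (S \<union> Z) i l \<subseteq> stable_space S rw cl i l"
    using theta_weight_space_subset by (auto simp: highest_weight_space_def)
next
  define N where "N = i + l"
  have "N \<le> card Z" using Z by (simp add: N_def)
  then obtain Z1 where Z1: "Z1 \<subseteq> Z" "card Z1 = N" by (meson obtain_subset_with_card_n)
  have "card (Z - Z1) = card Z - N"
    using Z1 finite_subset[OF Z1(1) finZ] by (simp add: card_Diff_subset)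
  then have "N \<le> card (Z - Z1)" using Z by (simp add: N_def)
  then obtain Z2 where Z2: "Z2 \<subseteq> Z - Z1" "card Z2 = N" by (meson obtain_subset_with_card_n)
  define Z0 where "Z0 = Z - Z1 - Z2"
  have fin: "finite Z0" "finite Z1" "finite Z2" using finZ finite_subset[OF Z1(1)] finite_subset[OF Z2(1)] by (auto simp: Z0_def)
  have "card Z0 = card Z - N - N"
    unfolding Z0_def using Z1 Z2 fin finZ \<open>card (Z - Z1) = card Z - N\<close> by (simp add: card_Diff_subset)
  then have iZ0: "i \<le> card Z0" using Z by (simp add: N_def)
  have sub: "Z0 \<subseteq> Z" "Z1 \<subseteq> Z" "Z2 \<subseteq> Z" "Z0 \<inter> Z1 = {}" "Z0 \<inter> Z2 = {}" "Z1 \<inter> Z2 = {}" "Z = Z0 \<union> Z1 \<union> Z2"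
    using Z1 Z2 by (auto simp: Z0_def)
  have tailI: "tail (S \<union> A) B rw cl" if "A \<subseteq> Z" "B \<subseteq> Z" "A \<inter> B = {}" for A B
  proof
    show "finite (S \<union> A)" "finite B" using finS finZ that finite_subset by auto
    show "(S \<union> A) \<inter> B = {}" using that disj by auto
    show "rw z = 0" if "z \<in> B" for z using that \<open>B \<subseteq> Z\<close> row_tail by auto
    show "cl x \<noteq> cl z" if "z \<in> B" "x \<in> S \<union> A" for z x
      using that \<open>A \<subseteq> Z\<close> \<open>B \<subseteq> Z\<close> \<open>A \<inter> B = {}\<close> col_tail col_inj unfolding inj_on_def by blast
    show "inj_on cl B" using col_inj \<open>B \<subseteq> Z\<close> inj_on_subset by blast
  qed
  interpret t0: tail "S" Z0 rw cl using tailI[of "{}" Z0] sub by simp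
  interpret t1: tail "S \<union> Z0" Z1 rw cl using tailI[of Z0 Z1] sub by simp
  interpret t2: tail "S \<union> Z0 \<union> Z1" Z2 rw cl using tailI[of "Z0 \<union> Z1" Z2] sub by (simp add: Un_assoc Int_Un_distrib2)
  have SZ: "S \<union> Z = S \<union> Z0 \<union> Z1 \<union> Z2" using sub(7) by blast
  show "stable_space S rw cl i l \<subseteq> theta (S \<union> Z) rw cl ` highest_weight_space (S \<union> Z) i l"
  proof
    fix h assume "h \<in> stable_space S rw cl i l"
    then obtain F where F: "F \<in> weight_space (S \<union> Z0) i l" "h = theta (S \<union> Z0) rw cl F"
      using t0.stable_space_subset_theta[OF iZ0] by blast
    define G where "G = lift_tensor (S \<union> Z0) Z1 e1 (True, False) F"
    define H where "H = lift_tensor (S \<union> Z0 \<union> Z1) Z2 e2 (False, True) G"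
    have wF: "shifted_weight (S \<union> Z0) (int i) (int l) F" using F by (simp add: shifted_weight_iff)
    have wG: "shifted_weight (S \<union> Z0 \<union> Z1) (int i) (int l) G"
      unfolding G_def using weight_e1
      by (intro shifted_weight_lift_tensor t1.disj t1.finS t1.finZ wF) auto
    have wH: "shifted_weight (S \<union> Z0 \<union> Z1 \<union> Z2) (int i) (int l) H"
      unfolding H_def using weight_e2
      by (intro shifted_weight_lift_tensor t2.disj t2.finS t2.finZ wG) auto
    \<comment> \<open>\<open>card Z1\<close> is \<open>i + l\<close>, at least \<open>i\<close>, so
      one derivation more makes the first weight negative.\<close>
    have nilF: "(derivation (S \<union> Z0) e1 ^^ Suc (card Z1)) F = 0"
      using shifted_weight_funpow[OF t1.finS wF weight_e1, where k = "Suc (card Z1)"] Z1(2)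
      by (intro shifted_weight_neg) (auto simp: N_def)
    have nilG: "(derivation (S \<union> Z0 \<union> Z1) e2 ^^ Suc (card Z2)) G = 0"
      using shifted_weight_funpow[OF t2.finS wG weight_e2, where k = "Suc (card Z2)"] Z2(2)
      by (intro shifted_weight_neg) (auto simp: N_def)
    have e1G: "derivation (S \<union> Z0 \<union> Z1) e1 G = 0"
      unfolding G_def by (rule lift_tensor_killed[OF t1.disj t1.finS t1.finZ _ _ _ nilF]) (auto simp: e1_def)
    have e2H: "derivation (S \<union> Z) e2 H = 0"
      unfolding SZ H_def by (rule lift_tensor_killed[OF t2.disj t2.finS t2.finZ _ _ _ nilG]) (auto simp: e2_def)
    \<comment> \<open>The second lift keeps the first condition: \<open>e1\<close> has zero columns
      at the letters \<open>(False, False)\<close> and \<open>(False, True)\<close> used on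
      \<open>Z2\<close>.\<close>
    have e1H: "derivation (S \<union> Z) e1 H = 0"
      unfolding SZ H_def
      by (rule lift_tensor_killed_other[OF t2.disj t2.finS t2.finZ _ _ e1_e2_commute e1G]) (auto simp: e1_def)
    have "H \<in> highest_weight_space (S \<union> Z) i l"
      using wH e1H e2H by (simp add: highest_weight_space_def shifted_weight_iff SZ)
    moreover have "theta (S \<union> Z) rw cl H = h"
      unfolding SZ H_def G_def F(2) by (simp add: t2.theta_lift_tensor t1.theta_lift_tensor)
    ultimately show "h \<in> theta (S \<union> Z) rw cl ` highest_weight_space (S \<union> Z) i l" by blast
  qed
qed

section \<open>The action of sl2 on the slice\<close>

text \<open>With \<open>lower\<close>, the nilpotent generators of the \<open>sl2\<close> on the two
  middle letters. Since a derivation reads \<open>F\<close> at the changed word,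
  \<open>raise\<close> takes weight \<open>(i, l)\<close> to \<open>(i + 1, l - 1)\<close>.\<close>

definition raise :: "letter \<Rightarrow> letter \<Rightarrow> complex"
  where "raise b a = (if b = (True, False) \<and> a = (False, True) then 1 else 0)"

definition lower :: "letter \<Rightarrow> letter \<Rightarrow> complex"
  where "lower b a = (if b = (False, True) \<and> a = (True, False) then 1 else 0)"

lemma weight_raise: "raise b a \<noteq> 0 \<Longrightarrow> of_bool (fst a) = of_bool (fst b) + (- 1 :: int) \<and> of_bool (snd a) = of_bool (snd b) + (1 :: int)"
  and weight_lower: "lower b a \<noteq> 0 \<Longrightarrow> of_bool (fst a) = of_bool (fst b) + (1 :: int) \<and> of_bool (snd a) = of_bool (snd b) + (- 1 :: int)"
  by (auto simp: raise_def lower_def split: if_splits)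

text \<open>The commutator of the matrices is diagonal, and its entry at each letter is the first
  bit minus the second. Summed over a word this gives
  \<open>card (fsts S w) - card (snds S w)\<close>.\<close>

lemma raise_lower_commutator:
  assumes S: "finite S" and F: "shifted_weight S i l F"
  shows "derivation S raise (derivation S lower F) = derivation S lower (derivation S raise F) + cscale (of_int (i - l)) F"
proof
  fix w
  show "derivation S raise (derivation S lower F) w =
      (derivation S lower (derivation S raise F) + cscale (of_int (i - l)) F) w"
  proof (cases "w \<in> words S")
    case w: True
    have "derivation S (\<lambda>a b. \<Sum>c\<in>UNIV. raise a c * lower c b) F w - derivation S (\<lambda>a b. \<Sum>c\<in>UNIV. lower a c * raise c b) F w =
        (\<Sum>x\<in>S. (of_bool (fst (w x)) - of_bool (snd (w x))) * F w)"
      unfolding derivation_def if_P[OF w] sum_subtractf[symmetric]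
    proof (rule sum.cong[OF refl])
      fix x
      have "w = w(x := w x)" by simp
      then show "(\<Sum>a\<in>UNIV. (\<Sum>c\<in>UNIV. raise (w x) c * lower c a) * F (w(x := a)) - (\<Sum>c\<in>UNIV. lower (w x) c * raise c a) * F (w(x := a))) =
          (of_bool (fst (w x)) - of_bool (snd (w x))) * F w"
        by (cases "w x"; cases "fst (w x)"; cases "snd (w x)") (auto simp: sum_letter raise_def lower_def)
    qed
    also have "\<dots> = (of_nat (card (fsts S w)) - of_nat (card (snds S w))) * F w"
      using S by (simp add: sum_distrib_right[symmetric] sum_subtractf fsts_def snds_def Int_def)
    also have "\<dots> = of_int (i - l) * F w"
    proof (cases "F w = 0")
      case False
      then have "i = int (card (fsts S w))" "l = int (card (snds S w))" using F by (auto simp: shifted_weight_def)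
      then show ?thesis by simp
    qed simp
    finally show ?thesis
      unfolding derivation_commutator[OF S w, of raise lower] by (simp add: cscale_apply)
  next
    case False
    then have "F w = 0" using F by (auto simp: shifted_weight_def)
    then show ?thesis using False by (simp add: derivation_def cscale_apply)
  qed
qed

text \<open>Since \<open>m\<close> annihilates row 0, the matrices \<open>X (1 + t m)\<close> stay
  in the slice. \<open>theta\<close> of \<open>F\<close> vanishes along this curve, and its
  derivative at \<open>t = 0\<close> is \<open>theta\<close> of the derivation of \<open>F\<close>.
  This invariance of the kernel replaces an action on the restricted space.\<close>

lemma theta_derivation_0:
  assumes S: "finite S" and m: "\<And>a c. (\<Sum>b\<in>UNIV. m a b * m b c) = 0"
    and tangent: "\<And>X a. row_mult (slice X 0) m a = 0" and F: "theta S rw cl F = 0"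
  shows "theta S rw cl (derivation S m F) = 0"
proof
  fix X
  let ?Y = "\<lambda>q x. slice X (rw (q x))"
  define g where "g t = (\<Sum>q\<in>col_perms S cl. of_int (sign q) *
    tensor_eval S F (\<lambda>x a. ?Y q x a + t * row_mult (?Y q x) m a))" for t :: complex
  have "g t = 0" for t
  proof -
    define X' where "X' r a = slice X r a + t * row_mult (slice X r) m a" for r a
    have "slice X' = X'" by (rule slice_eq_self) (simp_all add: X'_def tangent, simp_all add: slice_def)
    then have "g t = theta S rw cl F X'" by (simp add: g_def theta_def X'_def[abs_def])
    then show ?thesis using F by simp
  qed
  then have "g = (\<lambda>_. 0)" by auto
  then have "(g has_field_derivative 0) (at 0)" by simp
  moreover have "(g has_field_derivative (\<Sum>q\<in>col_perms S cl. of_int (sign q) *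
      tensor_eval S (derivation S m F) (\<lambda>x a. ?Y q x a + 0 * row_mult (?Y q x) m a))) (at 0)"
    unfolding g_def by (intro DERIV_sum DERIV_cmult tensor_eval_has_derivative[OF S m])
  ultimately have "(\<Sum>q\<in>col_perms S cl. of_int (sign q) *
      tensor_eval S (derivation S m F) (\<lambda>x a. ?Y q x a + 0 * row_mult (?Y q x) m a)) = 0"
    by (rule DERIV_unique[symmetric])
  then show "theta S rw cl (derivation S m F) X = 0 X" by (simp add: theta_def)
qed

lemma theta_raise_0:
  assumes S: "finite S" and F: "theta S rw cl F = 0"
  shows "theta S rw cl (derivation S raise F) = 0"
  by (rule theta_derivation_0[OF S _ _ F])
     (simp_all add: sum_letter raise_def row_mult_def slice_def)

lemma theta_lower_0:
  assumes S: "finite S" and F: "theta S rw cl F = 0"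
  shows "theta S rw cl (derivation S lower F) = 0"
  by (rule theta_derivation_0[OF S _ _ F])
     (simp_all add: sum_letter lower_def row_mult_def slice_def)

lemma theta_lower_funpow_0:
  assumes S: "finite S" and F: "theta S rw cl F = 0"
  shows "theta S rw cl ((derivation S lower ^^ k) F) = 0"
proof (induction k)
  case (Suc k)
  then show ?case unfolding funpow.simps comp_apply by (rule theta_lower_0[OF S])
qed (simp add: F)

text \<open>The standard identity \<open>[E, f^(k+1)] = (k + 1) f^k (H - k)\<close> in
  \<open>sl2\<close>, with \<open>H\<close> acting by \<open>i - l\<close>.\<close>

lemma raise_lower_funpow:
  assumes S: "finite S" and F: "shifted_weight S i l F"
  shows "derivation S raise ((derivation S lower ^^ Suc k) F) =
    (derivation S lower ^^ Suc k) (derivation S raise F) +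
    cscale (of_int ((int k + 1) * (i - l - int k))) ((derivation S lower ^^ k) F)"
proof (induction k)
  case 0
  show ?case using raise_lower_commutator[OF assms] by simp
next
  case (Suc k)
  let ?E = "derivation S raise" and ?f = "derivation S lower"
  have "shifted_weight S (i - int (Suc k)) (l + int (Suc k)) ((?f ^^ Suc k) F)"
    using shifted_weight_funpow[where m = lower and k = "Suc k", OF S F weight_lower]
    by (simp add: algebra_simps)
  from raise_lower_commutator[OF S this]
  have "?E ((?f ^^ Suc (Suc k)) F) = ?f (?E ((?f ^^ Suc k) F)) + cscale (of_int (i - l - 2 * int (Suc k))) ((?f ^^ Suc k) F)"
    by (simp add: algebra_simps)
  also have "?f (?E ((?f ^^ Suc k) F)) = (?f ^^ Suc (Suc k)) (?E F) + cscale (of_int ((int k + 1) * (i - l - int k))) ((?f ^^ Suc k) F)"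
    unfolding Suc.IH cfun_pair.linear_add[OF clinear_derivation] cfun_pair.linear_scale[OF clinear_derivation] by simp
  also have "\<dots> + cscale (of_int (i - l - 2 * int (Suc k))) ((?f ^^ Suc k) F) =
      (?f ^^ Suc (Suc k)) (?E F) + cscale (of_int ((int (Suc k) + 1) * (i - l - int (Suc k)))) ((?f ^^ Suc k) F)"
  proof -
    have "(int k + 1) * (i - l - int k) + (i - l - 2 * int (Suc k)) = (int (Suc k) + 1) * (i - l - int (Suc k))"
      by (simp add: algebra_simps)
    then show ?thesis
      unfolding add.assoc cfun.scale_left_distrib[symmetric] of_int_add[symmetric] by simp
  qed
  finally show ?case .
qed

text \<open>Modulo the kernel of \<open>theta\<close>, \<open>F\<close> would be a highest weight
  vector of negative weight \<open>i - l\<close>. Lowering it \<open>i + 1\<close> times gives 0, as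
  the first weight becomes negative. Applying \<open>raise\<close> then goes back one power at a
  time, because the factor \<open>(k + 1) (i - l - k)\<close> is never 0.\<close>

lemma theta_raise_injective:
  assumes S: "finite S" and F: "F \<in> weight_space S i l" and il: "i < l"
    and 0: "theta S rw cl (derivation S raise F) = 0"
  shows "theta S rw cl F = 0"
proof -
  let ?G = "\<lambda>k. (derivation S lower ^^ k) F"
  have wF: "shifted_weight S (int i) (int l) F" using F by (simp add: shifted_weight_iff)
  have step: "theta S rw cl (?G k) = 0" if "theta S rw cl (?G (Suc k)) = 0" for k
  proof -
    let ?c = "of_int ((int k + 1) * (int i - int l - int k)) :: complex"
    have "0 = theta S rw cl (derivation S raise (?G (Suc k)))"
      using theta_raise_0[OF S that] by simp
    also have "\<dots> = theta S rw cl ((derivation S lower ^^ Suc k) (derivation S raise F)) + cscale ?c (theta S rw cl (?G k))"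
      unfolding raise_lower_funpow[OF S wF] cfun_pair.linear_add[OF clinear_theta] cfun_pair.linear_scale[OF clinear_theta] ..
    also have "theta S rw cl ((derivation S lower ^^ Suc k) (derivation S raise F)) = 0"
      by (rule theta_lower_funpow_0[OF S 0])
    finally have "cscale ?c (theta S rw cl (?G k)) = 0" by (simp only: add_0_left)
    moreover have "?c \<noteq> 0" using il unfolding of_int_eq_0_iff by auto
    ultimately show ?thesis by (simp only: cfun.scale_eq_0_iff simp_thms)
  qed
  have "?G (Suc i) = 0"
    using shifted_weight_funpow[where m = lower and k = "Suc i", OF S wF weight_lower] by (intro shifted_weight_neg) auto
  then have top: "theta S rw cl (?G (Suc i)) = 0"
    using cfun_pair.linear_0[OF clinear_theta] by metis
  \<comment> \<open>Descending induction from the power \<open>Suc i\<close> down to 0, written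
    upwards in \<open>j\<close>; truncated subtraction makes the steps beyond \<open>Suc i\<close>
    trivial.\<close>
  have "theta S rw cl (?G (Suc i - j)) = 0" for j
  proof (induction j)
    case (Suc j)
    show ?case
    proof (cases "j < Suc i")
      case True
      then have "Suc i - j = Suc (Suc i - Suc j)" by simp
      then show ?thesis using step Suc.IH by metis
    next
      case False
      then have "Suc i - Suc j = Suc i - j" by simp
      then show ?thesis using Suc.IH by metis
    qed
  qed (use top in simp)
  from this[of "Suc i"] show ?thesis by simp
qed

text \<open>By the inclusion of kernels, the image of \<open>V\<close> under \<open>S\<close> is a
  quotient of its image under \<open>T\<close>. A linear section \<open>g\<close> of
  \<open>S\<close> followed by \<open>T\<close> embeds the former in the latter.\<close>

lemma dim_image_le_of_kernel:
  assumes S: "clinear S" and T: "clinear T" and V: "cfun.subspace V" "finite_dim (T ` V)"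
    and ker: "\<And>v. v \<in> V \<Longrightarrow> T v = 0 \<Longrightarrow> S v = 0"
  shows "cfun.dim (S ` V) \<le> cfun.dim (T ` V)"
proof -
  obtain g where g: "range g \<subseteq> V" "clinear g" "\<And>v. v \<in> S ` V \<Longrightarrow> S (g v) = v"
    using cfun_pair.linear_exists_right_inverse_on[OF S V(1)] by auto
  have SV: "cfun.subspace (S ` V)" by (rule cfun_pair.linear_subspace_image[OF S V(1)])
  have Tg: "clinear (\<lambda>v. T (g v))" by (rule clinear_compose[OF T g(2)])
  have "inj_on (\<lambda>v. T (g v)) (S ` V)"
    unfolding clinear_inj_on_iff[OF Tg SV] using ker g(1,3) by (metis rangeI subsetD)
  then have "cfun.dim (S ` V) = cfun.dim ((\<lambda>v. T (g v)) ` S ` V)"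
    by (rule dim_inj_image[OF Tg SV, symmetric])
  also have "\<dots> \<le> cfun.dim (T ` V)"
    using g(1) V(2) by (intro dim_mono_finite_dim) auto
  finally show ?thesis .
qed

section \<open>Monotonicity, symmetry and relabelling of the stable spaces\<close>

lemma finite_dim_weight_space: "finite S \<Longrightarrow> finite_dim (weight_space S i l)"
  by (rule finite_dim_subset[OF _ finite_dim_finite_support[of "words S"]]) (auto simp: weight_space_def)

lemma (in tail) stable_space_eq_theta:
  "i \<le> card Z \<Longrightarrow> stable_space S rw cl i l = theta (S \<union> Z) rw cl ` weight_space (S \<union> Z) i l"
  by (intro antisym stable_space_subset_theta theta_weight_space_subset)

text \<open>A tail with \<open>Suc i\<close> boxes is long enough to represent both spaces as images
  of full weight spaces. There \<open>raise\<close> maps the first weight to the second, and by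
  \<open>theta_raise_injective\<close> nothing is lost.\<close>

lemma (in tail) dim_stable_space_step:
  assumes il: "i < l" and iZ: "Suc i \<le> card Z"
  shows "cfun.dim (stable_space S rw cl i l) \<le> cfun.dim (stable_space S rw cl (Suc i) (l - 1))"
proof -
  let ?S = "S \<union> Z" and ?W = "weight_space (S \<union> Z)"
  let ?T = "theta ?S rw cl" and ?T' = "\<lambda>F. theta ?S rw cl (derivation ?S raise F)"
  have fin: "finite ?S" using finS finZ by simp
  have T': "clinear ?T'" by (rule clinear_compose[OF clinear_theta clinear_derivation])
  have "derivation ?S raise F \<in> ?W (Suc i) (l - 1)" if "F \<in> ?W i l" for F
    using shifted_weight_derivation[where m = raise, OF fin _ weight_raise, of "int i" "int l" F] that il
    by (simp add: shifted_weight_iff flip: shifted_weight_iff[of _ "Suc i"]) (simp add: of_nat_diff add.commute)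
  then have sub: "?T' ` ?W i l \<subseteq> ?T ` ?W (Suc i) (l - 1)" by blast
  have fin_dim: "finite_dim (?T ` ?W (Suc i) (l - 1))"
    by (intro finite_dim_image clinear_theta finite_dim_weight_space fin)
  have "cfun.dim (?T ` ?W i l) \<le> cfun.dim (?T' ` ?W i l)"
    using theta_raise_injective[OF fin _ il]
    by (intro dim_image_le_of_kernel clinear_theta T' subspace_weight_space finite_dim_subset[OF sub fin_dim]) auto
  also have "\<dots> \<le> cfun.dim (?T ` ?W (Suc i) (l - 1))"
    by (rule dim_mono_finite_dim[OF sub fin_dim])
  finally show ?thesis using iZ by (simp add: stable_space_eq_theta)
qed

lemma stable_gensI:
  "u \<in> words S \<Longrightarrow> card (fsts S u) + k = i \<Longrightarrow> card (snds S u) + k = l \<Longrightarrow>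
    (\<lambda>X. minors S rw cl u (slice X) * X 0 (True, True) ^ k) \<in> stable_gens S rw cl i l"
  unfolding stable_gens_def by blast

text \<open>Exchanging the two middle columns of the matrix commutes with passing to the slice, and
  it swaps the bits of every letter and hence the two weights.\<close>

lemma dim_stable_space_swap:
  "cfun.dim (stable_space S rw cl i l) = cfun.dim (stable_space S rw cl l i)"
proof -
  define W :: "((nat \<Rightarrow> letter \<Rightarrow> complex) \<Rightarrow> complex) \<Rightarrow> (nat \<Rightarrow> letter \<Rightarrow> complex) \<Rightarrow> complex"
    where "W h = (\<lambda>X. h (\<lambda>r a. X r (prod.swap a)))" for h
  have WW: "W (W h) = h" for h by (simp add: W_def)
  have Wlin: "clinear W" by (rule clinearI) (auto simp: W_def cscale_def)
  have gens: "W h \<in> stable_gens S rw cl l i" if h: "h \<in> stable_gens S rw cl i l" for h i l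
  proof -
    obtain u k where u: "u \<in> words S" "card (fsts S u) + k = i" "card (snds S u) + k = l"
      and h: "h = (\<lambda>X. minors S rw cl u (slice X) * X 0 (True, True) ^ k)"
      using h by (auto simp: stable_gens_def)
    let ?u = "restrict (\<lambda>x. prod.swap (u x)) S"
    have "slice (\<lambda>r a. X r (prod.swap a)) r a = slice X r (prod.swap a)" for X r a
      by (cases a) (auto simp: slice_def)
    then have Wh: "W h = (\<lambda>X. minors S rw cl ?u (slice X) * X 0 (True, True) ^ k)"
      by (simp add: W_def h minors_def)
    have "fsts S ?u = snds S u" "snds S ?u = fsts S u" by (auto simp: fsts_def snds_def)
    then show ?thesis
      unfolding Wh using u by (intro stable_gensI) simp_all
  qed
  have "W ` stable_gens S rw cl i l = stable_gens S rw cl l i"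
  proof
    show "stable_gens S rw cl l i \<subseteq> W ` stable_gens S rw cl i l"
    proof
      fix h assume "h \<in> stable_gens S rw cl l i"
      then have "W h \<in> stable_gens S rw cl i l" by (rule gens)
      then show "h \<in> W ` stable_gens S rw cl i l" using WW by (metis imageI)
    qed
  qed (use gens in blast)
  then have "stable_space S rw cl l i = W ` stable_space S rw cl i l"
    unfolding stable_space_def using cfun_pair.linear_span_image[OF Wlin] by metis
  moreover have "inj_on W (stable_space S rw cl i l)" by (rule inj_on_inverseI[where g = W]) (rule WW)
  moreover have "cfun.subspace (stable_space S rw cl i l)" by (simp add: stable_space_def)
  ultimately show ?thesis using dim_inj_image[OF Wlin] by simp
qed

lemma map_permutation_col_perms:
  assumes \<beta>: "bij_betw \<beta> S S'" and cl: "\<And>x. x \<in> S \<Longrightarrow> cl' (\<beta> x) = cl x" and q: "q \<in> col_perms S cl"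
  shows "map_permutation S \<beta> q \<in> col_perms S' cl'"
proof -
  have perm: "q permutes S" using q by (simp add: col_perms_def)
  have "cl' (map_permutation S \<beta> q y) = cl' y" if "y \<in> S'" for y
  proof -
    have "y \<in> \<beta> ` S" using that bij_betw_imp_surj_on[OF \<beta>] by simp
    then obtain x where x: "x \<in> S" "y = \<beta> x" by blast
    have "map_permutation S \<beta> q y = \<beta> (q x)"
      unfolding x(2) using \<beta> x(1) by (intro map_permutation_apply) (auto simp: bij_betw_def)
    moreover have "q x \<in> S" using perm x(1) by (simp add: permutes_in_image)
    ultimately show ?thesis using q x cl by (simp add: col_perms_def)
  qed
  then show ?thesis using map_permutation_permutes[OF \<beta> perm] by (simp add: col_perms_def)
qed

text \<open>Transport along \<open>\<beta>\<close>: \<open>map_permutation\<close> carries column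
  permutations to column permutations with the same sign. Relabelling is needed because the
  numbering of the boxes of a padded diagram changes with \<open>d\<close>.\<close>

lemma stable_gens_relabel:
  assumes S: "finite S" and \<beta>: "bij_betw \<beta> S S'"
    and rw: "\<And>x. x \<in> S \<Longrightarrow> rw' (\<beta> x) = rw x" and cl: "\<And>x. x \<in> S \<Longrightarrow> cl' (\<beta> x) = cl x"
  shows "stable_gens S rw cl i l \<subseteq> stable_gens S' rw' cl' i l"
proof
  fix h assume "h \<in> stable_gens S rw cl i l"
  then obtain u k where u: "u \<in> words S" "card (fsts S u) + k = i" "card (snds S u) + k = l"
    and h: "h = (\<lambda>X. minors S rw cl u (slice X) * X 0 (True, True) ^ k)"
    by (auto simp: stable_gens_def)
  define \<gamma> where "\<gamma> = inv_into S \<beta>"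
  have \<gamma>: "bij_betw \<gamma> S' S" unfolding \<gamma>_def by (rule bij_betw_inv_into[OF \<beta>])
  have \<gamma>\<beta>: "\<gamma> (\<beta> x) = x" if "x \<in> S" for x
    unfolding \<gamma>_def using \<beta> that by (intro inv_into_f_f) (auto simp: bij_betw_def)
  have \<beta>\<gamma>: "\<beta> (\<gamma> y) = y" if "y \<in> S'" for y
    unfolding \<gamma>_def using \<beta> that by (intro f_inv_into_f) (auto simp: bij_betw_def)
  have \<beta>S: "\<beta> x \<in> S'" if "x \<in> S" for x using \<beta> that by (auto simp: bij_betw_def)
  have \<gamma>S: "\<gamma> y \<in> S" if "y \<in> S'" for y using \<gamma> that by (auto simp: bij_betw_def)
  have inj: "inj_on \<beta> S" using \<beta> by (simp add: bij_betw_def)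
  define u' where "u' = restrict (\<lambda>y. u (\<gamma> y)) S'"
  have minors: "minors S rw cl u X = minors S' rw' cl' u' X" for X
    unfolding minors_def
  proof (rule sum.reindex_bij_witness[where i = "map_permutation S' \<gamma>" and j = "map_permutation S \<beta>"])
    fix q assume q: "q \<in> col_perms S cl"
    then have perm: "q permutes S" by (simp add: col_perms_def)
    show "map_permutation S' \<gamma> (map_permutation S \<beta> q) = q"
      by (rule map_permutation_compose_inv[OF \<beta> perm \<gamma>\<beta>])
    show "map_permutation S \<beta> q \<in> col_perms S' cl'"
      by (rule map_permutation_col_perms[OF \<beta> cl q])
    have "(\<Prod>y\<in>S'. X (rw' (map_permutation S \<beta> q y)) (u' y)) = (\<Prod>x\<in>S. X (rw (q x)) (u x))"
      unfolding prod.reindex_bij_betw[OF \<beta>, symmetric]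
    proof (rule prod.cong[OF refl])
      fix x assume x: "x \<in> S"
      have "q x \<in> S" using perm x by (simp add: permutes_in_image)
      then show "X (rw' (map_permutation S \<beta> q (\<beta> x))) (u' (\<beta> x)) = X (rw (q x)) (u x)"
        using x by (simp add: map_permutation_apply[OF inj] rw u'_def \<beta>S \<gamma>\<beta>)
    qed
    then show "of_int (sign (map_permutation S \<beta> q)) * (\<Prod>y\<in>S'. X (rw' (map_permutation S \<beta> q y)) (u' y)) =
        of_int (sign q) * (\<Prod>x\<in>S. X (rw (q x)) (u x))"
      by (simp add: sign_map_permutation[OF inj perm S])
  next
    fix q assume q: "q \<in> col_perms S' cl'"
    then have perm: "q permutes S'" by (simp add: col_perms_def)
    show "map_permutation S \<beta> (map_permutation S' \<gamma> q) = q"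
      by (rule map_permutation_compose_inv[OF \<gamma> perm \<beta>\<gamma>])
    show "map_permutation S' \<gamma> q \<in> col_perms S cl"
      using map_permutation_col_perms[OF \<gamma> _ q, of cl] cl \<gamma>S \<beta>\<gamma> by metis
  qed
  have "card (fsts S' u') = card (fsts S u)" "card (snds S' u') = card (snds S u)"
  proof -
    have "fsts S' u' = \<beta> ` fsts S u" "snds S' u' = \<beta> ` snds S u"
      using \<beta>S \<gamma>S \<gamma>\<beta> \<beta>\<gamma> by (force simp: fsts_def snds_def u'_def image_iff)+
    moreover have "inj_on \<beta> (fsts S u)" "inj_on \<beta> (snds S u)"
      using inj_on_subset[OF inj] by (auto simp: fsts_def snds_def)
    ultimately show "card (fsts S' u') = card (fsts S u)" "card (snds S' u') = card (snds S u)"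
      by (simp_all add: card_image)
  qed
  then show "h \<in> stable_gens S' rw' cl' i l"
    unfolding h minors using u by (intro stable_gensI) (simp_all add: u'_def)
qed

lemma stable_space_relabel:
  assumes S: "finite S" and \<beta>: "bij_betw \<beta> S S'"
    and rw: "\<And>x. x \<in> S \<Longrightarrow> rw' (\<beta> x) = rw x" and cl: "\<And>x. x \<in> S \<Longrightarrow> cl' (\<beta> x) = cl x"
  shows "stable_space S rw cl i l = stable_space S' rw' cl' i l"
proof -
  have S': "finite S'" using S \<beta> bij_betw_finite by blast
  have inv: "inv_into S \<beta> y \<in> S" "\<beta> (inv_into S \<beta> y) = y" if "y \<in> S'" for y
    using \<beta> that by (auto simp: bij_betw_def inv_into_into f_inv_into_f)
  have "stable_gens S' rw' cl' i l \<subseteq> stable_gens S rw cl i l"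
    using inv rw cl by (intro stable_gens_relabel[OF S' bij_betw_inv_into[OF \<beta>]]) metis+
  then show ?thesis
    unfolding stable_space_def using stable_gens_relabel[where rw' = rw' and cl' = cl', OF S \<beta> rw cl] by (metis antisym)
qed

section \<open>Reduced Kronecker coefficients of two rows\<close>

definition first_part :: "nat list \<Rightarrow> nat"
  where "first_part nu = (if nu = [] then 0 else hd nu)"

text \<open>The boxes of a padded diagram that lie in a column of length at least two.\<close>

definition core_boxes :: "nat list \<Rightarrow> (nat \<times> nat) set"
  where "core_boxes nu = diagram (first_part nu # nu)"

text \<open>With boxes given by their coordinates nothing here refers to \<open>d\<close>, so the
  stable value is independent of it by construction.\<close>

definition stable_multiplicity :: "nat list \<Rightarrow> nat \<Rightarrow> nat \<Rightarrow> nat"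
  where "stable_multiplicity nu i l = cfun.dim (stable_space (core_boxes nu) fst snd i l)"

lemma first_part_ge: "is_partition nu \<Longrightarrow> x \<in> set nu \<Longrightarrow> x \<le> first_part nu"
  by (cases nu) (auto simp: is_partition_def first_part_def)

lemma finite_core_boxes: "finite (core_boxes nu)"
  unfolding core_boxes_def using bij_betw_finite[OF bij_betw_box_of] by blast

lemma core_boxes_col: "is_partition nu \<Longrightarrow> b \<in> core_boxes nu \<Longrightarrow> snd b < first_part nu"
proof -
  assume nu: "is_partition nu" and b: "b \<in> core_boxes nu"
  then have b': "fst b < length (first_part nu # nu)" "snd b < (first_part nu # nu) ! fst b"
    by (auto simp: core_boxes_def diagram_def)
  have "(first_part nu # nu) ! fst b \<in> set (first_part nu # nu)" using b'(1) by (rule nth_mem)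
  then have "(first_part nu # nu) ! fst b \<le> first_part nu" using first_part_ge[OF nu] by auto
  then show ?thesis using b'(2) by simp
qed

text \<open>The monotonicity step needs sufficiently many tail boxes but no actual diagram of size
  \<open>d\<close>, so a tail of any length is attached to the core.\<close>

lemma tail_core_boxes:
  assumes "is_partition nu"
  shows "tail (core_boxes nu) ({0} \<times> {first_part nu..<first_part nu + n}) fst snd"
proof
  show "core_boxes nu \<inter> {0} \<times> {first_part nu..<first_part nu + n} = {}"
    using core_boxes_col[OF assms] by fastforce
  show "snd x \<noteq> snd z" if "z \<in> {0} \<times> {first_part nu..<first_part nu + n}" "x \<in> core_boxes nu" for x z
    using core_boxes_col[OF assms that(2)] that(1) by auto
  show "inj_on snd ({0 :: nat} \<times> {first_part nu..<first_part nu + n})" by (auto intro: inj_onI)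
qed (auto simp: finite_core_boxes)

lemma stable_multiplicity_step:
  assumes "is_partition nu" "i < l"
  shows "stable_multiplicity nu i l \<le> stable_multiplicity nu (Suc i) (l - 1)"
proof -
  interpret tail "core_boxes nu" "{0} \<times> {first_part nu..<first_part nu + Suc i}" fst snd
    by (rule tail_core_boxes[OF assms(1)])
  show ?thesis
    unfolding stable_multiplicity_def by (rule dim_stable_space_step[OF assms(2)]) (simp add: card_cartesian_product)
qed

text \<open>The condition \<open>i + n \<le> k\<close> keeps the first weight below the second at
  each of the \<open>n\<close> steps.\<close>

lemma stable_multiplicity_mono:
  assumes "is_partition nu" "i + n \<le> k"
  shows "stable_multiplicity nu i (k + n) \<le> stable_multiplicity nu (i + n) k"
  using assms(2)
proof (induction n arbitrary: i)
  case (Suc n)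
  have "stable_multiplicity nu i (k + Suc n) \<le> stable_multiplicity nu (Suc i) (k + n)"
    using stable_multiplicity_step[OF assms(1), of i "k + Suc n"] Suc.prems by simp
  also have "\<dots> \<le> stable_multiplicity nu (i + Suc n) k"
    using Suc.IH[of "Suc i"] Suc.prems by simp
  finally show ?case .
qed simp

lemma stable_multiplicity_commute: "stable_multiplicity nu i l = stable_multiplicity nu l i"
  unfolding stable_multiplicity_def by (rule dim_stable_space_swap)

text \<open>Apart from its core, the padded diagram has
  \<open>d - sum_list nu - first_part nu\<close> boxes, all in the first row, and the bound on
  \<open>d\<close> makes them at least \<open>3 * (i + l)\<close>, as the lift requires. It also
  makes the padded lists partitions of \<open>d\<close>.\<close>

lemma kronecker_stable:
  assumes nu: "is_partition nu" and d: "sum_list nu + first_part nu + 3 * (i + l) < d"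
  shows "kronecker d (padded (row_partition i) d) (padded (row_partition l) d) (padded nu d) = stable_multiplicity nu i l"
proof -
  define \<gamma> where "\<gamma> = padded nu d"
  have \<gamma>: "\<gamma> = (d - sum_list nu) # nu" using d by (simp add: \<gamma>_def padded_def row_partition_def)
  interpret partition_of \<gamma> d
  proof
    show "sorted_wrt (\<ge>) \<gamma>" using nu d first_part_ge[OF nu] by (fastforce simp: \<gamma> is_partition_def)
    show "sum_list \<gamma> = d" using d by (simp add: \<gamma>)
  qed
  define S where "S = {x. x < d \<and> (row_of \<gamma> x \<noteq> 0 \<or> col_of \<gamma> x < first_part nu)}"
  define Z where "Z = {x. x < d \<and> row_of \<gamma> x = 0 \<and> first_part nu \<le> col_of \<gamma> x}"
  have SZ: "S \<union> Z = {..<d}" by (auto simp: S_def Z_def)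
  have S_col: "col_of \<gamma> x < first_part nu" if "x \<in> S" for x
  proof (cases "row_of \<gamma> x")
    case (Suc r)
    have x: "row_of \<gamma> x < length \<gamma>" "col_of \<gamma> x < \<gamma> ! row_of \<gamma> x"
      using box_in_diagram that by (auto simp: S_def)
    then have "nu ! r \<in> set nu" using Suc by (simp add: \<gamma>)
    then show ?thesis using x(2) Suc first_part_ge[OF nu] by (fastforce simp: \<gamma>)
  qed (use that in \<open>simp add: S_def\<close>)
  interpret tail S Z "row_of \<gamma>" "col_of \<gamma>"
  proof
    show "col_of \<gamma> x \<noteq> col_of \<gamma> z" if "z \<in> Z" "x \<in> S" for x z
      using S_col[OF that(2)] that(1) by (auto simp: Z_def)
    show "inj_on (col_of \<gamma>) Z" using box_eqI by (auto simp: Z_def intro!: inj_onI)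
  qed (auto simp: S_def Z_def)
  have "{first_part nu..<d - sum_list nu} \<subseteq> col_of \<gamma> ` Z"
  proof
    fix j assume j: "j \<in> {first_part nu..<d - sum_list nu}"
    then obtain x where "x < d" "row_of \<gamma> x = 0" "col_of \<gamma> x = j"
      using box_exists[of 0 j] by (auto simp: \<gamma>)
    then show "j \<in> col_of \<gamma> ` Z" using j by (auto simp: Z_def)
  qed
  then have "card {first_part nu..<d - sum_list nu} \<le> card (col_of \<gamma> ` Z)"
    using finZ by (intro card_mono) auto
  also have "\<dots> \<le> card Z" by (rule card_image_le[OF finZ])
  finally have cardZ: "3 * (i + l) \<le> card Z" using d by simp
  have box: "bij_betw (box_of \<gamma>) S (core_boxes nu)"
  proof (rule bij_betw_subset[OF bij_box])
    show "S \<subseteq> {..<d}" by (auto simp: S_def)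
    have fits: "first_part nu < d - sum_list nu" using d by simp
    show "box_of \<gamma> ` S = core_boxes nu"
    proof (intro equalityI subsetI)
      fix b assume "b \<in> box_of \<gamma> ` S"
      then obtain x where x: "x \<in> S" "b = box_of \<gamma> x" by blast
      then have "row_of \<gamma> x < length \<gamma>" "col_of \<gamma> x < \<gamma> ! row_of \<gamma> x"
        using box_in_diagram by (auto simp: S_def)
      then show "b \<in> core_boxes nu"
        using x S_col[OF x(1)] by (cases "row_of \<gamma> x") (auto simp: core_boxes_def diagram_def box_of_def \<gamma>)
    next
      fix b assume b: "b \<in> core_boxes nu"
      obtain r j where rj: "b = (r, j)" by force
      have "r < length \<gamma>" "j < \<gamma> ! r" "r \<noteq> 0 \<or> j < first_part nu"
        using b fits by (cases r; auto simp: core_boxes_def diagram_def \<gamma> rj)+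
      then obtain x where "x < d" "row_of \<gamma> x = r" "col_of \<gamma> x = j" "r \<noteq> 0 \<or> j < first_part nu"
        using box_exists by blast
      then have "x \<in> S" "box_of \<gamma> x = b" by (auto simp: S_def box_of_def rj)
      then show "b \<in> box_of \<gamma> ` S" by blast
    qed
  qed
  have "kronecker d (padded (row_partition i) d) (padded (row_partition l) d) \<gamma> =
      cfun.dim (theta {..<d} (row_of \<gamma>) (col_of \<gamma>) ` highest_weight_space {..<d} i l)"
    using kronecker_eq_dim[OF partition_of_axioms, of i l] d dim_act_eq_dim_theta by simp
  also have "\<dots> = cfun.dim (stable_space S (row_of \<gamma>) (col_of \<gamma>) i l)"
    using theta_highest_weight_space[OF cardZ] by (simp add: SZ)
  also have "\<dots> = stable_multiplicity nu i l"
    unfolding stable_multiplicity_def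
    by (subst stable_space_relabel[OF finS box]) (auto simp: box_of_def)
  finally show ?thesis by (simp add: \<gamma>_def)
qed

lemma reduced_kronecker_rows:
  assumes "is_partition nu"
  shows "reduced_kronecker (row_partition i) (row_partition l) nu = stable_multiplicity nu i l"
  unfolding reduced_kronecker_def
proof (rule the_equality)
  let ?k = "\<lambda>d. kronecker d (padded (row_partition i) d) (padded (row_partition l) d) (padded nu d)"
  have ev: "\<forall>\<^sub>F d in sequentially. ?k d = stable_multiplicity nu i l"
    unfolding eventually_sequentially using kronecker_stable[OF assms]
    by (intro exI[of _ "Suc (sum_list nu + first_part nu + 3 * (i + l))"]) auto
  then show "\<forall>\<^sub>F d in sequentially. ?k d = stable_multiplicity nu i l" .
  fix g assume "\<forall>\<^sub>F d in sequentially. ?k d = g"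
  with ev have "\<forall>\<^sub>F d in sequentially. g = stable_multiplicity nu i l"
    by eventually_elim simp
  then show "g = stable_multiplicity nu i l" by simp
qed

theorem theorem5p4:
  "(\<forall>(a::nat) (b::nat) nu. even (a + b) \<longrightarrow> is_partition nu \<longrightarrow>
      reduced_kronecker (row_partition ((a + b) div 2)) (row_partition ((a + b) div 2)) nu
        \<ge> reduced_kronecker (row_partition a) (row_partition b) nu) \<and>
   (\<forall>(i::nat) (j::nat) (k::nat) (l::nat) nu.
      i < j \<longrightarrow> j \<le> k \<longrightarrow> k < l \<longrightarrow> j + k = i + l \<longrightarrow> is_partition nu \<longrightarrow>
      reduced_kronecker (row_partition j) (row_partition k) nu
        \<ge> reduced_kronecker (row_partition i) (row_partition l) nu)"
proof (intro conjI allI impI)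
  fix a b :: nat and nu assume ab: "even (a + b)" and nu: "is_partition nu"
  have *: "stable_multiplicity nu a b \<le> stable_multiplicity nu ((a + b) div 2) ((a + b) div 2)"
    if "a \<le> b" "even (a + b)" for a b :: nat
  proof -
    \<comment> \<open>With \<open>n\<close> half the difference, the mean is \<open>a + n\<close>,
      and \<open>n\<close> steps of the monotonicity lead from \<open>(a, b)\<close> to the pair of
      means.\<close>
    obtain n where n: "b = a + 2 * n" using \<open>a \<le> b\<close> \<open>even (a + b)\<close> by (metis dvdE even_add even_diff_nat le_add_diff_inverse)
    then have half: "(a + b) div 2 = a + n" and b: "b = a + n + n" by simp_all
    show ?thesis unfolding half by (subst b) (rule stable_multiplicity_mono[OF nu order.refl])
  qed
  show "reduced_kronecker (row_partition ((a + b) div 2)) (row_partition ((a + b) div 2)) nu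
      \<ge> reduced_kronecker (row_partition a) (row_partition b) nu"
    using *[of a b] *[of b a] ab stable_multiplicity_commute[of nu a b]
    by (cases "a \<le> b") (simp_all add: reduced_kronecker_rows[OF nu] add.commute)
next
  fix i j k l :: nat and nu
  assume "i < j" "j \<le> k" "k < l" "j + k = i + l" and nu: "is_partition nu"
  \<comment> \<open>From \<open>(i, l)\<close> to \<open>(j, k)\<close> it takes
    \<open>j - i\<close> steps, on both sides because the sums agree.\<close>
  then have "i + (j - i) = j" "k + (j - i) = l" "i + (j - i) \<le> k" by auto
  then show "reduced_kronecker (row_partition j) (row_partition k) nu
      \<ge> reduced_kronecker (row_partition i) (row_partition l) nu"
    using stable_multiplicity_mono[OF nu, of i "j - i" k] by (simp add: reduced_kronecker_rows[OF nu])
qed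

end
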